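(* Let $P\subset\mathbb R^r$ be a rational convex polytope and let $\delta$ be a piece-wise quadratic function in the variables $n,x$, where $x=(x_1,\dots,x_r)$. Suppose that $\delta$ depends on additional parameters $m\in\mathbb R^r$, and that the dependence of $\delta$ on $m$ is polynomial with real coefficients. Let $\mathrm{js}_{\mathbb R}(m)$ denote the coefficient of $n^2$ (for $n$ large enough) in $\hat\delta_{\mathbb R}(n)=\max\{\delta(m,n,x)\mid x\in nP\}$, that is, $\mathrm{js}_{\mathbb R}(m)=\max\{\delta_2(m,x)\mid x\in P\}$, where $\delta_2(m,x)$ is the coefficient of $n^2$ in $\delta(m,n,nx)$. Then $\mathrm{js}_{\mathbb R}:\mathbb R^r\to\mathbb R$ is a piece-wise rational function of $m$, defined on finitely many sectors whose corner locus is a closed semi-algebraic set of dimension at most $r-1$. Moreover, $\mathrm{js}_{\mathbb R}$ is continuous.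
   Context: The corner locus of a piece-wise function on $\mathbb R^r$ is the set of points where the function is not differentiable. A semi-algebraic set is one defined by polynomial equalities and inequalities. For $x\in P$, $\delta(m,n,nx)$ is a quadratic polynomial in $n$ whose coefficients are piece-wise quadratic polynomials in $x$; substituting $x\mapsto nx$ gives $\hat\delta_{\mathbb R}(n)=\max\{\delta(m,n,nx)\mid x\in P\}$, which for $n$ large enough is given by a quadratic polynomial in $n$.
   Formalization: The corner locus is taken as the closure of the set of non-differentiable points, since that set itself need not be closed (js = max(0, m1 m2) is differentiable at 0 but nowhere else on the axes); the set itself is shown to be semi-algebraic. *)

theory Defs
  imports "HOL-Analysis.Analysis" "HOL-Computational_Algebra.Polynomial"
begin

section \<open>Polytopes and piece-wise quadratic functions\<close>

definition rational_polytope :: "(real ^ 'r) set \<Rightarrow> bool" where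
  "rational_polytope P \<longleftrightarrow>
     (\<exists>V. finite V \<and> (\<forall>v\<in>V. \<forall>i. v $ i \<in> \<rat>) \<and> P = convex hull V)"

text \<open>A polynomial of degree at most two in the variables \<open>(n, x)\<close>, whose coefficients are
  polynomials with real coefficients in the parameter \<open>m\<close>.\<close>

definition param_quadratic ::
    "(real ^ 'r \<Rightarrow> real \<Rightarrow> real ^ 'r \<Rightarrow> real) \<Rightarrow> bool" where
  "param_quadratic q \<longleftrightarrow>
     (\<exists>a b c d e f.
        real_polynomial_function a \<and> (\<forall>i. real_polynomial_function (b i)) \<and>
        (\<forall>i j. real_polynomial_function (c i j)) \<and> real_polynomial_function d \<and>
        (\<forall>i. real_polynomial_function (e i)) \<and> real_polynomial_function f \<and>
        (\<forall>m n x. q m n x =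
           a m * n\<^sup>2 + (\<Sum>i\<in>UNIV. b i m * n * x $ i)
             + (\<Sum>i\<in>UNIV. \<Sum>j\<in>UNIV. c i j m * x $ i * x $ j)
             + d m * n + (\<Sum>i\<in>UNIV. e i m * x $ i) + f m))"

text \<open>\<open>\<delta>\<close> is piece-wise quadratic in \<open>(n, x)\<close> on the cone over \<open>P\<close>. The pieces do not depend
  on \<open>m\<close>. They are polyhedral cones in \<open>(n, x)\<close>-space, i.e. they are given by homogeneous linear
  inequalities; this is what makes \<open>\<delta> m n (n x)\<close> a quadratic polynomial in \<open>n\<close> for every fixed
  \<open>x \<in> P\<close>. The pieces are closed, so \<open>\<delta>\<close> is continuous across common boundaries.\<close>

definition piecewise_quadratic ::
    "(real ^ 'r) set \<Rightarrow> (real ^ 'r \<Rightarrow> real \<Rightarrow> real ^ 'r \<Rightarrow> real) \<Rightarrow> bool" where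
  "piecewise_quadratic P \<delta> \<longleftrightarrow>
     (\<exists>\<C> :: (real \<times> (real ^ 'r)) set set.
        finite \<C> \<and> (\<forall>C\<in>\<C>. polyhedron C \<and> cone C) \<and>
        (\<forall>n>0. \<forall>x \<in> (*\<^sub>R) n ` P. (n, x) \<in> \<Union>\<C>) \<and>
        (\<forall>C\<in>\<C>. \<exists>q. param_quadratic q \<and>
           (\<forall>m. \<forall>n>0. \<forall>x \<in> (*\<^sub>R) n ` P. (n, x) \<in> C \<longrightarrow> \<delta> m n x = q m n x)))"

section \<open>The Jones slope function\<close>

definition eventually_quadratic :: "(nat \<Rightarrow> real) \<Rightarrow> real poly \<Rightarrow> bool" where
  "eventually_quadratic g p \<longleftrightarrow>
     degree p \<le> 2 \<and> (\<forall>\<^sub>F n in sequentially. g n = poly p (real n))"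

definition n2_coeff :: "(nat \<Rightarrow> real) \<Rightarrow> real" where
  "n2_coeff g = (THE c. \<exists>p. eventually_quadratic g p \<and> coeff p 2 = c)"

lemma n2_coeff_eq:
  assumes "eventually_quadratic g p"
  shows "n2_coeff g = coeff p 2"
proof -
  have "p' = p" if "eventually_quadratic g p'" for p'
  proof -
    have "\<forall>\<^sub>F n in sequentially. g n = poly p (real n)"
      "\<forall>\<^sub>F n in sequentially. g n = poly p' (real n)"
      using assms that by (simp_all add: eventually_quadratic_def)
    then have "\<forall>\<^sub>F n in sequentially. poly (p' - p) (real n) = 0"
      by eventually_elim simp
    then obtain N where N: "\<forall>n\<ge>N. poly (p' - p) (real n) = 0"
      by (auto simp: eventually_sequentially)
    have "infinite (real ` {N..})"
      by (simp add: finite_image_iff infinite_Ici)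
    moreover have "real ` {N..} \<subseteq> {x. poly (p' - p) x = 0}"
      using N by auto
    ultimately have "infinite {x. poly (p' - p) x = 0}"
      using finite_subset by blast
    then show "p' = p"
      using poly_roots_finite[of "p' - p"] by auto
  qed
  then show ?thesis
    unfolding n2_coeff_def using assms by (intro the_equality) blast+
qed

definition delta_hat ::
    "(real ^ 'r) set \<Rightarrow> (real ^ 'r \<Rightarrow> real \<Rightarrow> real ^ 'r \<Rightarrow> real) \<Rightarrow> real ^ 'r \<Rightarrow> nat \<Rightarrow> real" where
  "delta_hat P \<delta> m n = (GREATEST v. v \<in> \<delta> m (real n) ` ((*\<^sub>R) (real n) ` P))"

definition js :: "(real ^ 'r) set \<Rightarrow> (real ^ 'r \<Rightarrow> real \<Rightarrow> real ^ 'r \<Rightarrow> real) \<Rightarrow> real ^ 'r \<Rightarrow> real" where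
  "js P \<delta> m = n2_coeff (delta_hat P \<delta> m)"

definition delta2 :: "(real ^ 'r \<Rightarrow> real \<Rightarrow> real ^ 'r \<Rightarrow> real) \<Rightarrow> real ^ 'r \<Rightarrow> real ^ 'r \<Rightarrow> real" where
  "delta2 \<delta> m x = n2_coeff (\<lambda>n. \<delta> m (real n) (real n *\<^sub>R x))"

section \<open>Semi-algebraic sets and piece-wise rational functions\<close>

definition basic_semialgebraic :: "(real ^ 'r) set \<Rightarrow> bool" where
  "basic_semialgebraic S \<longleftrightarrow>
     (\<exists>E I. finite E \<and> finite I \<and> (\<forall>p \<in> E \<union> I. real_polynomial_function p) \<and>
            S = {x. (\<forall>p\<in>E. p x = 0) \<and> (\<forall>p\<in>I. p x > 0)})"

definition semialgebraic :: "(real ^ 'r) set \<Rightarrow> bool" where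
  "semialgebraic S \<longleftrightarrow>
     (\<exists>\<B>. finite \<B> \<and> (\<forall>B\<in>\<B>. basic_semialgebraic B) \<and> S = \<Union>\<B>)"

text \<open>The largest \<open>d\<close> such that the set contains a \<open>d\<close>-cell, i.e. a homeomorphic copy of
  \<open>\<real>\<^sup>d\<close> (equivalently, of an open \<open>d\<close>-cube). Here \<open>\<real>\<^sup>d\<close> is a \<open>d\<close>-dimensional linear subspace of
  the ambient space. The empty set gets dimension 0.\<close>

definition semialg_dim :: "(real ^ 'r) set \<Rightarrow> nat" where
  "semialg_dim S =
     Sup {d. \<exists>(V :: (real ^ 'r) set) T. subspace V \<and> dim V = d \<and> T \<subseteq> S \<and> V homeomorphic T}"

definition piecewise_rational :: "(real ^ 'r \<Rightarrow> real) \<Rightarrow> bool" where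
  "piecewise_rational f \<longleftrightarrow>
     (\<exists>\<S>. finite \<S> \<and> \<Union>\<S> = UNIV \<and>
        (\<forall>S\<in>\<S>. semialgebraic S \<and>
           (\<exists>p q. real_polynomial_function p \<and> real_polynomial_function q \<and>
                  (\<forall>m\<in>S. q m \<noteq> 0 \<and> f m = p m / q m))))"

definition nondiff_set :: "(real ^ 'r \<Rightarrow> real) \<Rightarrow> (real ^ 'r) set" where
  "nondiff_set f = {x. \<not> f differentiable (at x)}"

text \<open>Differentiability of a piece-wise function at a point is meant on a neighbourhood of the
  point. With the purely pointwise notion, the corner locus need not be closed: for
  \<open>\<delta> m n x = m\<^sub>1 m\<^sub>2 n x\<^sub>1\<close> and \<open>P = [0,1] \<times> {0}\<close> one gets \<open>js m = max 0 (m\<^sub>1 m\<^sub>2)\<close>, which is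
  differentiable at the origin but at no other point of the two coordinate axes.\<close>

definition corner_locus :: "(real ^ 'r \<Rightarrow> real) \<Rightarrow> (real ^ 'r) set" where
  "corner_locus f = {x. \<not> (\<exists>U. open U \<and> x \<in> U \<and> f differentiable_on U)}"

lemma corner_locus_eq_closure: "corner_locus f = closure (nondiff_set f)"
proof -
  have *: "f differentiable_on U \<longleftrightarrow> U \<inter> nondiff_set f = {}" if "open U" for U
  proof -
    have "f differentiable_on U \<longleftrightarrow> (\<forall>x\<in>U. f differentiable (at x))"
      unfolding differentiable_on_def using at_within_open[OF _ that] by (metis (no_types))
    then show ?thesis
      unfolding nondiff_set_def by blast
  qed
  show ?thesis
  proof (intro set_eqI iffI)
    fix x assume x: "x \<in> corner_locus f"
    show "x \<in> closure (nondiff_set f)"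
    proof (rule ccontr)
      let ?U = "- closure (nondiff_set f)"
      assume "x \<notin> closure (nondiff_set f)"
      moreover have "open ?U" by (rule open_Compl[OF closed_closure])
      moreover have "?U \<inter> nondiff_set f = {}"
        using closure_subset[of "nondiff_set f"] by blast
      ultimately show False
        using x *[of ?U] unfolding corner_locus_def mem_Collect_eq by (metis ComplI)
    qed
  next
    fix x assume x: "x \<in> closure (nondiff_set f)"
    have False if U: "open U" "x \<in> U" "f differentiable_on U" for U
      using open_Int_closure_eq_empty[OF U(1), of "nondiff_set f"] *[OF U(1)] U x by blast
    then show "x \<in> corner_locus f"
      unfolding corner_locus_def mem_Collect_eq by metis
  qed
qed

end

theory Submission
  imports Defs
begin

text \<open>On each piece the leading coefficient \<open>delta2 \<delta> m\<close> is a quadratic polynomial in \<open>x\<close> on a polytope.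
  A maximizer on a face of minimal dimension is a nondegenerate critical point of the restriction to the
  affine hull of that face, so by Cramer's rule it is one of finitely many points depending rationally
  on \<open>m\<close>; hence \<open>js\<close> is piecewise rational. For fixed \<open>m\<close>, the same systems for \<open>\<delta> m n (n x) / n\<^sup>2\<close>
  have a constant matrix and a right-hand side that is affine in \<open>1 / n\<close>, so the candidate points are affine
  and the candidate values quadratic in \<open>1 / n\<close>; convexity of the pieces makes one candidate win for all
  large \<open>n\<close>. Semialgebraicity of the sectors, of the non-differentiability set and of its closure follows
  from Tarski--Seidenberg, proved by the Cohen--Hoermander method. The closure has empty interior because every open set
  contains an open set inside a single sector, and by invariance of domain a cell of full dimension
  is open.\<close>

text \<open>Definability is treated semantically: a set qualifies when membership depends only on
  the signs of finitely many polynomials. Two parameters with equal signs are linked by an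
  increasing bijection of the real line that carries the sign diagram of one univariate family onto
  that of the other, so projecting out a real variable means transporting a witness through the
  bijection; neither formulas nor sign tables are encoded. On the optimization side the obstacle is
  that the critical system of a face can be singular, and its solutions are then neither finite in
  number nor rational in \<open>m\<close>. A maximizer with as many active constraints as possible
  avoids such faces. The list of systems is fixed by the polytopes alone, before \<open>m\<close>
  and \<open>n\<close> are chosen: this yields finitely many sectors, and for fixed \<open>m\<close>
  finitely many candidates for all \<open>n\<close> together. A candidate may leave its piece as
  \<open>n\<close> grows; it moves along a line in \<open>t = 1 / n\<close>, so the admissible
  \<open>t\<close> form an interval, and being admissible infinitely often means being admissible
  from some point on.\<close>

section \<open>Matching sign diagrams of polynomial families\<close>

text \<open>The component of \<open>t\<close> in the complement of \<open>Z\<close>; it is \<open>{t}\<close> for \<open>t \<in> Z\<close>.\<close>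

definition gap :: "real set \<Rightarrow> real \<Rightarrow> real set" where
  "gap Z t = {s. \<forall>z\<in>Z. (z < s \<longleftrightarrow> z < t) \<and> (s < z \<longleftrightarrow> t < z)}"

lemma gap_iff: "s \<in> gap Z t \<longleftrightarrow> (\<forall>z\<in>Z. (z < s \<longleftrightarrow> z < t) \<and> (s < z \<longleftrightarrow> t < z))"
  by (simp only: gap_def mem_Collect_eq)

lemma gap_self: "t \<in> gap Z t"
  by (simp add: gap_iff)

lemma gap_eq:
  assumes "s \<in> gap Z t"
  shows "gap Z s = gap Z t"
proof -
  have "(z < s \<longleftrightarrow> z < t) \<and> (s < z \<longleftrightarrow> t < z)" if "z \<in> Z" for z
    using assms that unfolding gap_iff by blast
  then show ?thesis
    unfolding gap_def by (intro Collect_cong ball_cong refl) blast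
qed

lemma gap_between:
  assumes "a \<in> gap Z t" "b \<in> gap Z t" "a \<le> x" "x \<le> b"
  shows "x \<in> gap Z t"
  unfolding gap_iff
proof
  fix z assume "z \<in> Z"
  then have "(z < a \<longleftrightarrow> z < t) \<and> (a < z \<longleftrightarrow> t < z)" "(z < b \<longleftrightarrow> z < t) \<and> (b < z \<longleftrightarrow> t < z)"
    using assms(1,2) unfolding gap_iff by blast+
  then show "(z < x \<longleftrightarrow> z < t) \<and> (x < z \<longleftrightarrow> t < z)"
    using assms(3,4) by linarith
qed

lemma gap_disjoint:
  assumes "t \<notin> Z" "s \<in> gap Z t"
  shows "s \<notin> Z"
proof
  assume "s \<in> Z"
  then have "(s < s \<longleftrightarrow> s < t) \<and> (s < s \<longleftrightarrow> t < s)"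
    using assms(2) unfolding gap_iff by blast
  then have "s = t" by auto
  then show False using assms(1) \<open>s \<in> Z\<close> by simp
qed

lemma open_gap:
  assumes "finite Z" "t \<notin> Z"
  shows "open (gap Z t)"
proof -
  have "gap Z t = (\<Inter>z\<in>Z. if z < t then {z<..} else {..<z})"
  proof (intro set_eqI)
    fix s
    have "(z < s \<longleftrightarrow> z < t) \<and> (s < z \<longleftrightarrow> t < z) \<longleftrightarrow> s \<in> (if z < t then {z<..} else {..<z})"
      if "z \<in> Z" for z
      using that assms(2) by (cases z t rule: linorder_cases) auto
    then show "s \<in> gap Z t \<longleftrightarrow> s \<in> (\<Inter>z\<in>Z. if z < t then {z<..} else {..<z})"
      unfolding gap_def mem_Collect_eq INT_iff by blast
  qed
  then show ?thesis
    using assms(1) by (auto intro!: open_INT)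
qed

section \<open>Monotone polynomials on gaps\<close>

lemma open_interval_margin:
  fixes J :: "real set"
  assumes "open J" "x \<in> J"
  obtains a b where "a \<in> J" "b \<in> J" "a < x" "x < b"
proof -
  obtain e where e: "e > 0" "ball x e \<subseteq> J"
    using assms open_contains_ball by blast
  then have "x - e/2 \<in> J" "x + e/2 \<in> J"
    by (auto simp: subset_eq dist_real_def)
  then show thesis
    using that e(1) by (metis add_strict_increasing2 diff_less_eq half_gt_zero less_add_same_cancel1)
qed

text \<open>By the mean value theorem. Encoding the direction of monotonicity as a sign \<sigma>
  lets increasing and decreasing gaps share one argument below.\<close>

lemma sgn_poly_diff:
  fixes p :: "real poly"
  assumes deriv: "\<And>u. u \<in> J \<Longrightarrow> sgn (poly (pderiv p) u) = \<sigma>"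
    and conv: "\<And>a b u. \<lbrakk>a \<in> J; b \<in> J; a \<le> u; u \<le> b\<rbrakk> \<Longrightarrow> u \<in> J"
    and "x \<in> J" "y \<in> J"
  shows "sgn (poly p x - poly p y) = \<sigma> * sgn (x - y)"
proof -
  have less: "sgn (poly p b - poly p a) = \<sigma>" if ab: "a \<in> J" "b \<in> J" "a < b" for a b
  proof -
    obtain u where "a < u" "u < b" "poly p b - poly p a = (b - a) * poly (pderiv p) u"
      using poly_MVT[OF ab(3), of p] by blast
    then show ?thesis
      using deriv[of u] conv[of a b u] ab by (simp add: sgn_mult)
  qed
  consider "x < y" | "x = y" | "y < x" by linarith
  then show ?thesis
  proof cases
    case 1
    then have "sgn (poly p y - poly p x) = \<sigma>"
      using less assms(3,4) by blast
    then show ?thesis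
      using 1 sgn_minus[of "poly p y - poly p x"] by simp
  next
    case 3
    then show ?thesis
      using less[of y x] assms(3,4) by simp
  qed simp
qed

text \<open>Covers a gap unbounded to the left, where there is no boundary point to compare with:
  \<open>q\<close> is nonconstant, so its absolute value tends to infinity, and to the left of
  \<open>c\<close> monotonicity keeps it below \<open>poly q c\<close>, which leaves only large
  negative values.\<close>

lemma increasing_poly_negative_below:
  fixes q :: "real poly"
  assumes "\<And>u. u \<le> c \<Longrightarrow> poly (pderiv q) u > 0"
  shows "\<exists>u\<le>c. poly q u < 0"
proof -
  have mono: "poly q u < poly q c" if "u < c" for u
    by (rule DERIV_pos_imp_increasing[OF that]) (use assms poly_DERIV in blast)
  have "degree q > 0"
    using assms[of c] by (auto simp: pderiv_eq_0_iff[symmetric] intro!: gr0I)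
  then have "filterlim (poly q) at_infinity at_infinity"
    by (intro filterlim_poly_at_infinity) auto
  then have "\<forall>\<^sub>F z in at_infinity. \<bar>poly q c\<bar> + 1 \<le> norm (poly q z)"
    by (auto simp: filterlim_at_infinity[OF order_refl] intro: add_nonneg_pos)
  then obtain r where r: "\<And>z. r \<le> norm z \<Longrightarrow> \<bar>poly q c\<bar> + 1 \<le> norm (poly q z)"
    unfolding eventually_at_infinity by blast
  define u where "u = - (\<bar>r\<bar> + \<bar>c\<bar> + 1)"
  have "u < c" "r \<le> norm u" by (auto simp: u_def)
  then have "poly q u < 0" using mono[of u] r[of u] by auto
  then show ?thesis using \<open>u < c\<close> by (auto intro: less_imp_le)
qed

text \<open>An increasing polynomial is negative somewhere on an open gap iff it is negative near
  the left end. That end is either minus infinity or a point of \<open>Z\<close>, where the signs of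
  \<open>p\<close> and \<open>q\<close> agree by assumption.\<close>

lemma gap_negative_increasing:
  fixes p q :: "real poly"
  assumes h: "strict_mono h" "surj h" and Z: "finite Z"
    and ends: "\<And>z. z \<in> Z \<Longrightarrow> sgn (poly p z) = sgn (poly q (h z))"
    and incr: "\<And>s. s \<in> gap Z t \<Longrightarrow> poly (pderiv p) s > 0 \<and> poly (pderiv q) (h s) > 0"
    and neg: "poly p t < 0"
  shows "\<exists>s\<in>gap Z t. poly q (h s) < 0"
proof (cases "t \<in> Z")
  case True
  then show ?thesis using ends[OF True] neg gap_self[of t Z] by (metis sgn_less)
next
  case t: False
  show ?thesis
  proof (cases "{z\<in>Z. z < t} = {}")
    case True
    have below: "s \<in> gap Z t" if "s \<le> t" for s
      unfolding gap_def
    proof (intro CollectI ballI)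
      fix z assume "z \<in> Z"
      then have "t < z" using True t by (metis (mono_tags, lifting) Collect_empty_eq linorder_neqE)
      then show "(z < s \<longleftrightarrow> z < t) \<and> (s < z \<longleftrightarrow> t < z)" using that by auto
    qed
    have "poly (pderiv q) u > 0" if "u \<le> h t" for u
    proof -
      obtain s where s: "u = h s" using h(2) by (meson surjD)
      then have "s \<le> t" using that h(1) by (simp add: strict_mono_less_eq)
      then show ?thesis using incr below s by blast
    qed
    then obtain u where u: "u \<le> h t" "poly q u < 0"
      using increasing_poly_negative_below by blast
    obtain s where s: "u = h s" using h(2) by (meson surjD)
    then have "s \<le> t" using u h(1) by (simp add: strict_mono_less_eq)
    then show ?thesis using below s u by blast
  next
    case False
    define a where "a = Max {z\<in>Z. z < t}"
    have a: "a \<in> Z" "a < t" and a_max: "\<And>z. z \<in> Z \<Longrightarrow> z < t \<Longrightarrow> z \<le> a"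
      using Max_in[of "{z\<in>Z. z < t}"] False Z by (auto simp: a_def)
    have above: "s \<in> gap Z t" if "a < s" "s \<le> t" for s
      unfolding gap_def
    proof (intro CollectI ballI)
      fix z assume z: "z \<in> Z"
      then consider "z \<le> a" | "t < z" using a_max[of z] t by (metis linorder_neqE)
      then show "(z < s \<longleftrightarrow> z < t) \<and> (s < z \<longleftrightarrow> t < z)" using that by cases auto
    qed
    have "poly p a < poly p t"
    proof (rule DERIV_pos_imp_increasing_open[OF a(2)])
      show "\<exists>y. DERIV (poly p) x :> y \<and> y > 0" if "a < x" "x < t" for x
        using incr[of x] above[of x] that poly_DERIV by fastforce
    qed (auto intro: continuous_intros)
    then have "poly q (h a) < 0"
      using neg ends[OF a(1)] by (metis sgn_less order_less_trans)
    moreover have "isCont (poly q) (h a)" by simp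
    ultimately have "\<forall>\<^sub>F u in at (h a). poly q u < 0"
      unfolding isCont_def by (rule order_tendstoD(2)[rotated])
    then obtain d where d: "d > 0" "\<And>u. u \<noteq> h a \<Longrightarrow> dist u (h a) < d \<Longrightarrow> poly q u < 0"
      by (auto simp: eventually_at)
    \<comment> \<open>Close enough to \<open>h a\<close> for continuity to keep \<open>q\<close>
      negative, and not beyond \<open>h t\<close>, so that the preimage of \<open>u\<close> stays in
      the gap.\<close>
    define u where "u = min (h a + d/2) (h t)"
    have ht: "h a < h t" using h(1) a(2) by (simp add: strict_mono_less)
    have u: "h a < u" "u \<le> h t" "poly q u < 0"
      using d(1) ht by (auto simp: u_def dist_real_def intro!: d(2))
    obtain s where s: "u = h s" using h(2) by (meson surjD)
    have "a < s" "s \<le> t"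
      using u h(1) s by (auto simp: strict_mono_less_eq strict_mono_less)
    then show ?thesis using above s u by blast
  qed
qed

lemma gap_uminus: "gap (uminus ` Z) (- t) = uminus ` gap Z t"
proof -
  have "x \<in> gap (uminus ` Z) (- t) \<longleftrightarrow> - x \<in> gap Z t" for x
    unfolding gap_def by (auto simp: minus_less_iff less_minus_iff)
  then show ?thesis by (force intro: image_eqI[where x = "- x" for x])
qed

text \<open>Reflection at 0: \<open>p\<close> and \<open>q\<close> are composed with negation and
  \<open>h\<close> becomes \<open>\<lambda>s. - h (- s)\<close>, which is again increasing and
  onto.\<close>

lemma gap_negative_decreasing:
  fixes p q :: "real poly"
  assumes h: "strict_mono h" "surj h" and Z: "finite Z"
    and ends: "\<And>z. z \<in> Z \<Longrightarrow> sgn (poly p z) = sgn (poly q (h z))"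
    and decr: "\<And>s. s \<in> gap Z t \<Longrightarrow> poly (pderiv p) s < 0 \<and> poly (pderiv q) (h s) < 0"
    and neg: "poly p t < 0"
  shows "\<exists>s\<in>gap Z t. poly q (h s) < 0"
proof -
  let ?r = "\<lambda>p :: real poly. pcompose p [:0, -1:]"
  have d: "poly (pderiv (?r p)) x = - poly (pderiv p) (- x)" for p x
    by (simp add: pderiv_pcompose poly_pcompose pderiv_pCons)
  have "strict_mono (\<lambda>s. - h (- s))"
    using h(1) by (simp add: strict_mono_def)
  moreover have "surj (\<lambda>s. - h (- s))"
  proof (rule surjI)
    show "- h (- (- inv h (- y))) = y" for y
      using surj_f_inv_f[OF h(2), of "- y"] by simp
  qed
  ultimately have "\<exists>s\<in>gap (uminus ` Z) (- t). poly (?r q) (- h (- s)) < 0"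
    by (rule gap_negative_increasing[where p = "?r p"])
      (use assms in \<open>auto simp: gap_uminus d poly_pcompose\<close>)
  then show ?thesis
    by (auto simp: gap_uminus poly_pcompose)
qed

lemma gap_negative:
  fixes p q :: "real poly"
  assumes "strict_mono h" "surj h" "finite Z"
    and "\<And>z. z \<in> Z \<Longrightarrow> sgn (poly p z) = sgn (poly q (h z))"
    and "\<sigma> \<noteq> 0"
    and deriv: "\<And>s. s \<in> gap Z t \<Longrightarrow>
      sgn (poly (pderiv p) s) = \<sigma> \<and> sgn (poly (pderiv q) (h s)) = \<sigma>"
    and "r \<in> gap Z t" "poly p r < 0"
  shows "\<exists>s\<in>gap Z t. poly q (h s) < 0"
proof -
  have [simp]: "gap Z r = gap Z t" using assms(7) by (rule gap_eq)
  have "\<sigma> = sgn (poly (pderiv p) t)" using deriv gap_self by metis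
  then consider "\<sigma> = 1" | "\<sigma> = -1" using \<open>\<sigma> \<noteq> 0\<close> by (auto simp: sgn_real_def split: if_splits)
  then show ?thesis
  proof cases
    case 1
    show ?thesis
      using gap_negative_increasing[OF assms(1-4), of r] deriv assms(8) 1
      by (simp add: sgn_1_pos)
  next
    case 2
    show ?thesis
      using gap_negative_decreasing[OF assms(1-4), of r] deriv assms(8) 2
      by (simp add: sgn_1_neg)
  qed
qed

lemma gap_image:
  assumes "strict_mono h" "surj h"
  shows "gap (h ` Z) (h t) = h ` gap Z t"
proof -
  have "h s \<in> gap (h ` Z) (h t) \<longleftrightarrow> s \<in> gap Z t" for s
    unfolding gap_iff ball_simps strict_mono_less[OF assms(1)] ..
  moreover have "inj h" using assms(1) by (rule strict_mono_imp_inj_on)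
  ultimately show ?thesis
    using assms(2) by (auto simp: inj_image_mem_iff) (metis surjD imageI)
qed

text \<open>The converse is the same implication for \<open>inv h\<close>, with \<open>p\<close> and
  \<open>q\<close> exchanged and with the gaps of the image of \<open>Z\<close>.\<close>

lemma gap_negative_iff:
  fixes p q :: "real poly"
  assumes h: "strict_mono h" "surj h" and Z: "finite Z"
    and ends: "\<And>z. z \<in> Z \<Longrightarrow> sgn (poly p z) = sgn (poly q (h z))"
    and "\<sigma> \<noteq> 0"
    and deriv: "\<And>s. s \<in> gap Z t \<Longrightarrow>
      sgn (poly (pderiv p) s) = \<sigma> \<and> sgn (poly (pderiv q) (h s)) = \<sigma>"
  shows "(\<exists>s\<in>gap Z t. poly p s < 0) \<longleftrightarrow> (\<exists>s\<in>gap Z t. poly q (h s) < 0)"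
proof
  assume "\<exists>s\<in>gap Z t. poly p s < 0"
  then show "\<exists>s\<in>gap Z t. poly q (h s) < 0"
    using gap_negative[OF assms] by blast
next
  assume "\<exists>s\<in>gap Z t. poly q (h s) < 0"
  then obtain r where r: "r \<in> gap Z t" "poly q (h r) < 0" by blast
  have inj: "inj h" using h(1) by (rule strict_mono_imp_inj_on)
  have inv: "inv h (h x) = x" "h (inv h x) = x" for x
    using inj h(2) by (auto simp: surj_f_inv_f)
  have g: "gap (h ` Z) (h t) = h ` gap Z t"
    using gap_image[OF h] .
  have "\<exists>s\<in>gap (h ` Z) (h t). poly p (inv h s) < 0"
  proof (rule gap_negative[where p = q and \<sigma> = \<sigma> and r = "h r"])
    show "strict_mono (inv h)"
      using h inv by (metis strict_mono_def strict_mono_less)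
    show "surj (inv h)"
      using inj by (rule inj_imp_surj_inv)
  qed (use Z ends deriv r \<open>\<sigma> \<noteq> 0\<close> in \<open>auto simp: g inv\<close>)
  then show "\<exists>s\<in>gap Z t. poly p s < 0"
    by (auto simp: g inv)
qed

text \<open>Serves to move a root to a prescribed place inside a gap without disturbing anything
  outside it.\<close>

lemma interval_shift:
  fixes A B c d :: real
  assumes "A < c" "A < d" "c < B" "d < B"
  obtains g where "strict_mono g" "surj g" "g c = d" "\<And>x. x \<le> A \<or> B \<le> x \<Longrightarrow> g x = x"
proof -
  \<comment> \<open>Linear from [A, c] onto [A, d] and from [c, B] onto [d, B]. The points
    \<open>c\<close> and \<open>d\<close> are kept as arguments because \<open>g d c\<close> is the
    inverse of \<open>g c d\<close>, which settles surjectivity.\<close>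
  define g where "g c d x =
    (if x \<le> A \<or> B \<le> x then x
     else if x \<le> c then A + (x - A) * ((d - A) / (c - A))
     else B - (B - x) * ((B - d) / (B - c)))" for c d x
  have rng: "A < g c d x \<and> g c d x \<le> d" if "A < x" "x \<le> c" "A < c" "A < d" "c < B" for c d x
  proof -
    have "(x - A) / (c - A) \<le> 1" "(x - A) / (c - A) > 0"
      using that by (auto simp: field_simps)
    then have "(d - A) * ((x - A) / (c - A)) \<le> (d - A) * 1" "(d - A) * ((x - A) / (c - A)) > 0"
      using that by (intro mult_left_mono mult_pos_pos; simp)+
    then show ?thesis using that by (simp add: g_def algebra_simps)
  qed
  have rng': "d < g c d x \<and> g c d x < B" if "c < x" "x < B" "d < B" "A < c" for c d x
  proof -
    have "(B - x) / (B - c) < 1" "(B - x) / (B - c) > 0"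
      using that by (auto simp: field_simps)
    then have "(B - d) * ((B - x) / (B - c)) < (B - d) * 1" "(B - d) * ((B - x) / (B - c)) > 0"
      using that by (intro mult_strict_left_mono mult_pos_pos; simp)+
    then show ?thesis using that by (simp add: g_def algebra_simps)
  qed
  have inv: "g c d (g d c x) = x" for x
  proof -
    consider "x \<le> A \<or> B \<le> x" | "A < x" "x < B" "x \<le> d" | "d < x" "x < B" by linarith
    then show ?thesis
    proof cases
      case 1
      then show ?thesis by (auto simp: g_def)
    next
      case 2
      then have "A < g d c x" "g d c x \<le> c" using rng[of x d c] assms by auto
      then have e: "g c d (g d c x) = A + (g d c x - A) * ((d - A) / (c - A))"
        using assms by (simp add: g_def)
      have "g d c x = A + (x - A) * ((c - A) / (d - A))"
        using 2 by (simp add: g_def)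
      then show ?thesis using assms unfolding e by simp
    next
      case 3
      then have "c < g d c x" "g d c x < B" using rng'[of d x c] assms by auto
      then have e: "g c d (g d c x) = B - (B - g d c x) * ((B - d) / (B - c))"
        using assms by (simp add: g_def)
      have "g d c x = B - (B - x) * ((B - c) / (B - d))"
        using 3 assms by (simp add: g_def)
      then show ?thesis using assms unfolding e by simp
    qed
  qed
  have "g c d x < g c d y" if "x < y" for x y
  proof -
    have pos: "(d - A) / (c - A) > 0" "(B - d) / (B - c) > 0" using assms by auto
    consider "y \<le> A \<or> B \<le> x" | "x \<le> A" "B \<le> y" | "x \<le> A" "A < y" "y < B" | "A < x" "x < B" "B \<le> y"
      | "A < x" "y \<le> c" | "A < x" "x \<le> c" "c < y" "y < B" | "c < x" "y < B"
      using that by (smt (verit))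
    then show ?thesis
    proof cases
      case 3
      then have "g c d x = x" by (simp add: g_def)
      moreover have "A < g c d y"
        using rng[of y c d] rng'[of c y d] assms 3 by (cases "y \<le> c") linarith+
      ultimately show ?thesis using 3 by linarith
    next
      case 4
      then have "g c d y = y" by (simp add: g_def)
      moreover have "g c d x < B"
        using rng[of x c d] rng'[of c x d] assms 4 by (cases "x \<le> c") linarith+
      ultimately show ?thesis using 4 by linarith
    next
      case 5
      have "(x - A) * ((d - A) / (c - A)) < (y - A) * ((d - A) / (c - A))"
        using pos that by (intro mult_strict_right_mono) auto
      then show ?thesis using 5 that assms by (simp add: g_def)
    next
      case 6
      then show ?thesis using rng[of x c d] rng'[of c y d] assms by fastforce
    next
      case 7
      have "(B - y) * ((B - d) / (B - c)) < (B - x) * ((B - d) / (B - c))"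
        using pos that by (intro mult_strict_right_mono) auto
      then show ?thesis using 7 that assms by (simp add: g_def)
    qed (use that in \<open>auto simp: g_def\<close>)
  qed
  moreover have "surj (g c d)" using inv by (metis surjI)
  moreover have "g c d c = d" using assms by (simp add: g_def)
  moreover have "g c d x = x" if "x \<le> A \<or> B \<le> x" for x using that by (auto simp: g_def)
  ultimately show thesis using that by (metis strict_mono_def)
qed

text \<open>On a gap both polynomials are strictly monotone in the same direction, so each has at most one
  root, and one of them has a root iff the other does. Moving the root of \<open>p\<close> to that of \<open>q\<close> by a
  piecewise linear \<open>g\<close> that is the identity outside the gap aligns the signs.\<close>

lemma gap_match:
  fixes p q :: "real poly"
  assumes h: "strict_mono h" "surj h" and Z: "finite Z" and t: "t \<notin> Z"
    and ends: "\<And>z. z \<in> Z \<Longrightarrow> sgn (poly p z) = sgn (poly q (h z))"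
    and \<sigma>: "\<sigma> \<noteq> 0"
    and deriv: "\<And>s. s \<in> gap Z t \<Longrightarrow>
      sgn (poly (pderiv p) s) = \<sigma> \<and> sgn (poly (pderiv q) (h s)) = \<sigma>"
  obtains g where "strict_mono g" "surj g" "\<And>u. u \<notin> h ` gap Z t \<Longrightarrow> g u = u"
    "\<And>s. s \<in> gap Z t \<Longrightarrow> sgn (poly p s) = sgn (poly q (g (h s)))"
proof -
  let ?J = "gap Z t"
  have J_open: "open ?J" using open_gap[OF Z t] .
  have \<sigma>1: "\<sigma> = 1 \<or> \<sigma> = -1"
    using deriv[OF gap_self] \<sigma> by (metis sgn_real_def)
  have hJ: "u \<in> h ` ?J" if ab: "a \<in> h ` ?J" "b \<in> h ` ?J" "a \<le> u" "u \<le> b" for a b u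
  proof -
    obtain v where "u = h v" using h(2) by (meson surjD)
    moreover obtain a' b' where "a = h a'" "b = h b'" "a' \<in> ?J" "b' \<in> ?J"
      using ab(1,2) by blast
    ultimately show ?thesis
      using ab(3,4) h(1) gap_between[of a' Z t b' v] by (simp add: strict_mono_less_eq)
  qed
  have sp: "sgn (poly p x - poly p y) = \<sigma> * sgn (x - y)" if "x \<in> ?J" "y \<in> ?J" for x y
    by (rule sgn_poly_diff[where J = ?J, OF _ gap_between that]) (use deriv in blast)
  have sq: "sgn (poly q x - poly q y) = \<sigma> * sgn (x - y)" if "x \<in> h ` ?J" "y \<in> h ` ?J" for x y
    by (rule sgn_poly_diff[where J = "h ` ?J", OF _ hJ that]) (use deriv in blast)
  have neg: "(\<exists>s\<in>?J. poly p s < 0) \<longleftrightarrow> (\<exists>s\<in>?J. poly q (h s) < 0)"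
    by (rule gap_negative_iff[OF h Z ends \<sigma> deriv])
  have pos: "(\<exists>s\<in>?J. poly p s > 0) \<longleftrightarrow> (\<exists>s\<in>?J. poly q (h s) > 0)"
    using gap_negative_iff[OF h Z, where p = "-p" and q = "-q" and \<sigma> = "-\<sigma>" and t = t]
      ends \<sigma> deriv by (simp add: pderiv_minus)
  have sides: "\<exists>x\<in>?J. \<exists>y\<in>?J. sgn (x - s) = - \<sigma> \<and> sgn (y - s) = \<sigma>" if s: "s \<in> ?J" for s
  proof -
    obtain a b where "a \<in> ?J" "b \<in> ?J" "a < s" "s < b"
      using open_interval_margin[OF J_open s] by metis
    moreover have "sgn (a - s) = -1" "sgn (b - s) = 1" using calculation by auto
    ultimately show ?thesis using \<sigma>1 by (metis minus_minus)
  qed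
  have hs: "sgn (h x - h y) = sgn (x - y)" for x y
    using h(1) by (cases x y rule: linorder_cases) (auto simp: strict_mono_less)
  have \<sigma>\<sigma>: "\<sigma> * \<sigma> = 1" using \<sigma>1 by auto
  \<comment> \<open>At a root inside the gap, strict monotonicity produces both signs. Hence a
    polynomial that misses one of the signs has no root in the gap.\<close>
  have p0: "(\<exists>x\<in>?J. poly p x < 0) \<and> (\<exists>x\<in>?J. poly p x > 0)" if s: "s \<in> ?J" "poly p s = 0" for s
  proof -
    obtain x y where xy: "x \<in> ?J" "y \<in> ?J" "sgn (x - s) = - \<sigma>" "sgn (y - s) = \<sigma>"
      using sides[OF s(1)] by blast
    then show ?thesis
      using sp[OF xy(1) s(1)] sp[OF xy(2) s(1)] s(2) \<sigma>\<sigma> by (auto simp: sgn_1_pos sgn_1_neg)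
  qed
  have q0: "(\<exists>x\<in>?J. poly q (h x) < 0) \<and> (\<exists>x\<in>?J. poly q (h x) > 0)"
    if s: "s \<in> ?J" "poly q (h s) = 0" for s
  proof -
    obtain x y where xy: "x \<in> ?J" "y \<in> ?J" "sgn (x - s) = - \<sigma>" "sgn (y - s) = \<sigma>"
      using sides[OF s(1)] by blast
    then have "sgn (poly q (h x)) = \<sigma> * - \<sigma>" "sgn (poly q (h y)) = \<sigma> * \<sigma>"
      using sq[of "h x" "h s"] sq[of "h y" "h s"] s(1) xy hs s(2) by auto
    then show ?thesis
      using xy \<sigma>\<sigma> by (auto simp: sgn_1_pos sgn_1_neg)
  qed
  show thesis
  proof (cases "(\<exists>s\<in>?J. poly p s < 0) \<and> (\<exists>s\<in>?J. poly p s > 0)")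
    case False
    have eq: "sgn (poly p s) = sgn (poly q (h s))" if s: "s \<in> ?J" for s
      using False neg pos p0[OF s] q0[OF s] s
      by (cases "poly p s" "0::real" rule: linorder_cases;
          cases "poly q (h s)" "0::real" rule: linorder_cases) auto
    show thesis
      by (rule that[of id]) (use eq in \<open>auto simp: strict_mono_def\<close>)
  next
    case True
    have ivt: "\<exists>z\<in>K. poly r z = 0"
      if "x \<in> K" "y \<in> K" "poly r x < 0" "poly r y > 0"
        "\<And>a b u. \<lbrakk>a \<in> K; b \<in> K; a \<le> u; u \<le> b\<rbrakk> \<Longrightarrow> u \<in> K" for K x y and r :: "real poly"
    proof -
      have "x < y \<or> y < x" using that by (metis linorder_neqE order_less_asym)
      then show ?thesis
      proof
        assume "x < y"
        then show ?thesis using poly_IVT_pos[of x y r] that by (metis less_imp_le)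
      next
        assume "y < x"
        then show ?thesis using poly_IVT_neg[of y x r] that by (metis less_imp_le)
      qed
    qed
    obtain r where r: "r \<in> ?J" "poly p r = 0"
      using ivt[of _ ?J _ p] True gap_between by metis
    obtain x y where "x \<in> ?J" "y \<in> ?J" "poly q (h x) < 0" "poly q (h y) > 0"
      using True neg pos by blast
    then have "\<exists>v\<in>h ` ?J. poly q v = 0"
      using hJ by (intro ivt[of "h x" "h ` ?J" "h y" q]) blast+
    then obtain s where s: "s \<in> ?J" "poly q (h s) = 0" by blast
    \<comment> \<open>\<open>a\<close> and \<open>b\<close> enclose both the root \<open>r\<close>
      of \<open>p\<close> and the pullback \<open>s\<close> of the root of \<open>q\<close>, so
      \<open>g\<close> moves points only inside the image of the gap.\<close>
    obtain a where a: "a \<in> ?J" "a < r" "a < s"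
      using open_interval_margin[OF J_open, of "min r s"] r(1) s(1) by (metis min_def min_less_iff_conj)
    obtain b where b: "b \<in> ?J" "r < b" "s < b"
      using open_interval_margin[OF J_open, of "max r s"] r(1) s(1) by (metis max_def max_less_iff_conj)
    obtain g where g: "strict_mono g" "surj g" "g (h r) = h s"
      "\<And>x. x \<le> h a \<or> h b \<le> x \<Longrightarrow> g x = x"
      using interval_shift[of "h a" "h r" "h s" "h b"] a b h(1) by (metis strict_mono_less)
    have out: "g u = u" if "u \<notin> h ` ?J" for u
      using hJ[of "h a" "h b" u] that a(1) b(1) g(4)[of u] by (meson imageI linear)
    have inside: "g u \<in> h ` ?J" if "u \<in> h ` ?J" for u
      using out[of "g u"] g(1) that by (metis strict_mono_eq)
    have "sgn (poly p x) = sgn (poly q (g (h x)))" if x: "x \<in> ?J" for x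
    proof -
      have "sgn (poly q (g (h x)) - poly q (h s)) = \<sigma> * sgn (g (h x) - h s)"
        using sq inside x s(1) by blast
      also have "sgn (g (h x) - h s) = sgn (h x - h r)"
        using g(1) unfolding g(3)[symmetric]
        by (cases "h x" "h r" rule: linorder_cases) (auto simp: strict_mono_less)
      also have "\<dots> = sgn (x - r)" by (rule hs)
      finally show ?thesis using sp[OF x r(1)] r(2) s(2) by simp
    qed
    then show thesis using that[OF g(1,2) out] by blast
  qed
qed

text \<open>A gap is determined by the set of points of \<open>Z\<close> to its left.\<close>

lemma finite_gaps:
  assumes "finite Z"
  shows "finite (gap Z ` (- Z))"
proof (rule finite_subset)
  show "gap Z ` (- Z) \<subseteq> (\<lambda>A. {s. \<forall>z\<in>Z. (z < s \<longleftrightarrow> z \<in> A) \<and> (s < z \<longleftrightarrow> z \<notin> A)}) ` Pow Z"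
  proof
    fix K assume "K \<in> gap Z ` (- Z)"
    then obtain t where t: "t \<notin> Z" "K = gap Z t" by blast
    have "K = {s. \<forall>z\<in>Z. (z < s \<longleftrightarrow> z \<in> {z\<in>Z. z < t}) \<and> (s < z \<longleftrightarrow> z \<notin> {z\<in>Z. z < t})}"
      unfolding t(2) gap_def
    proof (intro Collect_cong ball_cong refl)
      fix s z assume "z \<in> Z"
      then show "(z < s \<longleftrightarrow> z < t) \<and> (s < z \<longleftrightarrow> t < z) \<longleftrightarrow>
          (z < s \<longleftrightarrow> z \<in> {z\<in>Z. z < t}) \<and> (s < z \<longleftrightarrow> z \<notin> {z\<in>Z. z < t})"
        using t(1) by (cases z t rule: linorder_cases) auto
    qed
    then show "K \<in> (\<lambda>A. {s. \<forall>z\<in>Z. (z < s \<longleftrightarrow> z \<in> A) \<and> (s < z \<longleftrightarrow> z \<notin> A)}) ` Pow Z"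
      by (rule image_eqI) blast
  qed
qed (use assms in simp)

text \<open>The gaps are corrected one at a time. Each correction is the identity outside the image
  of its gap and maps that image into itself, so signs already matched elsewhere survive. That
  \<open>h\<close> sends every gap into its image under \<open>h0\<close> is recorded because sign
  information known on gaps for \<open>h0\<close> then carries over to \<open>h\<close>.\<close>

lemma all_gaps_match:
  fixes p q :: "real poly"
  assumes h0: "strict_mono h0" "surj h0" and Z: "finite Z"
    and ends: "\<And>z. z \<in> Z \<Longrightarrow> sgn (poly p z) = sgn (poly q (h0 z))"
    and deriv: "\<And>t. t \<notin> Z \<Longrightarrow> \<exists>\<sigma>. \<sigma> \<noteq> 0 \<and> (\<forall>s\<in>gap Z t.
      sgn (poly (pderiv p) s) = \<sigma> \<and> sgn (poly (pderiv q) (h0 s)) = \<sigma>)"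
  obtains h where "strict_mono h" "surj h" "\<And>z. z \<in> Z \<Longrightarrow> h z = h0 z"
    "\<And>s. s \<notin> Z \<Longrightarrow> h s \<in> h0 ` gap Z s" "\<And>s. sgn (poly p s) = sgn (poly q (h s))"
proof -
  have "\<exists>h. strict_mono h \<and> surj h \<and> (\<forall>z\<in>Z. h z = h0 z) \<and> (\<forall>s. s \<notin> Z \<longrightarrow> h s \<in> h0 ` gap Z s) \<and>
      (\<forall>s\<in>\<Union>\<K>. sgn (poly p s) = sgn (poly q (h s)))"
    if "finite \<K>" "\<K> \<subseteq> gap Z ` (- Z)" for \<K>
    using that
  proof (induction \<K>)
    case empty
    show ?case
      using h0 gap_self by (intro exI[of _ h0]) auto
  next
    case (insert J \<K>)
    then obtain h where h: "strict_mono h" "surj h" and hZ: "\<And>z. z \<in> Z \<Longrightarrow> h z = h0 z"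
      and hs: "\<And>s. s \<notin> Z \<Longrightarrow> h s \<in> h0 ` gap Z s"
      and hK: "\<And>s. s \<in> \<Union>\<K> \<Longrightarrow> sgn (poly p s) = sgn (poly q (h s))"
      using insert.IH insert.prems by (metis insert_subset)
    have inj: "h x = h y \<longleftrightarrow> x = y" for x y
      using h(1) by (rule strict_mono_eq)
    obtain t where t: "t \<notin> Z" "J = gap Z t" using insert.prems by blast
    have hJ: "h s \<in> h0 ` J" if "s \<in> J" for s
      using hs[of s] gap_disjoint[OF t(1)] gap_eq[of s Z t] that t(2) by simp
    obtain \<sigma> where \<sigma>: "\<sigma> \<noteq> 0"
      "\<And>s. s \<in> gap Z t \<Longrightarrow> sgn (poly (pderiv p) s) = \<sigma> \<and> sgn (poly (pderiv q) (h0 s)) = \<sigma>"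
      using deriv[OF t(1)] by blast
    obtain g where g: "strict_mono g" "surj g" "\<And>u. u \<notin> h ` J \<Longrightarrow> g u = u"
      "\<And>s. s \<in> J \<Longrightarrow> sgn (poly p s) = sgn (poly q (g (h s)))"
    proof (rule gap_match[OF h Z t(1), of p q \<sigma>])
      show "sgn (poly p z) = sgn (poly q (h z))" if "z \<in> Z" for z
        using ends hZ that by simp
      show "sgn (poly (pderiv p) s) = \<sigma> \<and> sgn (poly (pderiv q) (h s)) = \<sigma>" if "s \<in> gap Z t" for s
        using \<sigma>(2) hJ[of s] that t(2) by auto
    qed (use \<sigma>(1) t(2) that in auto)
    have out: "g (h s) = h s" if "s \<notin> J" for s
      using g(3)[of "h s"] that inj by (metis imageE)
    \<comment> \<open>An increasing \<open>g\<close> that fixes all points outside the image cannot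
      send an inner point there: such a value would be hit twice.\<close>
    have inside: "g (h s) \<in> h ` J" if "s \<in> J" for s
    proof (rule ccontr)
      assume "g (h s) \<notin> h ` J"
      then have "g (g (h s)) = g (h s)" by (rule g(3))
      then have "g (h s) = h s" using g(1) by (simp add: strict_mono_eq)
      then show False using \<open>g (h s) \<notin> h ` J\<close> that by simp
    qed
    show ?case
    proof (intro exI conjI ballI allI impI)
      show "strict_mono (g \<circ> h)" using g(1) h(1) by (rule strict_mono_o)
      show "surj (g \<circ> h)" using g(2) h(2) by (rule comp_surj[rotated])
      show "(g \<circ> h) z = h0 z" if "z \<in> Z" for z
        using out[of z] gap_disjoint[OF t(1)] that hZ t(2) by auto
      show "(g \<circ> h) s \<in> h0 ` gap Z s" if "s \<notin> Z" for s
      proof (cases "s \<in> J")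
        case True
        then have "gap Z s = J" using gap_eq t(2) by simp
        then show ?thesis using inside[OF True] hJ by auto
      next
        case False
        then show ?thesis using out hs that by simp
      qed
      show "sgn (poly p s) = sgn (poly q ((g \<circ> h) s))" if "s \<in> \<Union>(insert J \<K>)" for s
        using g(4) hK out that by (cases "s \<in> J") auto
    qed
  qed
  from this[OF finite_gaps[OF Z] order_refl] obtain h where h: "strict_mono h" "surj h"
    "\<And>z. z \<in> Z \<Longrightarrow> h z = h0 z" "\<And>s. s \<notin> Z \<Longrightarrow> h s \<in> h0 ` gap Z s"
    "\<And>s. s \<in> \<Union>(gap Z ` (- Z)) \<Longrightarrow> sgn (poly p s) = sgn (poly q (h s))" by blast
  have "sgn (poly p s) = sgn (poly q (h s))" for s
    using h(3,5)[of s] ends[of s] gap_self[of s Z] by (cases "s \<in> Z") auto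
  then show thesis using that[OF h(1-4)] by blast
qed

lemma sgn_poly_constant_on_gap:
  fixes u :: "real poly"
  assumes "{z. poly u z = 0} \<subseteq> Z" "t \<notin> Z" "s \<in> gap Z t"
  shows "sgn (poly u s) = sgn (poly u t)"
proof (rule ccontr)
  assume neq: "sgn (poly u s) \<noteq> sgn (poly u t)"
  have "s \<notin> Z" using gap_disjoint[OF assms(2,3)] .
  have nz: "poly u s \<noteq> 0" "poly u t \<noteq> 0" using assms \<open>s \<notin> Z\<close> by auto
  then have op: "poly u s < 0 \<and> poly u t > 0 \<or> poly u s > 0 \<and> poly u t < 0"
    using neq by (auto simp: sgn_real_def split: if_splits)
  then have "s \<noteq> t" by auto
  have "\<exists>z. (s \<le> z \<and> z \<le> t \<or> t \<le> z \<and> z \<le> s) \<and> poly u z = 0"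
    using op poly_IVT_pos[of s t u] poly_IVT_neg[of s t u] poly_IVT_pos[of t s u]
      poly_IVT_neg[of t s u] \<open>s \<noteq> t\<close> by (metis less_imp_le linorder_neqE)
  then obtain z where z: "s \<le> z \<and> z \<le> t \<or> t \<le> z \<and> z \<le> s" "poly u z = 0" by blast
  then have "z \<in> gap Z t"
    using gap_between[of s Z t t z] gap_between[of t Z t s z] assms(3) gap_self[of t Z] by blast
  then show False using gap_disjoint[OF assms(2)] z(2) assms(1) by blast
qed

text \<open>Let \<open>Z\<close> be the set of roots of the nonzero members. Between them the
  derivative of \<open>p\<close>, being a member, keeps a nonzero sign, so \<open>p\<close> is
  strictly monotone there, while at \<open>Z\<close> its sign is given. Adjusting \<open>h0\<close>
  inside the gaps costs nothing for the family, whose signs are constant on gaps. If the derivative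
  vanishes identically, \<open>p\<close> is constant and \<open>const\<close> decides.\<close>

lemma sign_match_extend:
  fixes p q :: "real poly" and u v :: "'i \<Rightarrow> real poly"
  assumes I: "finite I" and h0: "strict_mono h0" "surj h0"
    and fam: "\<And>i t. i \<in> I \<Longrightarrow> sgn (poly (u i) t) = sgn (poly (v i) (h0 t))"
    and j: "j \<in> I" "pderiv p = u j" "pderiv q = v j"
    and roots: "\<And>i t. \<lbrakk>i \<in> I; u i \<noteq> 0; poly (u i) t = 0\<rbrakk> \<Longrightarrow> sgn (poly p t) = sgn (poly q (h0 t))"
    and const: "sgn (coeff p 0) = sgn (coeff q 0)"
  shows "\<exists>h. strict_mono h \<and> surj h \<and> (\<forall>i\<in>I. \<forall>t. sgn (poly (u i) t) = sgn (poly (v i) (h t))) \<and>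
    (\<forall>t. sgn (poly p t) = sgn (poly q (h t)))"
proof -
  \<comment> \<open>\<open>h0\<close> is onto, so a zero polynomial can only be matched with a zero
    polynomial.\<close>
  have zero: "v i = 0" if "i \<in> I" "u i = 0" for i
  proof -
    have "poly (v i) s = 0" for s
      using fam[OF that(1)] that(2) h0(2) by (metis poly_0 sgn_0 sgn_0_0 surjD)
    then show ?thesis using poly_all_0_iff_0 by blast
  qed
  show ?thesis
  proof (cases "pderiv p = 0")
    case True
    then have "pderiv q = 0" using zero j by simp
    then obtain a b where ab: "p = [:a:]" "q = [:b:]"
      using True by (metis degree_eq_zeroE pderiv_eq_0_iff)
    show ?thesis
      using fam h0 const unfolding ab by auto
  next
    case False
    define Z where "Z = {t. \<exists>i\<in>I. u i \<noteq> 0 \<and> poly (u i) t = 0}"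
    have "Z = (\<Union>i\<in>{i\<in>I. u i \<noteq> 0}. {t. poly (u i) t = 0})" by (auto simp: Z_def)
    then have Z: "finite Z" using I poly_roots_finite by auto
    have const_u: "sgn (poly (u i) s) = sgn (poly (u i) t)" if "i \<in> I" "t \<notin> Z" "s \<in> gap Z t" for i s t
      using sgn_poly_constant_on_gap[of "u i" Z t s] that by (cases "u i = 0") (auto simp: Z_def)
    obtain h where h: "strict_mono h" "surj h" "\<And>z. z \<in> Z \<Longrightarrow> h z = h0 z"
      "\<And>s. s \<notin> Z \<Longrightarrow> h s \<in> h0 ` gap Z s" "\<And>s. sgn (poly p s) = sgn (poly q (h s))"
    proof (rule all_gaps_match[OF h0 Z, of p q])
      show "sgn (poly p z) = sgn (poly q (h0 z))" if "z \<in> Z" for z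
        using roots that by (auto simp: Z_def)
      show "\<exists>\<sigma>. \<sigma> \<noteq> 0 \<and> (\<forall>s\<in>gap Z t.
          sgn (poly (pderiv p) s) = \<sigma> \<and> sgn (poly (pderiv q) (h0 s)) = \<sigma>)" if t: "t \<notin> Z" for t
      proof (intro exI[of _ "sgn (poly (u j) t)"] conjI ballI)
        show "sgn (poly (u j) t) \<noteq> 0"
          using t j False by (auto simp: Z_def sgn_0_0)
        show "sgn (poly (pderiv p) s) = sgn (poly (u j) t)" if "s \<in> gap Z t" for s
          using const_u[OF j(1) t that] j(2) by simp
        then show "sgn (poly (pderiv q) (h0 s)) = sgn (poly (u j) t)" if "s \<in> gap Z t" for s
          using fam[OF j(1), of s] j that by simp
      qed
    qed (use that in blast)
    have "sgn (poly (u i) t) = sgn (poly (v i) (h t))" if "i \<in> I" for i t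
    proof (cases "t \<in> Z")
      case True
      then show ?thesis using h(3) fam that by simp
    next
      case False
      then obtain s where "s \<in> gap Z t" "h t = h0 s" using h(4) by blast
      then show ?thesis using const_u[OF that False] fam[OF that, of s] by simp
    qed
    then show ?thesis using h(1,2,5) by blast
  qed
qed

section \<open>Polynomials with polynomial coefficients and pseudo-division\<close>

lemmas real_polynomial_function_intros =
  real_polynomial_function.intros(2-4) real_polynomial_function_diff
  real_polynomial_function_power real_polynomial_function_minus

text \<open>\<open>n\<close> bounds the number of coefficients rather than the degree, so that \<open>n = 0\<close> forces \<open>p = 0\<close>
  and leading coefficients may vanish at some parameters.\<close>

definition param_poly :: "nat \<Rightarrow> ('a::real_normed_vector \<Rightarrow> real poly) \<Rightarrow> bool" where
  "param_poly n p \<longleftrightarrow> (\<forall>i. real_polynomial_function (\<lambda>x. coeff (p x) i)) \<and>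
     (\<forall>x i. n \<le> i \<longrightarrow> coeff (p x) i = 0)"

lemma param_poly_mono: "param_poly m p \<Longrightarrow> m \<le> n \<Longrightarrow> param_poly n p"
  by (auto simp: param_poly_def)

lemma param_poly_cutoff:
  assumes "param_poly n p"
  shows "param_poly k (\<lambda>x. poly_cutoff k (p x))"
  unfolding param_poly_def coeff_poly_cutoff
proof (intro conjI allI impI)
  show "real_polynomial_function (\<lambda>x. if i < k then coeff (p x) i else 0)" for i
    using assms by (cases "i < k") (auto simp: param_poly_def)
qed auto

lemma poly_cutoff_eq_self:
  assumes "\<And>i. k \<le> i \<Longrightarrow> coeff p i = 0"
  shows "poly_cutoff k p = p"
  by (rule poly_eqI) (use assms in \<open>auto simp: coeff_poly_cutoff\<close>)

lemma param_poly_pderiv: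
  assumes "param_poly (Suc n) p"
  shows "param_poly n (\<lambda>x. pderiv (p x))"
  using assms unfolding param_poly_def coeff_pderiv
  by (intro conjI allI impI real_polynomial_function_intros) auto

text \<open>One step of pseudo-division by the formal leading coefficient of \<open>q\<close>,
  scaled once more by that coefficient so that the multiplier of \<open>p\<close> is a square. It
  holds also where this coefficient vanishes, which keeps the remainder polynomial in the
  parameter.\<close>

lemma param_poly_diff_monom_mult:
  assumes "param_poly (Suc m) p" "param_poly (Suc k) q" "k \<le> m"
  shows "param_poly m (\<lambda>x. smult ((coeff (q x) k)\<^sup>2) (p x)
    - monom (coeff (q x) k * coeff (p x) m) (m - k) * q x)"
  unfolding param_poly_def
proof (intro conjI allI impI)
  fix i
  have rp: "real_polynomial_function (\<lambda>x. coeff (p x) i)"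
    and rq: "real_polynomial_function (\<lambda>x. coeff (q x) i)" for i
    using assms by (auto simp: param_poly_def)
  show "real_polynomial_function (\<lambda>x. coeff (smult ((coeff (q x) k)\<^sup>2) (p x)
      - monom (coeff (q x) k * coeff (p x) m) (m - k) * q x) i)"
    unfolding coeff_diff coeff_smult coeff_monom_mult
    by (cases "i < m - k") (simp_all, (intro real_polynomial_function_intros rp rq)+)
  fix x assume "m \<le> i"
  then consider "i = m" | "Suc m \<le> i" "Suc k \<le> i - (m - k)" using assms(3) by linarith
  then show "coeff (smult ((coeff (q x) k)\<^sup>2) (p x)
      - monom (coeff (q x) k * coeff (p x) m) (m - k) * q x) i = 0"
  proof cases
    case 1
    then show ?thesis using assms(3) by (simp add: coeff_monom_mult power2_eq_square)
  next
    case 2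
    then show ?thesis using assms(1,2) by (simp add: coeff_monom_mult param_poly_def)
  qed
qed

text \<open>The even power makes the factor positive, so \<open>p\<close> and \<open>r\<close> have the same sign at roots of \<open>q\<close>.\<close>

lemma even_pseudo_remainder:
  assumes "param_poly n p" "param_poly (Suc k) q"
  shows "\<exists>r e. param_poly k r \<and>
    (\<forall>x. \<exists>s. smult ((coeff (q x) k) ^ (2 * e)) (p x) = s * q x + r x)"
  using assms(1)
proof (induction n arbitrary: p)
  case 0
  then have "param_poly k p" by (rule param_poly_mono) simp
  moreover have "\<forall>x. smult (coeff (q x) k ^ (2 * 0)) (p x) = 0 * q x + p x" by simp
  ultimately show ?case by blast
next
  case (Suc m)
  show ?case
  proof (cases "Suc m \<le> k")
    case True
    with Suc.prems have "param_poly k p" by (rule param_poly_mono)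
    moreover have "\<forall>x. smult (coeff (q x) k ^ (2 * 0)) (p x) = 0 * q x + p x" by simp
    ultimately show ?thesis by blast
  next
    case False
    then have "k \<le> m" by simp
    from Suc.IH[OF param_poly_diff_monom_mult[OF Suc.prems assms(2) this]]
    obtain r e where r: "param_poly k r" and
      eq: "\<And>x. \<exists>s. smult (coeff (q x) k ^ (2 * e)) (smult ((coeff (q x) k)\<^sup>2) (p x)
        - monom (coeff (q x) k * coeff (p x) m) (m - k) * q x) = s * q x + r x"
      by blast
    have "\<exists>s. smult (coeff (q x) k ^ (2 * Suc e)) (p x) = s * q x + r x" for x
    proof -
      obtain s where s: "smult (coeff (q x) k ^ (2 * e)) (smult ((coeff (q x) k)\<^sup>2) (p x)
        - monom (coeff (q x) k * coeff (p x) m) (m - k) * q x) = s * q x + r x"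
        using eq by blast
      have "smult (coeff (q x) k ^ (2 * Suc e)) (p x) =
        (s + smult (coeff (q x) k ^ (2 * e)) (monom (coeff (q x) k * coeff (p x) m) (m - k))) * q x + r x"
        using s by (simp add: smult_diff_right algebra_simps power_add power2_eq_square)
      then show ?thesis by blast
    qed
    then show ?thesis using r by blast
  qed
qed

section \<open>Finiteness of sign diagrams\<close>

definition same_signs :: "('a \<Rightarrow> real) set \<Rightarrow> 'a \<Rightarrow> 'a \<Rightarrow> bool" where
  "same_signs F x y \<longleftrightarrow> (\<forall>f\<in>F. sgn (f x) = sgn (f y))"

text \<open>An increasing bijection of the line expresses that both families have their roots in the
  same order with the same signs between them, and it also carries witnesses of existential
  quantifiers from \<open>x\<close> to \<open>y\<close>.\<close>

definition sign_matched :: "('a \<Rightarrow> real poly) set \<Rightarrow> 'a \<Rightarrow> 'a \<Rightarrow> bool" where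
  "sign_matched F x y \<longleftrightarrow> (\<exists>h. strict_mono h \<and> surj h \<and>
     (\<forall>p\<in>F. \<forall>t. sgn (poly (p x) t) = sgn (poly (p y) (h t))))"

text \<open>The Cohen--Hoermander step: the sign diagram of a family with the long member \<open>p\<close> is determined
  by that of the family in which \<open>p\<close> is replaced by shorter ones, namely its derivative, its truncation
  (which takes over where the leading coefficient vanishes) and its remainders modulo all truncations
  of the other members.\<close>

lemma sign_matched_insert:
  fixes p :: "'a::real_normed_vector \<Rightarrow> real poly"
  assumes "finite F" and H: "finite H" and F: "\<And>q. q \<in> F \<Longrightarrow> param_poly n q"
    and Hn: "\<And>q. q \<in> H \<Longrightarrow> param_poly (Suc n) q" and p: "param_poly (Suc n) p"
    and IH: "\<And>F. \<lbrakk>finite F; \<And>q. q \<in> F \<Longrightarrow> param_poly n q\<rbrakk> \<Longrightarrow>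
      \<exists>G. finite G \<and> (\<forall>g\<in>G. real_polynomial_function g) \<and>
        (\<forall>x y. same_signs G x y \<longrightarrow> sign_matched (F \<union> H) x y)"
  shows "\<exists>G. finite G \<and> (\<forall>g\<in>G. real_polynomial_function g) \<and>
    (\<forall>x y. same_signs G x y \<longrightarrow> sign_matched (F \<union> insert p H) x y)"
proof -
  define pd where "pd = (\<lambda>x. pderiv (p x))"
  define ct where "ct = (\<lambda>x. poly_cutoff n (p x))"
  define B where "B = insert pd (insert ct (F \<union> H))"
  have pd: "param_poly n pd" unfolding pd_def using p by (rule param_poly_pderiv)
  have ct: "param_poly n ct" unfolding ct_def using p by (rule param_poly_cutoff)
  have B: "finite B" and Bn: "\<And>q. q \<in> B \<Longrightarrow> param_poly (Suc n) q"
    using assms(1) H Hn F pd ct by (auto simp: B_def intro: param_poly_mono[of n])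
  have "\<forall>q\<in>B. \<forall>k. \<exists>r e. param_poly k r \<and>
      (\<forall>x. \<exists>s. smult ((coeff (poly_cutoff (Suc k) (q x)) k) ^ (2 * e)) (p x)
        = s * poly_cutoff (Suc k) (q x) + r x)"
    using even_pseudo_remainder[OF p param_poly_cutoff] Bn by blast
  then obtain r e where r: "\<And>q k. q \<in> B \<Longrightarrow> param_poly k (r q k)"
    and re: "\<And>q k x. q \<in> B \<Longrightarrow> \<exists>s. smult ((coeff (poly_cutoff (Suc k) (q x)) k) ^ (2 * e q k)) (p x)
        = s * poly_cutoff (Suc k) (q x) + r q k x"
    by metis
  \<comment> \<open>The degree of \<open>q\<close> varies with the parameter. Wherever it is
    \<open>k\<close>, \<open>q\<close> coincides with its truncation to \<open>Suc k\<close>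
    coefficients, so one remainder for each \<open>k \<le> n\<close> covers all parameters.\<close>
  define R where "R = (\<lambda>(q, k). r q k) ` (B \<times> {..n})"
  have "\<exists>G. finite G \<and> (\<forall>g\<in>G. real_polynomial_function g) \<and>
      (\<forall>x y. same_signs G x y \<longrightarrow> sign_matched (insert pd (insert ct (F \<union> R)) \<union> H) x y)"
  proof (rule IH)
    show "finite (insert pd (insert ct (F \<union> R)))" using assms(1) B by (simp add: R_def)
    show "param_poly n q" if "q \<in> insert pd (insert ct (F \<union> R))" for q
      using that pd ct F r by (auto simp: R_def intro: param_poly_mono)
  qed
  then obtain G0 where G0: "finite G0" "\<forall>g\<in>G0. real_polynomial_function g"
    and match: "\<And>x y. same_signs G0 x y \<Longrightarrow> sign_matched (insert pd (insert ct (F \<union> R)) \<union> H) x y"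
    by blast
  \<comment> \<open>Signs of coefficients are added so that equal signs force equal degrees at
    \<open>x\<close> and \<open>y\<close>, as well as equal signs of the constant terms.\<close>
  define G where "G = G0 \<union> (\<lambda>(q, i) x. coeff (q x) i) ` (insert p B \<times> {..n})"
  have "finite G" using G0(1) B by (simp add: G_def)
  moreover have "\<forall>g\<in>G. real_polynomial_function g"
    using G0(2) Bn p by (auto simp: G_def param_poly_def)
  moreover have "sign_matched (F \<union> insert p H) x y" if G: "same_signs G x y" for x y
  proof -
    have "same_signs G0 x y" using G by (auto simp: G_def same_signs_def)
    then obtain h0 where h0: "strict_mono h0" "surj h0" and
      h0F: "\<And>q t. q \<in> insert pd (insert ct (F \<union> R)) \<union> H \<Longrightarrow> sgn (poly (q x) t) = sgn (poly (q y) (h0 t))"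
      using match unfolding sign_matched_def by blast
    have co: "sgn (coeff (q x) i) = sgn (coeff (q y) i)" if "q \<in> insert p B" for q i
    proof (cases "i \<le> n")
      case True
      then have "(\<lambda>x. coeff (q x) i) \<in> G" using that by (force simp: G_def)
      then show ?thesis using G by (auto simp: same_signs_def)
    next
      case False
      then show ?thesis using that p Bn by (auto simp: param_poly_def)
    qed
    show ?thesis
    proof (cases "coeff (p x) n = 0")
      case True
      then have "coeff (p y) n = 0" using co[of p n] by (simp add: sgn_0_0)
      then have "coeff (p x) i = 0" "coeff (p y) i = 0" if "n \<le> i" for i
        using True p that by (cases "i = n"; simp add: param_poly_def)+
      then have "p x = ct x" "p y = ct y"
        by (simp_all add: ct_def poly_cutoff_eq_self)
      then show ?thesis
        unfolding sign_matched_def using h0 h0F by (intro exI[of _ h0]) auto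
    next
      case False
      have "\<exists>h. strict_mono h \<and> surj h \<and> (\<forall>q\<in>B. \<forall>t. sgn (poly (q x) t) = sgn (poly (q y) (h t))) \<and>
        (\<forall>t. sgn (poly (p x) t) = sgn (poly (p y) (h t)))"
      proof (rule sign_match_extend[OF B h0, where j = pd])
        show "sgn (poly (q x) t) = sgn (poly (q y) (h0 t))" if "q \<in> B" for q t
          using h0F that by (auto simp: B_def)
        show "pd \<in> B" by (simp add: B_def)
        show "sgn (coeff (p x) 0) = sgn (coeff (p y) 0)" using co by blast
        fix q t assume q: "q \<in> B" "q x \<noteq> 0" "poly (q x) t = 0"
        define k where "k = degree (q x)"
        have kx: "coeff (q x) k \<noteq> 0" using q(2) by (simp add: k_def)
        then have ky: "coeff (q y) k \<noteq> 0" using co[of q k] q(1) by (auto simp: sgn_0_0)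
        have "k \<le> n"
          using kx Bn[OF q(1)] by (meson not_less_eq_eq param_poly_def)
        have hix: "coeff (q x) i = 0" if "Suc k \<le> i" for i
          using that by (simp add: k_def coeff_eq_0)
        then have hiy: "coeff (q y) i = 0" if "Suc k \<le> i" for i
          using co[of q i] q(1) that by (simp add: sgn_0_0)
        have cx: "poly_cutoff (Suc k) (q x) = q x" "poly_cutoff (Suc k) (q y) = q y"
          using hix hiy by (simp_all add: poly_cutoff_eq_self)
        have qy: "poly (q y) (h0 t) = 0"
          using h0F[of q t] q by (auto simp: B_def sgn_0_0)
        have sgn_r: "sgn (poly (p z) a) = sgn (poly (r q k z) a)"
          if z: "poly_cutoff (Suc k) (q z) = q z" "poly (q z) a = 0" "coeff (q z) k \<noteq> 0" for z a
        proof -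
          obtain s where "smult ((coeff (q z) k) ^ (2 * e q k)) (p z) = s * q z + r q k z"
            using re[OF q(1), of k z] z(1) by auto
          from arg_cong[OF this, of "\<lambda>w. poly w a"]
          have "(coeff (q z) k) ^ (2 * e q k) * poly (p z) a = poly (r q k z) a"
            using z(2) by simp
          moreover have "sgn ((coeff (q z) k) ^ (2 * e q k)) = 1"
            using z(3) by (simp add: power_mult sgn_if)
          ultimately show ?thesis by (metis mult_1 sgn_mult)
        qed
        have "r q k \<in> R" using q(1) \<open>k \<le> n\<close> by (force simp: R_def)
        then show "sgn (poly (p x) t) = sgn (poly (p y) (h0 t))"
          using sgn_r[OF cx(1) q(3) kx] sgn_r[OF cx(2) qy ky] h0F[of "r q k" t] by simp
      qed (auto simp: pd_def)
      then show ?thesis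
        unfolding sign_matched_def by (auto simp: B_def)
    qed
  qed
  ultimately show ?thesis by blast
qed

text \<open>Outer induction on the length bound, inner induction on the set \<open>H\<close> of
  members of full length. The set \<open>F\<close> of shorter members stays arbitrary in the inner
  induction, since removing one member of \<open>H\<close> adds many shorter ones.\<close>

lemma finite_sign_diagrams:
  fixes F :: "('a::real_normed_vector \<Rightarrow> real poly) set"
  assumes "finite F" "\<And>q. q \<in> F \<Longrightarrow> param_poly n q"
  shows "\<exists>G. finite G \<and> (\<forall>g\<in>G. real_polynomial_function g) \<and>
    (\<forall>x y. same_signs G x y \<longrightarrow> sign_matched F x y)"
  using assms
proof (induction n arbitrary: F)
  case 0
  have zero: "q x = 0" if "q \<in> F" for q x
    using 0(2)[OF that] by (auto simp: param_poly_def intro: poly_eqI)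
  have "sign_matched F x y" for x y
    unfolding sign_matched_def
  proof (intro exI conjI ballI allI)
    show "strict_mono (id :: real \<Rightarrow> real)" by (simp add: strict_mono_def)
    show "sgn (poly (q x) t) = sgn (poly (q y) (id t))" if "q \<in> F" for q t
      unfolding zero[OF that] by simp
  qed simp
  then have "finite {} \<and> (\<forall>g\<in>{}. real_polynomial_function g) \<and>
    (\<forall>x y. same_signs {} x y \<longrightarrow> sign_matched F x y)" by simp
  then show ?case by blast
next
  case (Suc n)
  have "\<exists>G. finite G \<and> (\<forall>g\<in>G. real_polynomial_function g) \<and>
    (\<forall>x y. same_signs G x y \<longrightarrow> sign_matched (F \<union> H) x y)"
    if "finite H" "\<And>q. q \<in> H \<Longrightarrow> param_poly (Suc n) q" "finite F" "\<And>q. q \<in> F \<Longrightarrow> param_poly n q"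
    for F H :: "('a \<Rightarrow> real poly) set"
    using that
  proof (induction H arbitrary: F)
    case empty
    then show ?case using Suc.IH[of F] by simp
  next
    case (insert p H)
    show ?case
      by (rule sign_matched_insert) (use insert in auto)
  qed
  from this[OF Suc.prems, of "{}"] show ?case by simp
qed

section \<open>Definable sets and projections\<close>

lemma polynomial_function_fst:
  "polynomial_function f \<Longrightarrow> polynomial_function (\<lambda>x. fst (f x))"
  using polynomial_function_compose[OF _ polynomial_function_bounded_linear[OF bounded_linear_fst]]
  unfolding o_def .

lemma polynomial_function_snd:
  "polynomial_function f \<Longrightarrow> polynomial_function (\<lambda>x. snd (f x))"
  using polynomial_function_compose[OF _ polynomial_function_bounded_linear[OF bounded_linear_snd]]
  unfolding o_def .

lemma polynomial_function_Pair:
  assumes "polynomial_function f" "polynomial_function g"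
  shows "polynomial_function (\<lambda>x. (f x, g x))"
  unfolding polynomial_function_def o_def
proof (intro allI impI)
  fix h :: "'b \<times> 'c \<Rightarrow> real" assume h: "bounded_linear h"
  have "real_polynomial_function (\<lambda>x. h (f x, 0))"
    using assms(1) bounded_linear_compose[OF h bounded_linear_Pair[OF bounded_linear_ident bounded_linear_zero]]
    unfolding polynomial_function_def o_def by blast
  moreover have "real_polynomial_function (\<lambda>x. h (0, g x))"
    using assms(2) bounded_linear_compose[OF h bounded_linear_Pair[OF bounded_linear_zero bounded_linear_ident]]
    unfolding polynomial_function_def o_def by blast
  moreover have "h (f x, g x) = h (f x, 0) + h (0, g x)" for x
    using linear_add[OF bounded_linear.linear[OF h], of "(f x, 0)" "(0, g x)"] by simp
  ultimately show "real_polynomial_function (\<lambda>x. h (f x, g x))"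
    using real_polynomial_function.intros(3) by simp
qed

lemma polynomial_function_inner:
  fixes f g :: "'a::real_normed_vector \<Rightarrow> 'b::euclidean_space"
  assumes "polynomial_function f" "polynomial_function g"
  shows "polynomial_function (\<lambda>x. f x \<bullet> g x)"
proof -
  have "real_polynomial_function (\<lambda>x. \<Sum>b\<in>Basis. (f x \<bullet> b) * (g x \<bullet> b))"
    using assms unfolding polynomial_function_iff_Basis_inner
    by (intro real_polynomial_function_sum finite_Basis real_polynomial_function_intros) auto
  then show ?thesis
    by (simp add: euclidean_inner[symmetric] real_polynomial_function_eq)
qed

lemma polynomial_function_times:
  fixes f g :: "'a::real_normed_vector \<Rightarrow> real"
  assumes "polynomial_function f" "polynomial_function g"
  shows "polynomial_function (\<lambda>x. f x * g x)"
  using polynomial_function_mult[OF assms] by simp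

lemma polynomial_function_power2:
  fixes f :: "'a::real_normed_vector \<Rightarrow> real"
  assumes "polynomial_function f"
  shows "polynomial_function (\<lambda>x. (f x)\<^sup>2)"
  unfolding power2_eq_square using polynomial_function_times assms by blast

lemma polynomial_function_nth:
  fixes f :: "'a::real_normed_vector \<Rightarrow> real ^ 'n"
  assumes "polynomial_function f"
  shows "polynomial_function (\<lambda>x. f x $ i)"
  using polynomial_function_inner[OF assms polynomial_function_const[of "axis i 1"]]
  by (simp add: inner_axis)

lemmas polynomial_function_intros =
  polynomial_function_const polynomial_function_id polynomial_function_fst polynomial_function_snd
  polynomial_function_Pair polynomial_function_inner polynomial_function_times
  polynomial_function_power2 polynomial_function_nth polynomial_function_add
  polynomial_function_diff polynomial_function_minus polynomial_function_mult

text \<open>Semialgebraic sets in a form for which Boolean operations are immediate.\<close>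

definition sign_definable :: "'a::real_normed_vector set \<Rightarrow> bool" where
  "sign_definable S \<longleftrightarrow> (\<exists>F. finite F \<and> (\<forall>f\<in>F. real_polynomial_function f) \<and>
     (\<forall>x y. same_signs F x y \<longrightarrow> x \<in> S \<longrightarrow> y \<in> S))"

lemma same_signs_sym: "same_signs F x y \<Longrightarrow> same_signs F y x"
  by (simp add: same_signs_def)

lemma same_signs_Un: "same_signs (F \<union> G) x y \<longleftrightarrow> same_signs F x y \<and> same_signs G x y"
  by (auto simp: same_signs_def)

lemma sign_definableI:
  assumes "finite F" "\<And>f. f \<in> F \<Longrightarrow> real_polynomial_function f"
    "\<And>x y. same_signs F x y \<Longrightarrow> x \<in> S \<Longrightarrow> y \<in> S"
  shows "sign_definable S"
  using assms unfolding sign_definable_def by blast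

lemma sign_definableE:
  assumes "sign_definable S"
  obtains F where "finite F" "\<And>f. f \<in> F \<Longrightarrow> real_polynomial_function f"
    "\<And>x y. same_signs F x y \<Longrightarrow> x \<in> S \<longleftrightarrow> y \<in> S"
  using assms same_signs_sym unfolding sign_definable_def by (metis (full_types))

lemma sign_definable_sgn:
  assumes "polynomial_function f"
  shows "sign_definable {x. R (sgn (f x :: real))}"
  by (rule sign_definableI[of "{f}"])
    (use assms in \<open>auto simp: same_signs_def real_polynomial_function_eq\<close>)

lemma sign_definable_less:
  assumes "polynomial_function f" "polynomial_function g"
  shows "sign_definable {x. f x < (g x :: real)}"
proof -
  have "f x < g x \<longleftrightarrow> sgn (g x - f x) = 1" for x by (simp add: sgn_1_pos)
  then show ?thesis
    using sign_definable_sgn[OF polynomial_function_diff[OF assms(2,1)], of "\<lambda>s. s = 1"] by simp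
qed

lemma sign_definable_not:
  assumes "sign_definable {x. P x}"
  shows "sign_definable {x. \<not> P x}"
  using assms by (elim sign_definableE) (rule sign_definableI, auto)

lemma sign_definable_conj:
  assumes "sign_definable {x. P x}" "sign_definable {x. Q x}"
  shows "sign_definable {x. P x \<and> Q x}"
proof -
  obtain F where F: "finite F" "\<And>f. f \<in> F \<Longrightarrow> real_polynomial_function f"
    "\<And>x y. same_signs F x y \<Longrightarrow> x \<in> {x. P x} \<longleftrightarrow> y \<in> {x. P x}"
    using assms(1) by (rule sign_definableE) blast
  obtain G where G: "finite G" "\<And>f. f \<in> G \<Longrightarrow> real_polynomial_function f"
    "\<And>x y. same_signs G x y \<Longrightarrow> x \<in> {x. Q x} \<longleftrightarrow> y \<in> {x. Q x}"
    using assms(2) by (rule sign_definableE) blast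
  show ?thesis
    by (rule sign_definableI[of "F \<union> G"]) (use F G in \<open>auto simp: same_signs_Un\<close>)
qed

lemma sign_definable_disj:
  assumes "sign_definable {x. P x}" "sign_definable {x. Q x}"
  shows "sign_definable {x. P x \<or> Q x}"
  using sign_definable_not[OF sign_definable_conj[OF assms[THEN sign_definable_not]]] by simp

lemma sign_definable_imp:
  assumes "sign_definable {x. P x}" "sign_definable {x. Q x}"
  shows "sign_definable {x. P x \<longrightarrow> Q x}"
  unfolding imp_conv_disj by (intro sign_definable_disj sign_definable_not assms)

lemma sign_definable_const: "sign_definable {x. b}"
  by (rule sign_definableI[of "{}"]) (auto split: if_splits)

lemma sign_definable_le:
  assumes "polynomial_function f" "polynomial_function g"
  shows "sign_definable {x. f x \<le> (g x :: real)}"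
  using sign_definable_not[OF sign_definable_less[OF assms(2,1)]] by (simp add: not_less)

lemma sign_definable_eq:
  assumes "polynomial_function f" "polynomial_function g"
  shows "sign_definable {x. f x = (g x :: real)}"
  using sign_definable_conj[OF sign_definable_le[OF assms] sign_definable_le[OF assms(2,1)]]
  by (simp add: order_eq_iff)

lemma sign_definable_finite_ball:
  assumes "finite A" "\<And>a. a \<in> A \<Longrightarrow> sign_definable {x. P a x}"
  shows "sign_definable {x. \<forall>a\<in>A. P a x}"
  using assms
proof (induction A)
  case empty
  show ?case using sign_definable_const[of True] by simp
next
  case (insert a A)
  then show ?case
    using sign_definable_conj[of "P a" "\<lambda>x. \<forall>a\<in>A. P a x"] by simp
qed

lemma sign_definable_finite_bex:
  assumes "finite A" "\<And>a. a \<in> A \<Longrightarrow> sign_definable {x. P a x}"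
  shows "sign_definable {x. \<exists>a\<in>A. P a x}"
proof -
  have "sign_definable {x. \<not> (\<forall>a\<in>A. \<not> P a x)}"
    by (intro sign_definable_not sign_definable_finite_ball assms)
  then show ?thesis by simp
qed

lemma sign_definable_mem:
  assumes "sign_definable S" "polynomial_function \<phi>"
  shows "sign_definable {x. \<phi> x \<in> S}"
proof -
  obtain F where F: "finite F" "\<And>f. f \<in> F \<Longrightarrow> real_polynomial_function f"
    "\<And>x y. same_signs F x y \<Longrightarrow> x \<in> S \<longleftrightarrow> y \<in> S"
    using assms(1) by (rule sign_definableE) blast
  show ?thesis
  proof (rule sign_definableI[of "(\<lambda>f. f \<circ> \<phi>) ` F"])
    show "real_polynomial_function f" if "f \<in> (\<lambda>f. f \<circ> \<phi>) ` F" for f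
      using that F(2) assms(2) by (auto intro: real_polynomial_function_compose)
    show "y \<in> {x. \<phi> x \<in> S}" if "same_signs ((\<lambda>f. f \<circ> \<phi>) ` F) x y" "x \<in> {x. \<phi> x \<in> S}" for x y
      using that F(3)[of "\<phi> x" "\<phi> y"] by (auto simp: same_signs_def)
  qed (use F(1) in simp)
qed

section \<open>Elimination of real quantifiers\<close>

lemma param_poly_add:
  assumes "param_poly m p" "param_poly n q"
  shows "param_poly (max m n) (\<lambda>x. p x + q x)"
  using assms unfolding param_poly_def coeff_add
  by (auto intro: real_polynomial_function_intros)

lemma param_poly_mult:
  assumes "param_poly m p" "param_poly n q"
  shows "param_poly (m + n) (\<lambda>x. p x * q x)"
  unfolding param_poly_def coeff_mult
proof (intro conjI allI impI)
  show "real_polynomial_function (\<lambda>x. \<Sum>j\<le>i. coeff (p x) j * coeff (q x) (i - j))" for i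
    using assms unfolding param_poly_def
    by (intro real_polynomial_function_sum real_polynomial_function_intros) auto
  show "(\<Sum>j\<le>i. coeff (p x) j * coeff (q x) (i - j)) = 0" if i: "m + n \<le> i" for x i
  proof (intro sum.neutral ballI)
    show "coeff (p x) j * coeff (q x) (i - j) = 0" for j
    proof (cases "m \<le> j")
      case True
      then show ?thesis using assms(1) by (simp add: param_poly_def)
    next
      case False
      then have "n \<le> i - j" using i by linarith
      then show ?thesis using assms(2) by (simp add: param_poly_def)
    qed
  qed
qed

text \<open>Links polynomials on a product, on which quantifiers act, to the univariate families
  with parameters treated above.\<close>

lemma real_polynomial_function_as_param_poly:
  fixes f :: "'a::real_normed_vector \<times> real \<Rightarrow> real"
  assumes "real_polynomial_function f"
  shows "\<exists>n p. param_poly n p \<and> (\<forall>x t. f (x, t) = poly (p x) t)"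
  using assms
proof (induction rule: real_polynomial_function.induct)
  case (linear f)
  have "f (x, t) = poly [:f (x, 0), f (0, 1):] t" for x t
    using linear_add[OF bounded_linear.linear[OF linear], of "(x, 0)" "t *\<^sub>R (0, 1)"]
      linear_scale[OF bounded_linear.linear[OF linear], of t "(0, 1)"] by simp
  moreover have "param_poly 2 (\<lambda>x. [:f (x, 0), f (0, 1):])"
  proof -
    have "real_polynomial_function (\<lambda>x. f (x, 0))"
      by (rule real_polynomial_function.intros(1))
        (rule bounded_linear_compose[OF linear bounded_linear_Pair[OF bounded_linear_ident bounded_linear_zero]])
    then have "real_polynomial_function (\<lambda>x. coeff [:f (x, 0), f (0, 1):] i)" for i
      by (cases i; cases "i - 1") (auto simp: coeff_pCons real_polynomial_function_intros)
    then show ?thesis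
      by (auto simp: param_poly_def coeff_pCons split: nat.splits)
  qed
  ultimately show ?case by blast
next
  case (const c)
  have "param_poly 1 (\<lambda>x::'a. [:c:])"
    by (auto simp: param_poly_def coeff_pCons real_polynomial_function_intros split: nat.splits)
  then show ?case by (intro exI[of _ 1] exI[of _ "\<lambda>_. [:c:]"]) simp
next
  case (add f g)
  then obtain m p n q where pq: "param_poly m p" "\<And>x t. f (x, t) = poly (p x) t"
    "param_poly n q" "\<And>x t. g (x, t) = poly (q x) t" by blast
  then show ?case
    by (intro exI[of _ "max m n"] exI[of _ "\<lambda>x. p x + q x"]) (simp add: param_poly_add)
next
  case (mult f g)
  then obtain m p n q where pq: "param_poly m p" "\<And>x t. f (x, t) = poly (p x) t"
    "param_poly n q" "\<And>x t. g (x, t) = poly (q x) t" by blast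
  then show ?case
    by (intro exI[of _ "m + n"] exI[of _ "\<lambda>x. p x * q x"]) (simp add: param_poly_mult)
qed

text \<open>Tarski--Seidenberg for one real variable: a witness \<open>t\<close> over
  \<open>x\<close> is carried by the bijection to the witness \<open>h t\<close> over
  \<open>y\<close>.\<close>

lemma sign_definable_fst_image:
  fixes S :: "('a::real_normed_vector \<times> real) set"
  assumes "sign_definable S"
  shows "sign_definable (fst ` S)"
proof -
  obtain F where F: "finite F" "\<And>f. f \<in> F \<Longrightarrow> real_polynomial_function f"
    "\<And>x y. same_signs F x y \<Longrightarrow> x \<in> S \<longleftrightarrow> y \<in> S"
    using assms by (rule sign_definableE) blast
  have "\<forall>f\<in>F. \<exists>n p. param_poly n p \<and> (\<forall>x t. f (x, t) = poly (p x) t)"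
    using F(2) real_polynomial_function_as_param_poly by blast
  then obtain n p where p: "\<And>f. f \<in> F \<Longrightarrow> param_poly (n f) (p f)"
    "\<And>f x t. f \<in> F \<Longrightarrow> f (x, t) = poly (p f x) t" by metis
  define N where "N = Max (n ` F)"
  have "param_poly N (p f)" if "f \<in> F" for f
    using p(1)[OF that] by (rule param_poly_mono) (use F(1) that in \<open>simp add: N_def\<close>)
  then obtain G where G: "finite G" "\<And>g. g \<in> G \<Longrightarrow> real_polynomial_function g"
    "\<And>x y. same_signs G x y \<Longrightarrow> sign_matched (p ` F) x y"
    using finite_sign_diagrams[of "p ` F" N] F(1) by blast
  show ?thesis
  proof (rule sign_definableI[OF G(1,2)])
    fix x y assume G_xy: "same_signs G x y" and "x \<in> fst ` S"
    then obtain t where t: "(x, t) \<in> S" by auto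
    obtain h where h: "\<And>f t. f \<in> F \<Longrightarrow> sgn (poly (p f x) t) = sgn (poly (p f y) (h t))"
      using G(3)[OF G_xy] unfolding sign_matched_def by blast
    have "same_signs F (x, t) (y, h t)"
      unfolding same_signs_def using h p(2) by simp
    then have "(y, h t) \<in> S" using F(3) t by blast
    then show "y \<in> fst ` S" by (rule image_eqI[rotated]) simp
  qed
qed

lemma sign_definable_ex_real:
  assumes "sign_definable {z. P (fst z) (snd z :: real)}"
  shows "sign_definable {x. \<exists>t. P x t}"
proof -
  have "{x. \<exists>t. P x t} = fst ` {z. P (fst z) (snd z)}" by (auto simp: image_iff)
  then show ?thesis using sign_definable_fst_image[OF assms] by simp
qed

lemma sign_definable_ex:
  fixes P :: "'a::real_normed_vector \<Rightarrow> 'b::euclidean_space \<Rightarrow> bool"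
  assumes "sign_definable {z. P (fst z) (snd z)}"
  shows "sign_definable {x. \<exists>y. P x y}"
proof -
  \<comment> \<open>Eliminates a vector one basis direction at a time. The second component stays in
    its space as a base point that may move along the span of \<open>B\<close>, so the type is the
    same throughout the induction; for the full basis and base point 0 this is the plain
    quantifier.\<close>
  define T where "T B = {z. \<exists>c. P (fst z) (snd z + (\<Sum>b\<in>B. c b *\<^sub>R b))}" for B
  have "sign_definable (T B)" if "finite B" for B
    using that
  proof (induction B)
    case empty
    then show ?case using assms by (simp add: T_def)
  next
    case (insert b B)
    have "T (insert b B) = {z. \<exists>t. (fst z, snd z + t *\<^sub>R b) \<in> T B}"
    proof (intro set_eqI iffI)
      fix z assume "z \<in> T (insert b B)"
      then obtain c where "P (fst z) (snd z + (\<Sum>a\<in>insert b B. c a *\<^sub>R a))" by (auto simp: T_def)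
      then have "P (fst z) ((snd z + c b *\<^sub>R b) + (\<Sum>a\<in>B. c a *\<^sub>R a))"
        using insert.hyps by (simp add: add.assoc)
      then show "z \<in> {z. \<exists>t. (fst z, snd z + t *\<^sub>R b) \<in> T B}" by (auto simp: T_def)
    next
      fix z assume "z \<in> {z. \<exists>t. (fst z, snd z + t *\<^sub>R b) \<in> T B}"
      then obtain t c where c: "P (fst z) ((snd z + t *\<^sub>R b) + (\<Sum>a\<in>B. c a *\<^sub>R a))"
        by (auto simp: T_def)
      have "(\<Sum>a\<in>insert b B. (c(b := t)) a *\<^sub>R a) = t *\<^sub>R b + (\<Sum>a\<in>B. (c(b := t)) a *\<^sub>R a)"
        using insert.hyps by simp
      also have "(\<Sum>a\<in>B. (c(b := t)) a *\<^sub>R a) = (\<Sum>a\<in>B. c a *\<^sub>R a)"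
        using insert.hyps(2) by (intro sum.cong) auto
      finally have "P (fst z) (snd z + (\<Sum>a\<in>insert b B. (c(b := t)) a *\<^sub>R a))"
        using c by (simp only: add.assoc)
      then show "z \<in> T (insert b B)" unfolding T_def by blast
    qed
    moreover have "sign_definable {z. \<exists>t. (fst z, snd z + t *\<^sub>R b) \<in> T B}"
      by (intro sign_definable_ex_real sign_definable_mem[OF insert.IH] polynomial_function_intros)
    ultimately show ?case by simp
  qed
  then have "sign_definable {x. (x, 0) \<in> T Basis}"
    by (intro sign_definable_mem polynomial_function_intros) auto
  also have "{x. (x, 0) \<in> T Basis} = {x. \<exists>y. P x y}"
  proof -
    have "P x y \<Longrightarrow> P x (\<Sum>b\<in>Basis. (y \<bullet> b) *\<^sub>R b)" for x y
      by (simp only: euclidean_representation)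
    then show ?thesis unfolding T_def by auto
  qed
  finally show ?thesis .
qed

lemma sign_definable_all:
  fixes P :: "'a::real_normed_vector \<Rightarrow> 'b::euclidean_space \<Rightarrow> bool"
  assumes "sign_definable {z. P (fst z) (snd z)}"
  shows "sign_definable {x. \<forall>y. P x y}"
  using sign_definable_not[OF sign_definable_ex[OF sign_definable_not[OF assms]]] by simp

section \<open>Semialgebraicity, closure and differentiability\<close>

lemmas sign_definable_intros =
  sign_definable_ex sign_definable_all sign_definable_not sign_definable_conj sign_definable_disj
  sign_definable_imp sign_definable_less sign_definable_le sign_definable_eq

text \<open>Cells are given by sign vectors: zero on \<open>A\<close>, positive on \<open>B\<close>,
  negative on the rest of \<open>F\<close>. There are finitely many, and \<open>S\<close> is the
  union of the cells it contains because the cell of a point consists of the points with the same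
  signs.\<close>

lemma semialgebraic_if_sign_definable:
  assumes "sign_definable S"
  shows "semialgebraic S"
proof -
  obtain F where F: "finite F" "\<And>f. f \<in> F \<Longrightarrow> real_polynomial_function f"
    "\<And>x y. same_signs F x y \<Longrightarrow> x \<in> S \<longleftrightarrow> y \<in> S"
    using assms by (rule sign_definableE) blast
  define cell where "cell A B = {y. (\<forall>f\<in>A. f y = 0) \<and> (\<forall>f\<in>B \<union> (\<lambda>f x. - f x) ` (F - A - B). f y > 0)}"
    for A B
  have mem: "y \<in> cell {f\<in>F. f x = 0} {f\<in>F. f x > 0} \<longleftrightarrow> same_signs F x y" for x y
  proof -
    have "same_signs F x y \<longleftrightarrow> (\<forall>f\<in>F. (f x = 0 \<longrightarrow> f y = 0) \<and> (f x > 0 \<longrightarrow> f y > 0) \<and> (f x < 0 \<longrightarrow> f y < 0))"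
      unfolding same_signs_def by (intro ball_cong refl) (auto simp: sgn_real_def)
    also have "\<dots> \<longleftrightarrow> y \<in> cell {f\<in>F. f x = 0} {f\<in>F. f x > 0}"
      unfolding cell_def by (auto simp: ball_Un)
    finally show ?thesis ..
  qed
  define \<B> where "\<B> = {cell A B | A B. A \<subseteq> F \<and> B \<subseteq> F \<and> cell A B \<subseteq> S}"
  have "\<B> \<subseteq> (\<lambda>(A, B). cell A B) ` (Pow F \<times> Pow F)" by (auto simp: \<B>_def)
  then have "finite \<B>" by (rule finite_subset) (use F(1) in simp)
  moreover have "basic_semialgebraic C" if "C \<in> \<B>" for C
  proof -
    obtain A B where AB: "A \<subseteq> F" "B \<subseteq> F" "C = cell A B" using \<open>C \<in> \<B>\<close> by (auto simp: \<B>_def)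
    show ?thesis
      unfolding basic_semialgebraic_def
    proof (intro exI conjI)
      show "finite A" "finite (B \<union> (\<lambda>f x. - f x) ` (F - A - B))"
        using AB F(1) by (auto intro: finite_subset)
      show "\<forall>p\<in>A \<union> (B \<union> (\<lambda>f x. - f x) ` (F - A - B)). real_polynomial_function p"
        using AB(1,2) F(2) real_polynomial_function_minus by blast
      show "C = {x. (\<forall>p\<in>A. p x = 0) \<and> (\<forall>p\<in>B \<union> (\<lambda>f x. - f x) ` (F - A - B). p x > 0)}"
        by (simp only: AB(3) cell_def)
    qed
  qed
  moreover have "S = \<Union>\<B>"
  proof
    show "S \<subseteq> \<Union>\<B>"
    proof
      fix x assume x: "x \<in> S"
      have "cell {f\<in>F. f x = 0} {f\<in>F. f x > 0} \<subseteq> S"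
        using mem F(3) x by blast
      then have "cell {f\<in>F. f x = 0} {f\<in>F. f x > 0} \<in> \<B>" unfolding \<B>_def by blast
      moreover have "x \<in> cell {f\<in>F. f x = 0} {f\<in>F. f x > 0}"
        using mem by (simp add: same_signs_def)
      ultimately show "x \<in> \<Union>\<B>" by blast
    qed
  qed (auto simp: \<B>_def)
  ultimately show ?thesis unfolding semialgebraic_def by blast
qed

text \<open>The epsilon description of the closure, with squared distances so that all comparisons
  are polynomial.\<close>

lemma sign_definable_closure:
  fixes S :: "'a::euclidean_space set"
  assumes "sign_definable S"
  shows "sign_definable (closure S)"
proof -
  have "closure S = {x. \<forall>e. 0 < e \<longrightarrow> (\<exists>y. y \<in> S \<and> (y - x) \<bullet> (y - x) < e\<^sup>2)}"
    by (intro set_eqI) (auto simp: closure_approachable dist_norm norm_lt_square)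
  moreover have "sign_definable {x. \<forall>e. 0 < e \<longrightarrow> (\<exists>y. y \<in> S \<and> (y - x) \<bullet> (y - x) < e\<^sup>2)}"
    by (intro sign_definable_intros sign_definable_mem[OF assms] polynomial_function_intros)
  ultimately show ?thesis by simp
qed

text \<open>Two changes prepare the epsilon-delta definition for quantifier elimination: the
  derivative is represented by a gradient vector, over which one can quantify, and the norms are
  squared.\<close>

lemma differentiable_real_iff:
  fixes f :: "'a::euclidean_space \<Rightarrow> real"
  shows "f differentiable (at x) \<longleftrightarrow>
    (\<exists>g. \<forall>e. 0 < e \<longrightarrow> (\<exists>d. 0 < d \<and> (\<forall>y. (y - x) \<bullet> (y - x) < d\<^sup>2 \<longrightarrow>
      (f y - f x - g \<bullet> (y - x))\<^sup>2 \<le> e\<^sup>2 * ((y - x) \<bullet> (y - x)))))"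
proof -
  have bound: "(f y - f x - g \<bullet> (y - x))\<^sup>2 \<le> e\<^sup>2 * ((y - x) \<bullet> (y - x)) \<longleftrightarrow>
      norm (f y - f x - g \<bullet> (y - x)) \<le> e * norm (y - x)" if "e > 0" for e g y
  proof -
    have "e\<^sup>2 * ((y - x) \<bullet> (y - x)) = (e * norm (y - x))\<^sup>2"
      by (simp add: power_mult_distrib power2_norm_eq_inner)
    then show ?thesis using that by (simp add: abs_le_square_iff[symmetric] abs_mult)
  qed
  have near: "(y - x) \<bullet> (y - x) < d\<^sup>2 \<longleftrightarrow> norm (y - x) < d" if "d > 0" for d y
    using that by (simp add: norm_lt_square)
  have "f differentiable (at x) \<longleftrightarrow> (\<exists>g. (f has_derivative (\<lambda>v. g \<bullet> v)) (at x))"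
  proof
    assume "f differentiable (at x)"
    then obtain f' where f': "(f has_derivative f') (at x)" unfolding differentiable_def by blast
    have "f' = (\<lambda>v. (\<Sum>b\<in>Basis. f' b *\<^sub>R b) \<bullet> v)"
    proof
      fix v
      have "f' v = f' (\<Sum>b\<in>Basis. (v \<bullet> b) *\<^sub>R b)" by (simp only: euclidean_representation)
      also have "\<dots> = (\<Sum>b\<in>Basis. (v \<bullet> b) * f' b)"
        using has_derivative_linear[OF f'] by (simp add: linear_sum linear_scale)
      finally show "f' v = (\<Sum>b\<in>Basis. f' b *\<^sub>R b) \<bullet> v"
        unfolding inner_sum_left inner_scaleR_left by (simp add: inner_commute mult.commute)
    qed
    then show "\<exists>g. (f has_derivative (\<lambda>v. g \<bullet> v)) (at x)" using f' by metis
  qed (auto simp: differentiable_def)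
  also have "\<dots> \<longleftrightarrow> (\<exists>g. \<forall>e>0. \<exists>d>0. \<forall>y. norm (y - x) < d \<longrightarrow>
      norm (f y - f x - g \<bullet> (y - x)) \<le> e * norm (y - x))"
    unfolding has_derivative_at_alt using bounded_linear_inner_right by blast
  also have "\<dots> \<longleftrightarrow> (\<exists>g. \<forall>e. 0 < e \<longrightarrow> (\<exists>d. 0 < d \<and> (\<forall>y. (y - x) \<bullet> (y - x) < d\<^sup>2 \<longrightarrow>
      (f y - f x - g \<bullet> (y - x))\<^sup>2 \<le> e\<^sup>2 * ((y - x) \<bullet> (y - x)))))"
    using bound near by (metis (no_types, lifting))
  finally show ?thesis .
qed

text \<open>The values of \<open>f\<close> are not polynomial, so they appear as variables
  \<open>s\<close> and \<open>t\<close> constrained to the graph.\<close>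

lemma sign_definable_nondiff_set:
  fixes f :: "real ^ 'r \<Rightarrow> real"
  assumes "sign_definable {(x, t). f x = t}"
  shows "sign_definable (nondiff_set f)"
proof -
  let ?G = "{(x, t). f x = t}"
  have "nondiff_set f = {x. \<not> (\<exists>g. \<forall>e. 0 < e \<longrightarrow> (\<exists>d. 0 < d \<and> (\<forall>y. (y - x) \<bullet> (y - x) < d\<^sup>2 \<longrightarrow>
      (\<forall>s t. (x, s) \<in> ?G \<longrightarrow> (y, t) \<in> ?G \<longrightarrow>
        (t - s - g \<bullet> (y - x))\<^sup>2 \<le> e\<^sup>2 * ((y - x) \<bullet> (y - x))))))}"
    unfolding nondiff_set_def differentiable_real_iff by simp
  moreover have "sign_definable \<dots>"
    by (intro sign_definable_intros sign_definable_mem[OF assms] polynomial_function_intros)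
  ultimately show ?thesis by simp
qed

section \<open>Empty interior and dimension\<close>

lemma open_subset_same_signs:
  fixes F :: "('a::topological_space \<Rightarrow> real) set"
  assumes "finite F" "\<And>f. f \<in> F \<Longrightarrow> continuous_on UNIV f" "open U" "U \<noteq> {}"
  obtains V where "open V" "V \<noteq> {}" "V \<subseteq> U" "\<And>x y. \<lbrakk>x \<in> V; y \<in> V\<rbrakk> \<Longrightarrow> same_signs F x y"
proof -
  have "\<exists>V. open V \<and> V \<noteq> {} \<and> V \<subseteq> U \<and> (\<forall>x\<in>V. \<forall>y\<in>V. same_signs F x y)"
    using assms(1,2)
  proof (induction F)
    case empty
    then show ?case using assms(3,4) by (auto simp: same_signs_def)
  next
    case (insert f F)
    then obtain V where V: "open V" "V \<noteq> {}" "V \<subseteq> U" "\<forall>x\<in>V. \<forall>y\<in>V. same_signs F x y"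
      by auto
    have cont: "continuous_on UNIV f" using insert.prems by simp
    then have op: "open {x. 0 < f x}" "open {x. f x < 0}"
      by (auto intro!: open_Collect_less continuous_intros)
    \<comment> \<open>Shrink \<open>V\<close> to an open part on which \<open>f\<close> has a strict
      sign; if there is none, \<open>f\<close> vanishes on all of \<open>V\<close>.\<close>
    consider "V \<inter> {x. 0 < f x} \<noteq> {}" | "V \<inter> {x. f x < 0} \<noteq> {}" | "\<forall>x\<in>V. f x = 0"
      using linorder_neqE by fastforce
    then show ?case
    proof cases
      case 1
      then show ?thesis using V op
        by (intro exI[of _ "V \<inter> {x. 0 < f x}"]) (auto simp: same_signs_def)
    next
      case 2
      then show ?thesis using V op
        by (intro exI[of _ "V \<inter> {x. f x < 0}"]) (auto simp: same_signs_def)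
    next
      case 3
      then have "\<forall>x\<in>V. \<forall>y\<in>V. same_signs (insert f F) x y"
        using V(4) unfolding same_signs_def by (metis insert_iff)
      then show ?thesis using V(1-3) by blast
    qed
  qed
  then show thesis using that by blast
qed

lemma semialg_dim_less_if_no_interior:
  fixes S :: "(real ^ 'r) set"
  assumes "interior S = {}"
  shows "semialg_dim S \<le> CARD('r) - 1"
proof -
  have "d \<le> CARD('r) - 1"
    if V: "subspace V" "dim V = d" "T \<subseteq> S" "V homeomorphic T" for d and V T :: "(real ^ 'r) set"
  proof -
    have "d \<le> CARD('r)" using V(2) dim_subset_UNIV[of V] by simp
    moreover have "d \<noteq> CARD('r)"
    proof
      assume "d = CARD('r)"
      then have "span V = UNIV" using V(2) dim_eq_full[of V] by simp
      then have "V = UNIV" using V(1) span_eq_iff[of V] by simp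
      then obtain f g where fg: "homeomorphism (UNIV :: (real ^ 'r) set) T f g"
        using V(4) unfolding homeomorphic_def by auto
      have "open (f ` UNIV)"
        using fg by (intro invariance_of_domain)
          (auto simp: homeomorphism_def intro: inj_on_inverseI[of _ g])
      then have "f 0 \<in> interior S"
        using fg V(3) by (auto simp: homeomorphism_def intro!: interiorI)
      then show False using assms by simp
    qed
    ultimately show ?thesis by linarith
  qed
  then have *: "d \<le> CARD('r) - 1"
    if "d \<in> {d. \<exists>(V :: (real ^ 'r) set) T. subspace V \<and> dim V = d \<and> T \<subseteq> S \<and> V homeomorphic T}" for d
    using that by blast
  \<comment> \<open>For empty \<open>S\<close> there are no cells, and \<open>Sup {}\<close> is 0 on
    natural numbers.\<close>
  have bounded: "Sup D \<le> k" if "\<And>d. d \<in> D \<Longrightarrow> d \<le> k" for D and k :: nat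
    using that cSup_least[of D k] by (cases "D = {}") auto
  show ?thesis
    unfolding semialg_dim_def by (rule bounded) (rule *)
qed

section \<open>Maxima of quadratic polynomials on polytopes\<close>

text \<open>\<open>A\<close> is not assumed symmetric, so the gradient at \<open>x\<close> is
  \<open>b + (A + transpose A) *v x\<close>; this symmetrization recurs below.\<close>

definition quad :: "real \<Rightarrow> real ^ 'r \<Rightarrow> real ^ 'r ^ 'r \<Rightarrow> real ^ 'r \<Rightarrow> real" where
  "quad c b A x = c + b \<bullet> x + x \<bullet> (A *v x)"

lemma inner_transpose_mult: "x \<bullet> (transpose A *v y) = y \<bullet> (A *v (x :: real ^ 'r))"
  using dot_lmul_matrix[of y A x] by (simp add: inner_commute vector_transpose_matrix)

lemma quad_add_scale:
  "quad c b A (x + t *\<^sub>R w) =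
     quad c b A x + t * (w \<bullet> (b + (A + transpose A) *v x)) + t\<^sup>2 * (w \<bullet> (A *v w))"
proof -
  have "w \<bullet> (transpose A *v x) = x \<bullet> (A *v w)" by (rule inner_transpose_mult)
  then show ?thesis
    by (simp add: quad_def matrix_vector_right_distrib matrix_vector_mult_add_rdistrib
        matrix_vector_mult_scaleR inner_add_left inner_add_right inner_commute[of w b]
        power2_eq_square algebra_simps)
qed

definition ineqs :: "((real ^ 'r) \<times> real) set \<Rightarrow> (real ^ 'r) set" where
  "ineqs H = {x. \<forall>h\<in>H. fst h \<bullet> x \<le> snd h}"

definition active :: "((real ^ 'r) \<times> real) set \<Rightarrow> real ^ 'r \<Rightarrow> ((real ^ 'r) \<times> real) set" where
  "active H x = {h\<in>H. fst h \<bullet> x = snd h}"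

lemma closed_ineqs: "closed (ineqs H)"
proof -
  have "ineqs H = (\<Inter>h\<in>H. {x. fst h \<bullet> x \<le> snd h})" by (auto simp: ineqs_def)
  then show ?thesis by (auto intro: closed_halfspace_le)
qed

lemma continuous_on_quad: "continuous_on S (quad c b A)"
  unfolding quad_def by (intro continuous_intros matrix_vector_mult_linear_continuous_on)

text \<open>Inactive constraints have slack and active ones are constant along \<open>w\<close>, so
  a short step in either direction remains feasible.\<close>

lemma feasible_both_ways:
  assumes "finite H" "x \<in> ineqs H" "\<And>h. h \<in> active H x \<Longrightarrow> fst h \<bullet> w = 0"
  obtains e where "e > 0" "\<And>t. \<bar>t\<bar> < e \<Longrightarrow> x + t *\<^sub>R w \<in> ineqs H"
proof -
  have "\<forall>\<^sub>F t in nhds 0. fst h \<bullet> (x + t *\<^sub>R w) \<le> snd h" if h: "h \<in> H" for h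
  proof (cases "h \<in> active H x")
    case True
    then show ?thesis using assms(3) by (simp add: active_def inner_add_right)
  next
    case False
    then have "fst h \<bullet> (x + 0 *\<^sub>R w) < snd h"
      using h assms(2) by (force simp: active_def ineqs_def)
    moreover have "((\<lambda>t. fst h \<bullet> (x + t *\<^sub>R w)) \<longlongrightarrow> fst h \<bullet> (x + 0 *\<^sub>R w)) (nhds 0)"
      by (intro tendsto_intros filterlim_ident)
    ultimately have "\<forall>\<^sub>F t in nhds 0. fst h \<bullet> (x + t *\<^sub>R w) < snd h"
      by (rule order_tendstoD(2)[rotated])
    then show ?thesis by eventually_elim simp
  qed
  then have "\<forall>\<^sub>F t in nhds 0. x + t *\<^sub>R w \<in> ineqs H"
    unfolding ineqs_def mem_Collect_eq using assms(1) by (simp add: eventually_ball_finite)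
  then show thesis
    using that unfolding eventually_nhds_metric dist_real_def by auto
qed

lemma quadratic_local_max:
  fixes L K :: real
  assumes "e > 0" "\<And>t. \<bar>t\<bar> < e \<Longrightarrow> t * L + t\<^sup>2 * K \<le> 0"
  shows "L = 0" "K \<le> 0"
proof -
  have "((\<lambda>t. t * L + t\<^sup>2 * K) has_real_derivative L) (at 0)"
    by (auto intro!: derivative_eq_intros)
  then show "L = 0"
    by (rule DERIV_local_max[OF _ assms(1)]) (use assms(2) in auto)
  then show "K \<le> 0"
    using assms(2)[of "e/2"] assms(1) by (simp add: mult_le_0_iff)
qed

text \<open>The ratio test of the simplex method: boundedness forces some constraint to grow along
  \<open>w\<close>, and the first one to become tight stops the ray. It is new because the active
  constraints do not change along \<open>w\<close>.\<close>

lemma exits_through_new_constraint: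
  assumes "finite H" "bounded (ineqs H)" "x \<in> ineqs H" "w \<noteq> 0"
    and "\<And>h. h \<in> active H x \<Longrightarrow> fst h \<bullet> w = 0"
  obtains t where "x + t *\<^sub>R w \<in> ineqs H" "active H x \<subset> active H (x + t *\<^sub>R w)"
proof -
  define H' where "H' = {h\<in>H. fst h \<bullet> w > 0}"
  have "H' \<noteq> {}"
  proof
    assume "H' = {}"
    then have le: "fst h \<bullet> w \<le> 0" if "h \<in> H" for h using that unfolding H'_def by (metis (mono_tags, lifting) Collect_empty_eq linorder_not_less)
    have ray: "x + t *\<^sub>R w \<in> ineqs H" if "t \<ge> 0" for t
      unfolding ineqs_def
    proof (intro CollectI ballI)
      fix h assume "h \<in> H"
      then have "fst h \<bullet> x \<le> snd h" "t * (fst h \<bullet> w) \<le> 0"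
        using assms(3) le that by (auto simp: ineqs_def mult_nonneg_nonpos)
      then show "fst h \<bullet> (x + t *\<^sub>R w) \<le> snd h" by (simp add: inner_add_right)
    qed
    obtain B where B: "\<And>y. y \<in> ineqs H \<Longrightarrow> norm y \<le> B" "B > 0"
      using assms(2) by (auto simp: bounded_pos)
    \<comment> \<open>Long enough for \<open>x + t *\<^sub>R w\<close> to leave the ball of radius
      \<open>B\<close>.\<close>
    define t where "t = (B + norm x + 1) / norm w"
    have t: "t \<ge> 0" "t * norm w = B + norm x + 1"
      using assms(4) B(2) by (auto simp: t_def)
    have "norm (t *\<^sub>R w) \<le> norm (x + t *\<^sub>R w) + norm x"
      using norm_triangle_ineq4[of "x + t *\<^sub>R w" x] by simp
    then show False using B(1)[OF ray[OF t(1)]] t by simp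
  qed
  \<comment> \<open>The parameter at which the ray meets the hyperplane of \<open>h\<close>.\<close>
  define \<tau> where "\<tau> h = (snd h - fst h \<bullet> x) / (fst h \<bullet> w)" for h
  have fin: "finite (\<tau> ` H')" and ne: "\<tau> ` H' \<noteq> {}"
    using assms(1) \<open>H' \<noteq> {}\<close> by (auto simp: H'_def)
  define t where "t = Min (\<tau> ` H')"
  obtain h0 where h0: "h0 \<in> H'" "t = \<tau> h0"
    using Min_in[OF fin ne] by (auto simp: t_def)
  have t_le: "t \<le> \<tau> h" if "h \<in> H'" for h
    using fin that by (simp add: t_def)
  have "t \<ge> 0"
    using h0 assms(3) by (auto simp: \<tau>_def H'_def ineqs_def)
  have "fst h \<bullet> (x + t *\<^sub>R w) \<le> snd h" if h: "h \<in> H" for h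
  proof (cases "h \<in> H'")
    case True
    then have "t * (fst h \<bullet> w) \<le> snd h - fst h \<bullet> x"
      using t_le[OF True] by (simp add: \<tau>_def H'_def pos_le_divide_eq)
    then show ?thesis by (simp add: inner_add_right)
  next
    case False
    then have "t * (fst h \<bullet> w) \<le> 0"
      using h \<open>t \<ge> 0\<close> by (simp add: H'_def mult_nonneg_nonpos)
    moreover have "fst h \<bullet> x \<le> snd h" using assms(3) h by (simp add: ineqs_def)
    ultimately show ?thesis by (simp add: inner_add_right)
  qed
  then have "x + t *\<^sub>R w \<in> ineqs H" by (simp add: ineqs_def)
  moreover have "active H x \<subseteq> active H (x + t *\<^sub>R w)"
    using assms(5) by (auto simp: active_def inner_add_right)
  moreover have "h0 \<in> active H (x + t *\<^sub>R w)"
    using h0 by (simp add: active_def H'_def \<tau>_def inner_add_right)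
  moreover have "h0 \<notin> active H x"
    using h0(1) assms(5)[of h0] unfolding H'_def by force
  ultimately show thesis using that by blast
qed

text \<open>Take a maximizer with as many active constraints as possible. If the form degenerated along a
  direction \<open>w\<close> tangent to its face, the function would be constant along \<open>w\<close>, and one could move
  until a further constraint becomes active.\<close>

lemma nondegenerate_maximizer:
  fixes H :: "((real ^ 'r) \<times> real) set"
  assumes "finite H" "bounded (ineqs H)" "ineqs H \<noteq> {}"
  obtains x where "x \<in> ineqs H" "\<And>y. y \<in> ineqs H \<Longrightarrow> quad c b A y \<le> quad c b A x"
    "\<And>w. \<lbrakk>w \<noteq> 0; \<And>h. h \<in> active H x \<Longrightarrow> fst h \<bullet> w = 0\<rbrakk> \<Longrightarrow>
      w \<bullet> (b + (A + transpose A) *v x) = 0 \<and> w \<bullet> (A *v w) < 0"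
proof -
  define X where "X x \<longleftrightarrow> x \<in> ineqs H \<and> (\<forall>y\<in>ineqs H. quad c b A y \<le> quad c b A x)" for x
  have "compact (ineqs H)" using assms(2) closed_ineqs by (rule compact_eq_bounded_closed[THEN iffD2, OF conjI])
  then obtain x1 where "X x1"
    using continuous_attains_sup[OF _ assms(3) continuous_on_quad] unfolding X_def by blast
  moreover have "card (active H y) < Suc (card H)" for y
    using assms(1) by (auto simp: active_def less_Suc_eq_le intro: card_mono)
  ultimately obtain x where x: "X x" "\<And>y. X y \<Longrightarrow> card (active H y) \<le> card (active H x)"
    using ex_has_greatest_nat[of X x1 "\<lambda>y. card (active H y)"] by blast
  have xH: "x \<in> ineqs H" and max: "\<And>y. y \<in> ineqs H \<Longrightarrow> quad c b A y \<le> quad c b A x"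
    using x(1) by (auto simp: X_def)
  show thesis
  proof (rule that[OF xH max])
    fix w assume w: "w \<noteq> 0" "\<And>h. h \<in> active H x \<Longrightarrow> fst h \<bullet> w = 0"
    obtain e where e: "e > 0" "\<And>t. \<bar>t\<bar> < e \<Longrightarrow> x + t *\<^sub>R w \<in> ineqs H"
      using feasible_both_ways[OF assms(1) xH w(2)] by blast
    have "t * (w \<bullet> (b + (A + transpose A) *v x)) + t\<^sup>2 * (w \<bullet> (A *v w)) \<le> 0" if "\<bar>t\<bar> < e" for t
      using max[OF e(2)[OF that]] by (simp only: quad_add_scale)
    \<comment> \<open>Both signs of \<open>t\<close> are feasible, so the linear coefficient
      vanishes and the quadratic one is not positive.\<close>
    note LK = quadratic_local_max[OF e(1) this]
    have "w \<bullet> (A *v w) \<noteq> 0"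
    proof
      assume K: "w \<bullet> (A *v w) = 0"
      obtain t where t: "x + t *\<^sub>R w \<in> ineqs H" "active H x \<subset> active H (x + t *\<^sub>R w)"
        using exits_through_new_constraint[OF assms(1,2) xH w] by blast
      have "quad c b A (x + t *\<^sub>R w) = quad c b A x"
        by (simp only: quad_add_scale LK(1) K)
      then have "X (x + t *\<^sub>R w)" using t(1) max by (simp add: X_def)
      moreover have "finite (active H (x + t *\<^sub>R w))" using assms(1) by (simp add: active_def)
      ultimately show False using x(2) psubset_card_mono[OF _ t(2)] by (metis not_less)
    qed
    then show "w \<bullet> (b + (A + transpose A) *v x) = 0 \<and> w \<bullet> (A *v w) < 0"
      using LK by linarith
  qed
qed

section \<open>Critical systems on faces\<close>

lemma orthogonal_projection_matrix:
  fixes W :: "(real ^ 'r) set"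
  assumes "subspace W"
  obtains E :: "real ^ 'r ^ 'r" where "\<And>v. E *v v \<in> W" "\<And>v. v \<in> W \<Longrightarrow> E *v v = v"
    "\<And>u v. u \<bullet> (E *v v) = (E *v u) \<bullet> v"
proof -
  obtain B where B: "B \<subseteq> W" "pairwise orthogonal B" "\<And>x. x \<in> B \<Longrightarrow> norm x = 1"
    "independent B" "span B = W"
    using orthonormal_basis_subspace[OF assms] by metis
  have fin: "finite B" using B(4) by (rule independent_imp_finite)
  define f where "f v = (\<Sum>b\<in>B. (b \<bullet> v) *\<^sub>R b)" for v
  have lin: "linear f"
    unfolding f_def
    by (rule linearI) (simp_all add: inner_add_right scaleR_left_distrib sum.distrib scaleR_sum_right)
  have E: "matrix f *v v = f v" for v using lin by (simp add: matrix_works linear_matrix_vector_mul_eq)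
  show thesis
  proof (rule that[of "matrix f"]; unfold E)
    show "f v \<in> W" for v
      unfolding f_def B(5)[symmetric] by (intro span_sum span_scale span_base)
    show "f v = v" if "v \<in> W" for v
    proof -
      have "f b = b" if b: "b \<in> B" for b
      proof -
        have "f b = (\<Sum>a\<in>B. if a = b then b else 0)"
          unfolding f_def using B(2,3) b
          by (intro sum.cong refl) (auto simp: pairwise_def orthogonal_def dot_square_norm)
        then show ?thesis using fin b by simp
      qed
      then show ?thesis
        using linear_eq_on[OF lin linear_id, of v B] that B(5) by simp
    qed
    show "u \<bullet> f v = f u \<bullet> v" for u v
      unfolding f_def by (simp add: inner_sum_left inner_sum_right inner_commute mult.commute)
  qed
qed

text \<open>With \<open>E\<close> the orthogonal projection onto the direction space of a face through \<open>x0\<close>, the square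
  system \<open>kkt_matrix E A *v (x - x0) = kkt_rhs E x0 b A\<close> says that \<open>x\<close> lies in the affine hull of the face
  and that the gradient of \<open>quad c b A\<close> at \<open>x\<close> is orthogonal to it.\<close>

definition kkt_matrix :: "real ^ 'r ^ 'r \<Rightarrow> real ^ 'r ^ 'r \<Rightarrow> real ^ 'r ^ 'r" where
  "kkt_matrix E A = E ** (A + transpose A) ** E + (mat 1 - E)"

definition kkt_rhs :: "real ^ 'r ^ 'r \<Rightarrow> real ^ 'r \<Rightarrow> real ^ 'r \<Rightarrow> real ^ 'r ^ 'r \<Rightarrow> real ^ 'r" where
  "kkt_rhs E x0 b A = - (E *v (b + (A + transpose A) *v x0))"

text \<open>One system for each set \<open>J\<close> of constraints made tight. The list is chosen
  before \<open>c\<close>, \<open>b\<close> and \<open>A\<close>, so it serves all parameters at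
  once; the matrix has the full size for every face, so that Cramer's rule applies
  uniformly.\<close>

lemma finite_kkt_systems:
  fixes H :: "((real ^ 'r) \<times> real) set"
  assumes "finite H" "bounded (ineqs H)" "ineqs H \<noteq> {}"
  obtains \<K> :: "((real ^ 'r) \<times> (real ^ 'r ^ 'r)) set" where "finite \<K>"
    "\<And>c b A. \<exists>x0 E x. (x0, E) \<in> \<K> \<and> det (kkt_matrix E A) \<noteq> 0 \<and> x \<in> ineqs H \<and>
      kkt_matrix E A *v (x - x0) = kkt_rhs E x0 b A \<and> (\<forall>y\<in>ineqs H. quad c b A y \<le> quad c b A x)"
proof -
  define W where "W J = {w. \<forall>h\<in>J. fst h \<bullet> w = 0}" for J :: "((real ^ 'r) \<times> real) set"
  have "subspace (W J)" for J
    by (auto simp: W_def subspace_def inner_add_right)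
  then have "\<exists>E. (\<forall>v. E *v v \<in> W J) \<and> (\<forall>v\<in>W J. E *v v = v) \<and>
      (\<forall>u v. u \<bullet> (E *v v) = (E *v u) \<bullet> v)" for J
    by (rule orthogonal_projection_matrix) blast
  then obtain E where E: "\<And>J v. E J *v v \<in> W J" "\<And>J v. v \<in> W J \<Longrightarrow> E J *v v = v"
    "\<And>J u v. u \<bullet> (E J *v v) = (E J *v u) \<bullet> v" by metis
  \<comment> \<open>A base point of the affine space where all of \<open>J\<close> is tight,
    arbitrary if that space is empty.\<close>
  define x0 where "x0 J = (SOME x. \<forall>h\<in>J. fst h \<bullet> x = snd h)" for J :: "((real ^ 'r) \<times> real) set"
  show thesis
  proof (rule that[of "(\<lambda>J. (x0 J, E J)) ` Pow H"])
    show "finite ((\<lambda>J. (x0 J, E J)) ` Pow H)" using assms(1) by simp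
    fix c and b :: "real ^ 'r" and A :: "real ^ 'r ^ 'r"
    let ?S = "A + transpose A"
    obtain x where x: "x \<in> ineqs H" "\<And>y. y \<in> ineqs H \<Longrightarrow> quad c b A y \<le> quad c b A x"
      and crit: "\<And>w. \<lbrakk>w \<noteq> 0; \<And>h. h \<in> active H x \<Longrightarrow> fst h \<bullet> w = 0\<rbrakk> \<Longrightarrow>
        w \<bullet> (b + ?S *v x) = 0 \<and> w \<bullet> (A *v w) < 0"
      using nondegenerate_maximizer[OF assms] by blast
    define J where "J = active H x"
    have "\<forall>h\<in>J. fst h \<bullet> x0 J = snd h"
      unfolding x0_def by (rule someI[of _ x]) (auto simp: J_def active_def)
    then have xW: "x - x0 J \<in> W J"
      by (auto simp: W_def J_def active_def inner_diff_right)
    have M: "kkt_matrix (E J) A *v v = E J *v (?S *v (E J *v v)) + (v - E J *v v)" for v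
      by (simp add: kkt_matrix_def matrix_vector_mult_add_rdistrib matrix_vector_mult_diff_rdistrib
          matrix_vector_mul_assoc matrix_mul_assoc)
    have "E J *v (b + ?S *v x) = 0"
    proof -
      \<comment> \<open>\<open>?u\<close> is the projection of the gradient to the directions of the
        face; testing criticality along \<open>?u\<close> itself gives
        \<open>?u \<bullet> ?u = 0\<close>.\<close>
      let ?u = "E J *v (b + ?S *v x)"
      have "?u \<bullet> ?u = (E J *v ?u) \<bullet> (b + ?S *v x)" by (rule E(3))
      also have "E J *v ?u = ?u" using E(1,2) by blast
      also have "?u \<bullet> (b + ?S *v x) = 0"
        using crit[of ?u] E(1)[of J] by (cases "?u = 0") (auto simp: W_def J_def)
      finally show ?thesis by simp
    qed
    then have "kkt_matrix (E J) A *v (x - x0 J) = kkt_rhs (E J) (x0 J) b A"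
      using E(2)[OF xW] unfolding M kkt_rhs_def
      by (simp add: matrix_vector_mult_diff_distrib matrix_vector_right_distrib) (simp add: algebra_simps eq_neg_iff_add_eq_0)
    moreover have "det (kkt_matrix (E J) A) \<noteq> 0"
    proof -
      have "v = 0" if v: "kkt_matrix (E J) A *v v = 0" for v
      proof (rule ccontr)
        assume "v \<noteq> 0"
        \<comment> \<open>The kernel equation exhibits \<open>v\<close> in the range of the
          projection, so \<open>v\<close> is tangent to the face; there it would be a null direction
          of the form.\<close>
        have "v = E J *v (v - ?S *v (E J *v v))"
          using v unfolding M by (simp add: matrix_vector_mult_diff_distrib algebra_simps)
        then have vW: "v \<in> W J" using E(1) by metis
        then have "E J *v (?S *v v) = 0" using v E(2) unfolding M by simp
        then have "v \<bullet> (?S *v v) = 0" using E(2)[OF vW] E(3)[of v J "?S *v v"] by simp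
        then have "v \<bullet> (A *v v) = 0"
          using inner_transpose_mult[of v A v]
          by (simp add: matrix_vector_mult_add_rdistrib inner_add_right)
        then show False using crit[OF \<open>v \<noteq> 0\<close>] vW by (simp add: W_def J_def)
      qed
      then show ?thesis
        using matrix_left_invertible_ker[of "kkt_matrix (E J) A"] invertible_det_nz invertible_left_inverse by blast
    qed
    moreover have "(x0 J, E J) \<in> (\<lambda>J. (x0 J, E J)) ` Pow H"
      by (rule imageI) (auto simp: J_def active_def)
    ultimately show "\<exists>x0' E' x. (x0', E') \<in> (\<lambda>J. (x0 J, E J)) ` Pow H \<and> det (kkt_matrix E' A) \<noteq> 0 \<and>
      x \<in> ineqs H \<and> kkt_matrix E' A *v (x - x0') = kkt_rhs E' x0' b A \<and>
      (\<forall>y\<in>ineqs H. quad c b A y \<le> quad c b A x)"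
      using x by (intro exI[of _ "x0 J"] exI[of _ "E J"] exI[of _ x]) simp
  qed
qed

section \<open>Dependence of the maxima on parameters\<close>

lemma polynomial_function_comp:
  "polynomial_function g \<Longrightarrow> polynomial_function \<phi> \<Longrightarrow> polynomial_function (\<lambda>x. g (\<phi> x))"
  using polynomial_function_compose unfolding o_def by blast

lemma polynomial_function_vec:
  fixes f :: "'a::real_normed_vector \<Rightarrow> real ^ 'n"
  assumes "\<And>i. polynomial_function (\<lambda>x. f x $ i)"
  shows "polynomial_function f"
  unfolding polynomial_function_iff_Basis_inner Basis_vec_def
  using assms by (auto simp: inner_axis real_polynomial_function_eq)

lemma polynomial_function_matrix_vector_mult:
  fixes A :: "'a::real_normed_vector \<Rightarrow> real ^ 'n ^ 'm"
  assumes "\<And>i j. polynomial_function (\<lambda>z. A z $ i $ j)" "polynomial_function x"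
  shows "polynomial_function (\<lambda>z. A z *v x z)"
  by (rule polynomial_function_vec)
    (auto simp: matrix_vector_mult_def
      intro!: polynomial_function_sum polynomial_function_times polynomial_function_nth assms)

lemma polynomial_function_matrix_matrix_mult:
  fixes A :: "'a::real_normed_vector \<Rightarrow> real ^ 'n ^ 'm" and B :: "'a \<Rightarrow> real ^ 'l ^ 'n"
  assumes "\<And>i j. polynomial_function (\<lambda>z. A z $ i $ j)" "\<And>i j. polynomial_function (\<lambda>z. B z $ i $ j)"
  shows "polynomial_function (\<lambda>z. (A z ** B z) $ i $ j)"
  by (auto simp: matrix_matrix_mult_def
      intro!: polynomial_function_sum polynomial_function_times assms)

lemma polynomial_function_det:
  fixes A :: "'a::real_normed_vector \<Rightarrow> real ^ 'n ^ 'n"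
  assumes "\<And>i j. polynomial_function (\<lambda>z. A z $ i $ j)"
  shows "polynomial_function (\<lambda>z. det (A z))"
  using assms unfolding det_def real_polynomial_function_eq[symmetric]
  by (intro real_polynomial_function_sum real_polynomial_function_prod real_polynomial_function_intros)
    (auto intro: finite_permutations)

lemma polynomial_function_quad:
  assumes "polynomial_function c" "polynomial_function b"
    "\<And>i j. polynomial_function (\<lambda>z. A z $ i $ j)" "polynomial_function x"
  shows "polynomial_function (\<lambda>z. quad (c z) (b z) (A z) (x z))"
  unfolding quad_def
  by (intro polynomial_function_intros polynomial_function_matrix_vector_mult assms)

lemma polynomial_function_kkt_matrix:
  assumes "\<And>i j. polynomial_function (\<lambda>z. A z $ i $ j)"
  shows "polynomial_function (\<lambda>z. kkt_matrix E (A z) $ i $ j)"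
proof -
  have "polynomial_function (\<lambda>z. (E ** (A z + transpose (A z)) ** E) $ i $ j)"
    by (intro polynomial_function_matrix_matrix_mult polynomial_function_const)
      (auto simp: transpose_def intro!: polynomial_function_add assms)
  then show ?thesis
    unfolding kkt_matrix_def by (auto intro: polynomial_function_add)
qed

lemma polynomial_function_kkt_rhs:
  assumes "polynomial_function b" "\<And>i j. polynomial_function (\<lambda>z. A z $ i $ j)"
  shows "polynomial_function (\<lambda>z. kkt_rhs E x0 (b z) (A z))"
  unfolding kkt_rhs_def
  by (intro polynomial_function_minus polynomial_function_matrix_vector_mult
      polynomial_function_const polynomial_function_add assms(1))
    (auto simp: transpose_def intro!: polynomial_function_add assms(2))

text \<open>The numerators in Cramer's rule.\<close>

definition kkt_num :: "real ^ 'r ^ 'r \<Rightarrow> real ^ 'r \<Rightarrow> real ^ 'r \<Rightarrow> real ^ 'r ^ 'r \<Rightarrow> real ^ 'r" where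
  "kkt_num E x0 b A = (\<chi> k. det (\<chi> i j. if j = k then kkt_rhs E x0 b A $ i else kkt_matrix E A $ i $ j))"

lemma polynomial_function_kkt_num:
  assumes "polynomial_function b" "\<And>i j. polynomial_function (\<lambda>z. A z $ i $ j)"
  shows "polynomial_function (\<lambda>z. kkt_num E x0 (b z) (A z))"
proof (rule polynomial_function_vec)
  fix k
  have "polynomial_function (\<lambda>z. (\<chi> i j. if j = k then kkt_rhs E x0 (b z) (A z) $ i
      else kkt_matrix E (A z) $ i $ j) $ i $ j)" for i j
    by (cases "j = k") (auto intro!: polynomial_function_nth polynomial_function_kkt_rhs
        polynomial_function_kkt_matrix assms)
  then show "polynomial_function (\<lambda>z. kkt_num E x0 (b z) (A z) $ k)"
    unfolding kkt_num_def by (simp add: polynomial_function_det)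
qed

lemma kkt_solution:
  assumes "det (kkt_matrix E A) \<noteq> 0"
  shows "kkt_matrix E A *v (x - x0) = kkt_rhs E x0 b A \<longleftrightarrow>
    x = x0 + (1 / det (kkt_matrix E A)) *\<^sub>R kkt_num E x0 b A"
proof -
  have "(\<chi> k. det (\<chi> i j. if j = k then kkt_rhs E x0 b A $ i else kkt_matrix E A $ i $ j) /
      det (kkt_matrix E A)) = (1 / det (kkt_matrix E A)) *\<^sub>R kkt_num E x0 b A"
    by (simp add: kkt_num_def vec_eq_iff)
  then show ?thesis
    unfolding cramer[OF assms] by (auto simp: algebra_simps)
qed

text \<open>Clears the denominator \<open>D\<close> by homogeneity, so that numerator and
  denominator are polynomial in \<open>m\<close> whenever \<open>D\<close> and \<open>v\<close>
  are.\<close>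

lemma quad_rational_point:
  assumes "D \<noteq> 0"
  shows "quad c b A (x0 + (1 / D) *\<^sub>R v) = quad (D\<^sup>2 * c) (D *\<^sub>R b) A (D *\<^sub>R x0 + v) / D\<^sup>2"
proof -
  define y where "y = x0 + (1 / D) *\<^sub>R v"
  have "D *\<^sub>R x0 + v = D *\<^sub>R y" using assms by (simp add: y_def scaleR_right_distrib)
  then have "quad (D\<^sup>2 * c) (D *\<^sub>R b) A (D *\<^sub>R x0 + v) = D\<^sup>2 * quad c b A y"
    by (simp add: quad_def matrix_vector_mult_scaleR power2_eq_square algebra_simps)
  then show ?thesis using assms by (simp add: y_def)
qed

text \<open>For fixed \<open>m\<close> only the right-hand side depends on \<open>t\<close>, and
  applying the constant inverse matrix preserves affine dependence.\<close>

lemma kkt_solution_affine: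
  assumes "det (kkt_matrix E A) \<noteq> 0"
  obtains y0 y1 where "\<And>t x. kkt_matrix E A *v (x - x0) = kkt_rhs E x0 (b + t *\<^sub>R e) A \<longleftrightarrow>
    x = y0 + t *\<^sub>R y1"
proof -
  obtain B where B: "B ** kkt_matrix E A = mat 1" "kkt_matrix E A ** B = mat 1"
    using assms invertible_det_nz[of "kkt_matrix E A"] unfolding invertible_def by blast
  have inv: "kkt_matrix E A *v v = w \<longleftrightarrow> v = B *v w" for v w
    using B by (metis matrix_vector_mul_assoc matrix_vector_mul_lid)
  show thesis
  proof (rule that)
    show "kkt_matrix E A *v (x - x0) = kkt_rhs E x0 (b + t *\<^sub>R e) A \<longleftrightarrow>
      x = (x0 + B *v kkt_rhs E x0 b A) + t *\<^sub>R (- (B *v (E *v e)))" for t x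
    proof -
      have "kkt_rhs E x0 (b + t *\<^sub>R e) A = kkt_rhs E x0 b A - t *\<^sub>R (E *v e)"
        by (simp add: kkt_rhs_def matrix_vector_right_distrib matrix_vector_mult_scaleR algebra_simps)
      then have e: "B *v kkt_rhs E x0 (b + t *\<^sub>R e) A = B *v kkt_rhs E x0 b A - t *\<^sub>R (B *v (E *v e))"
        by (simp add: matrix_vector_mult_diff_distrib matrix_vector_mult_scaleR)
      show ?thesis unfolding inv e by (auto simp: algebra_simps)
    qed
  qed
qed

text \<open>No power of \<open>t\<close> beyond the square occurs: the constant term is quadratic in
  \<open>t\<close>, the linear form is affine, and the quadratic form does not change. The value at
  \<open>t = 0\<close> is kept explicit because it becomes the coefficient of
  \<open>n\<^sup>2\<close>.\<close>

lemma quad_along_line: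
  obtains c1 c2 where "\<And>t. quad (a + t * d + t\<^sup>2 * f) (b + t *\<^sub>R e) A (y0 + t *\<^sub>R y1) =
    quad a b A y0 + t * c1 + t\<^sup>2 * c2"
proof (rule that[of "d + e \<bullet> y0 + b \<bullet> y1 + y0 \<bullet> (A *v y1) + y1 \<bullet> (A *v y0)"
      "f + e \<bullet> y1 + y1 \<bullet> (A *v y1)"])
  show "quad (a + t * d + t\<^sup>2 * f) (b + t *\<^sub>R e) A (y0 + t *\<^sub>R y1) =
      quad a b A y0 + t * (d + e \<bullet> y0 + b \<bullet> y1 + y0 \<bullet> (A *v y1) + y1 \<bullet> (A *v y0)) +
      t\<^sup>2 * (f + e \<bullet> y1 + y1 \<bullet> (A *v y1))" for t
    by (simp add: quad_def matrix_vector_right_distrib matrix_vector_mult_scaleR inner_add_left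
        inner_add_right power2_eq_square algebra_simps)
qed

section \<open>Eventual positivity and eventual feasibility\<close>

lemma eventually_poly_pos:
  fixes p :: "real poly"
  assumes "lead_coeff p > 0"
  shows "\<forall>\<^sub>F n in sequentially. poly p (real n) > 0"
proof -
  obtain r where "\<And>x. x \<ge> r \<Longrightarrow> poly p x \<ge> lead_coeff p"
    using poly_pinfty_gt_lc[OF assms] by blast
  then have "poly p x > 0" if "x \<ge> r" for x using that assms by force
  moreover have "\<forall>\<^sub>F n in sequentially. real n \<ge> r"
    by (rule eventually_sequentiallyI[of "nat \<lceil>r\<rceil>"]) linarith
  ultimately show ?thesis by (auto elim: eventually_mono)
qed

text \<open>The sign of a polynomial is eventually constant, so being positive infinitely often
  already decides the leading coefficient.\<close>

lemma lead_coeff_pos_if_frequently: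
  fixes p :: "real poly"
  assumes "\<exists>\<^sub>F n in sequentially. poly p (real n) > 0"
  shows "lead_coeff p > 0"
proof (rule ccontr)
  assume neg: "\<not> lead_coeff p > 0"
  have "p \<noteq> 0"
    using frequently_ex[OF assms] by auto
  then have "lead_coeff (- p) > 0" using neg by (simp add: order_less_le not_less)
  then have "\<forall>\<^sub>F n in sequentially. poly (- p) (real n) > 0" by (rule eventually_poly_pos)
  then have "\<forall>\<^sub>F n in sequentially. \<not> poly p (real n) > 0" by eventually_elim simp
  then show False using assms by (simp add: frequently_def)
qed

lemma coeff2_nonneg_if_eventually:
  fixes p :: "real poly"
  assumes "degree p \<le> 2" "\<forall>\<^sub>F n in sequentially. poly p (real n) \<ge> 0"
  shows "coeff p 2 \<ge> 0"
proof (rule ccontr)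
  assume neg: "\<not> coeff p 2 \<ge> 0"
  then have "degree p = 2" using assms(1) le_degree[of p 2] by (intro antisym) auto
  then have "lead_coeff (- p) > 0" using neg by simp
  then have "\<forall>\<^sub>F n in sequentially. poly (- p) (real n) > 0" by (rule eventually_poly_pos)
  with assms(2) have "\<forall>\<^sub>F n in sequentially. False" by eventually_elim simp
  then show False by simp
qed

lemma convex_ineqs: "convex (ineqs H)"
proof -
  have "ineqs H = (\<Inter>h\<in>H. {x. fst h \<bullet> x \<le> snd h})" by (auto simp: ineqs_def)
  then show ?thesis by (auto intro: convex_INT convex_halfspace_le)
qed

text \<open>Along the line the admissible \<open>t\<close> form an interval. It contains
  \<open>1 / n0\<close> and reciprocals \<open>1 / n1\<close> with \<open>n1\<close> as large as
  desired, hence every \<open>1 / n\<close> with \<open>n \<ge> n0\<close>.\<close>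

lemma convex_eventually_if_frequently:
  assumes "convex S" "\<exists>\<^sub>F n in sequentially. y0 + (1 / real n) *\<^sub>R y1 \<in> S"
  shows "\<forall>\<^sub>F n in sequentially. y0 + (1 / real n) *\<^sub>R y1 \<in> S"
proof -
  let ?y = "\<lambda>t. y0 + t *\<^sub>R y1"
  have freq: "\<exists>n\<ge>k. ?y (1 / real n) \<in> S" for k
    using assms(2) unfolding frequently_sequentially by blast
  obtain n0 where n0: "n0 \<ge> 1" "?y (1 / real n0) \<in> S" using freq by blast
  have "?y (1 / real n) \<in> S" if "n \<ge> n0" for n
  proof -
    obtain n1 where n1: "n1 \<ge> n" "?y (1 / real n1) \<in> S" using freq by blast
    have t: "1 / real n1 \<le> 1 / real n" "1 / real n \<le> 1 / real n0"
      using n0(1) n1(1) that by (auto intro!: divide_left_mono)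
    have "linear (\<lambda>t. t *\<^sub>R y1)" by (rule linearI) (simp_all add: scaleR_left_distrib)
    then have "convex ((\<lambda>t. t *\<^sub>R y1) -` ((\<lambda>x. - y0 + x) ` S))"
      by (intro convex_linear_vimage convex_translation assms(1))
    moreover have "(\<lambda>t. t *\<^sub>R y1) -` ((\<lambda>x. - y0 + x) ` S) = {t. ?y t \<in> S}"
      by (force simp: image_iff)
    ultimately have "is_interval {t. ?y t \<in> S}" by (simp add: is_interval_convex_1)
    then have "1 / real n \<in> {t. ?y t \<in> S}"
      by (rule mem_is_interval_1_I[OF _ _ _ t]) (use n0(2) n1(2) in auto)
    then show ?thesis by simp
  qed
  then show ?thesis by (rule eventually_sequentiallyI)
qed

section \<open>Polyhedral pieces and rational sectors\<close>

lemma polyhedron_inequalities: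
  fixes S :: "'a::euclidean_space set"
  assumes "polyhedron S"
  obtains F :: "('a \<times> real) set" where "finite F" "\<And>x. x \<in> S \<longleftrightarrow> (\<forall>h\<in>F. fst h \<bullet> x \<le> snd h)"
proof -
  obtain F where F: "finite F" "S = \<Inter>F" "\<forall>h\<in>F. \<exists>a b. a \<noteq> 0 \<and> h = {x. a \<bullet> x \<le> b}"
    using assms unfolding polyhedron_def by blast
  have "\<exists>k. \<forall>x. x \<in> h \<longleftrightarrow> fst k \<bullet> x \<le> snd k" if hF: "h \<in> F" for h
  proof -
    obtain a b where h: "h = {x. a \<bullet> x \<le> b}" using bspec[OF F(3) hF] by (elim exE conjE)
    have "\<forall>x. x \<in> h \<longleftrightarrow> fst (a, b) \<bullet> x \<le> snd (a, b)" unfolding h by simp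
    then show ?thesis ..
  qed
  then obtain k where k: "\<And>h x. h \<in> F \<Longrightarrow> x \<in> h \<longleftrightarrow> fst (k h) \<bullet> x \<le> snd (k h)" by metis
  show thesis
    by (rule that[of "k ` F"]) (use F(1) k in \<open>auto simp: F(2)\<close>)
qed

text \<open>Applied to cones, whose slice at height 1 determines them at all positive heights; this
  removes \<open>n\<close> from the description of the pieces.\<close>

lemma polyhedron_slice_ineqs:
  fixes C :: "(real \<times> (real ^ 'r)) set"
  assumes "polyhedron C"
  obtains H where "finite H" "{x. (1, x) \<in> C} = ineqs H"
proof -
  obtain F where F: "finite F" "\<And>z. z \<in> C \<longleftrightarrow> (\<forall>h\<in>F. fst h \<bullet> z \<le> snd h)"
    using polyhedron_inequalities[OF assms] by blast
  have "fst h \<bullet> (1, x) \<le> snd h \<longleftrightarrow> snd (fst h) \<bullet> x \<le> snd h - fst (fst h)"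
    for h :: "(real \<times> (real ^ 'r)) \<times> real" and x
    by (cases h; cases "fst h") (auto simp: algebra_simps)
  then have "{x. (1, x) \<in> C} = ineqs ((\<lambda>h. (snd (fst h), snd h - fst (fst h))) ` F)"
    unfolding F(2) ineqs_def by simp
  then show thesis using that F(1) by blast
qed

lemma sign_definable_if_semialgebraic:
  assumes "semialgebraic S"
  shows "sign_definable S"
proof -
  obtain \<B> where \<B>: "finite \<B>" "\<forall>B\<in>\<B>. basic_semialgebraic B" "S = \<Union>\<B>"
    using assms unfolding semialgebraic_def by blast
  have "sign_definable B" if B: "B \<in> \<B>" for B
  proof -
    obtain E I where EI: "finite E" "finite I" "\<forall>p\<in>E \<union> I. real_polynomial_function p"
      "B = {x. (\<forall>p\<in>E. p x = 0) \<and> (\<forall>p\<in>I. p x > 0)}"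
      using bspec[OF \<B>(2) B] unfolding basic_semialgebraic_def by (elim exE conjE)
    show ?thesis
      unfolding EI(4) using EI(1-3)
      by (auto simp: real_polynomial_function_eq intro!: sign_definable_conj sign_definable_finite_ball
          sign_definable_eq sign_definable_less polynomial_function_const)
  qed
  then have "sign_definable {x. \<exists>B\<in>\<B>. x \<in> B}"
    using \<B>(1) by (intro sign_definable_finite_bex) auto
  moreover have "{x. \<exists>B\<in>\<B>. x \<in> B} = S" using \<B>(3) by auto
  ultimately show ?thesis by simp
qed

lemma piecewise_rational_interior_corner_locus:
  assumes "piecewise_rational f"
  shows "interior (corner_locus f) = {}"
proof (rule ccontr)
  assume ne: "interior (corner_locus f) \<noteq> {}"
  obtain \<S> where \<S>: "finite \<S>" "\<Union>\<S> = UNIV" "\<forall>S\<in>\<S>. semialgebraic S \<and>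
      (\<exists>p q. real_polynomial_function p \<and> real_polynomial_function q \<and>
        (\<forall>m\<in>S. q m \<noteq> 0 \<and> f m = p m / q m))"
    using assms unfolding piecewise_rational_def by (elim exE conjE)
  have "\<exists>F. finite F \<and> (\<forall>f\<in>F. real_polynomial_function f) \<and>
      (\<forall>x y. same_signs F x y \<longrightarrow> x \<in> S \<longrightarrow> y \<in> S)" if S: "S \<in> \<S>" for S
    using sign_definable_if_semialgebraic[OF conjunct1[OF bspec[OF \<S>(3) S]]]
    unfolding sign_definable_def .
  then obtain F where F: "\<And>S. S \<in> \<S> \<Longrightarrow> finite (F S)"
    "\<And>S f. S \<in> \<S> \<Longrightarrow> f \<in> F S \<Longrightarrow> real_polynomial_function f"
    "\<And>S x y. S \<in> \<S> \<Longrightarrow> same_signs (F S) x y \<Longrightarrow> x \<in> S \<Longrightarrow> y \<in> S"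
    by metis
  have "finite (\<Union>(F ` \<S>))" using \<S>(1) F(1) by auto
  moreover have "continuous_on UNIV g" if "g \<in> \<Union>(F ` \<S>)" for g
    using that F(2) by (auto intro: continuous_on_polymonial_function simp: real_polynomial_function_eq)
  ultimately obtain V where V: "open V" "V \<noteq> {}" "V \<subseteq> interior (corner_locus f)"
    "\<And>x y. \<lbrakk>x \<in> V; y \<in> V\<rbrakk> \<Longrightarrow> same_signs (\<Union>(F ` \<S>)) x y"
    using open_subset_same_signs[OF _ _ open_interior ne] by metis
  obtain x where x: "x \<in> V" using V(2) by blast
  obtain S where S: "S \<in> \<S>" "x \<in> S" using \<S>(2) by blast
  \<comment> \<open>All of \<open>V\<close> has the signs of \<open>x\<close>, so \<open>V\<close>
    lies in any sector that contains \<open>x\<close>.\<close>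
  have VS: "y \<in> S" if "y \<in> V" for y
    using F(3)[OF S(1) _ S(2)] V(4)[OF x that] S(1) by (auto simp: same_signs_def)
  obtain p q where pq: "real_polynomial_function p" "real_polynomial_function q"
    "\<And>m. m \<in> S \<Longrightarrow> q m \<noteq> 0 \<and> f m = p m / q m"
    using bspec[OF \<S>(3) S(1)] by (elim exE conjE) blast
  have "f differentiable (at y within V)" if y: "y \<in> V" for y
  proof (rule differentiable_transform_within)
    show "(\<lambda>m. p m / q m) differentiable (at y within V)"
      using pq VS[OF y] by (intro differentiable_divide differentiable_at_real_polynomial_function) auto
  qed (use VS pq(3) y in \<open>auto intro: zero_less_one\<close>)
  then have "f differentiable_on V" by (simp add: differentiable_on_def)
  then have "x \<notin> corner_locus f" using V(1) x unfolding corner_locus_def by blast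
  then show False using x V(3) interior_subset by blast
qed

section \<open>The Jones slope function\<close>

text \<open>In the application a piece is the slice at height 1 of a cone, cut with
  \<open>P\<close>. Along the ray through one of its points \<open>\<delta>\<close> is an explicit
  quadratic polynomial in \<open>n\<close> with leading coefficient
  \<open>quad (a i m) (b i m) (A i m) x\<close>.\<close>

locale quadratic_pieces =
  fixes P :: "(real ^ 'r) set" and \<delta> :: "real ^ 'r \<Rightarrow> real \<Rightarrow> real ^ 'r \<Rightarrow> real"
    and I :: "'i set" and H :: "'i \<Rightarrow> ((real ^ 'r) \<times> real) set"
    and a :: "'i \<Rightarrow> real ^ 'r \<Rightarrow> real" and b :: "'i \<Rightarrow> real ^ 'r \<Rightarrow> real ^ 'r"
    and A :: "'i \<Rightarrow> real ^ 'r \<Rightarrow> real ^ 'r ^ 'r"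
    and d :: "'i \<Rightarrow> real ^ 'r \<Rightarrow> real" and e :: "'i \<Rightarrow> real ^ 'r \<Rightarrow> real ^ 'r"
    and f :: "'i \<Rightarrow> real ^ 'r \<Rightarrow> real"
  assumes finite_I: "finite I" and I_nonempty: "I \<noteq> {}"
    and P_eq: "P = (\<Union>i\<in>I. ineqs (H i))"
    and finite_H: "i \<in> I \<Longrightarrow> finite (H i)"
    and bounded_H: "i \<in> I \<Longrightarrow> bounded (ineqs (H i))"
    and nonempty_H: "i \<in> I \<Longrightarrow> ineqs (H i) \<noteq> {}"
    and poly_a: "i \<in> I \<Longrightarrow> polynomial_function (a i)"
    and poly_b: "i \<in> I \<Longrightarrow> polynomial_function (b i)"
    and poly_A: "i \<in> I \<Longrightarrow> polynomial_function (\<lambda>m. A i m $ k $ l)"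
    and delta: "\<lbrakk>i \<in> I; x \<in> ineqs (H i); n > 0\<rbrakk> \<Longrightarrow> \<delta> m n (n *\<^sub>R x) =
      n\<^sup>2 * quad (a i m) (b i m) (A i m) x + n * (d i m + e i m \<bullet> x) + f i m"
begin

definition lead :: "'i \<Rightarrow> real ^ 'r \<Rightarrow> real ^ 'r \<Rightarrow> real" where
  "lead i m x = quad (a i m) (b i m) (A i m) x"

text \<open>\<open>\<delta> m n (n x) / n\<^sup>2\<close> in terms of \<open>t = 1 / n\<close>; at \<open>t = 0\<close> it is \<open>delta2\<close>.\<close>

definition scaled :: "'i \<Rightarrow> real ^ 'r \<Rightarrow> real \<Rightarrow> real ^ 'r \<Rightarrow> real" where
  "scaled i m t x = quad (a i m + t * d i m + t\<^sup>2 * f i m) (b i m + t *\<^sub>R e i m) (A i m) x"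

lemma scaled_0: "scaled i m 0 x = lead i m x"
  by (simp add: scaled_def lead_def)

lemma delta_scaled:
  assumes "i \<in> I" "x \<in> ineqs (H i)" "n > 0"
  shows "\<delta> m n (n *\<^sub>R x) = n\<^sup>2 * scaled i m (1 / n) x"
  unfolding delta[OF assms] using assms(3)
  by (simp add: scaled_def quad_def inner_add_left power2_eq_square field_simps)

text \<open>\<open>t = 1 / n\<close> describes the maximum at height \<open>n\<close> and
  \<open>t = 0\<close> the maximum of \<open>delta2\<close>, so one notion serves both
  problems.\<close>

definition optimal where
  "optimal i x0 E m t x \<longleftrightarrow> det (kkt_matrix E (A i m)) \<noteq> 0 \<and> x \<in> ineqs (H i) \<and>
     kkt_matrix E (A i m) *v (x - x0) = kkt_rhs E x0 (b i m + t *\<^sub>R e i m) (A i m) \<and>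
     (\<forall>j\<in>I. \<forall>y\<in>ineqs (H j). scaled j m t y \<le> scaled i m t x)"

text \<open>A maximizer over a finite union of pieces is a maximizer on one of them, so the systems
  of the single pieces suffice.\<close>

lemma candidates:
  obtains \<Phi> :: "('i \<times> (real ^ 'r) \<times> (real ^ 'r ^ 'r)) set" where "finite \<Phi>"
    "\<And>i x0 E. (i, x0, E) \<in> \<Phi> \<Longrightarrow> i \<in> I"
    "\<And>m t. \<exists>i x0 E x. (i, x0, E) \<in> \<Phi> \<and> optimal i x0 E m t x"
proof -
  have "\<exists>\<K> :: ((real ^ 'r) \<times> (real ^ 'r ^ 'r)) set. finite \<K> \<and> (\<forall>c b A. \<exists>x0 E x. (x0, E) \<in> \<K> \<and>
      det (kkt_matrix E A) \<noteq> 0 \<and> x \<in> ineqs (H i) \<and> kkt_matrix E A *v (x - x0) = kkt_rhs E x0 b A \<and>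
      (\<forall>y\<in>ineqs (H i). quad c b A y \<le> quad c b A x))" if i: "i \<in> I" for i
    by (rule finite_kkt_systems[OF finite_H[OF i] bounded_H[OF i] nonempty_H[OF i]]) blast
  then obtain \<K> :: "'i \<Rightarrow> ((real ^ 'r) \<times> (real ^ 'r ^ 'r)) set" where fin: "\<And>i. i \<in> I \<Longrightarrow> finite (\<K> i)"
    and \<K>: "\<And>i c b A. i \<in> I \<Longrightarrow> \<exists>x0 E x. (x0, E) \<in> \<K> i \<and>
      det (kkt_matrix E A) \<noteq> 0 \<and> x \<in> ineqs (H i) \<and> kkt_matrix E A *v (x - x0) = kkt_rhs E x0 b A \<and>
      (\<forall>y\<in>ineqs (H i). quad c b A y \<le> quad c b A x)"
    by metis
  show thesis
  proof (rule that[of "Sigma I \<K>"])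
    show "finite (Sigma I \<K>)" using finite_I fin by auto
    show "i \<in> I" if "(i, x0, E) \<in> Sigma I \<K>" for i x0 E using that by simp
    fix m :: "real ^ 'r" and t :: real
    have "\<exists>x0 E x. (x0, E) \<in> \<K> i \<and> det (kkt_matrix E (A i m)) \<noteq> 0 \<and> x \<in> ineqs (H i) \<and>
      kkt_matrix E (A i m) *v (x - x0) = kkt_rhs E x0 (b i m + t *\<^sub>R e i m) (A i m) \<and>
      (\<forall>y\<in>ineqs (H i). scaled i m t y \<le> scaled i m t x)" if i: "i \<in> I" for i
      unfolding scaled_def by (rule \<K>[OF i])
    then obtain x0 E x where sol: "\<And>i. i \<in> I \<Longrightarrow> (x0 i, E i) \<in> \<K> i \<and>
      det (kkt_matrix (E i) (A i m)) \<noteq> 0 \<and> x i \<in> ineqs (H i) \<and>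
      kkt_matrix (E i) (A i m) *v (x i - x0 i) = kkt_rhs (E i) (x0 i) (b i m + t *\<^sub>R e i m) (A i m) \<and>
      (\<forall>y\<in>ineqs (H i). scaled i m t y \<le> scaled i m t (x i))"
      by metis
    let ?V = "(\<lambda>i. scaled i m t (x i)) ` I"
    have "Max ?V \<in> ?V" using finite_I I_nonempty by (intro Max_in) auto
    then obtain i where i: "i \<in> I" "scaled i m t (x i) = Max ?V" by auto
    have le: "scaled j m t y \<le> scaled i m t (x i)" if "j \<in> I" "y \<in> ineqs (H j)" for j y
    proof -
      have "scaled j m t y \<le> scaled j m t (x j)" using sol that by blast
      also have "\<dots> \<le> Max ?V" using finite_I that(1) by simp
      finally show ?thesis using i(2) by simp
    qed
    show "\<exists>i x0 E x. (i, x0, E) \<in> Sigma I \<K> \<and> optimal i x0 E m t x"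
      unfolding optimal_def
      using sol[OF i(1)] i(1) le
      by (intro exI[of _ i] exI[of _ "x0 i"] exI[of _ "E i"] exI[of _ "x i"]) simp
  qed
qed

section \<open>The maximum for large \<open>n\<close>\<close>

lemma delta_hat_eq:
  fixes n :: nat
  assumes "n > 0" "i \<in> I" "x \<in> ineqs (H i)"
    and "\<And>j y. \<lbrakk>j \<in> I; y \<in> ineqs (H j)\<rbrakk> \<Longrightarrow> scaled j m (1 / real n) y \<le> scaled i m (1 / real n) x"
  shows "delta_hat P \<delta> m n = (real n)\<^sup>2 * scaled i m (1 / real n) x"
  unfolding delta_hat_def
proof (rule Greatest_equality)
  have "\<delta> m (real n) (real n *\<^sub>R x) = (real n)\<^sup>2 * scaled i m (1 / real n) x"
    using assms(1-3) by (intro delta_scaled) auto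
  then show "(real n)\<^sup>2 * scaled i m (1 / real n) x \<in> \<delta> m (real n) ` (*\<^sub>R) (real n) ` P"
    using assms(2,3) unfolding P_eq by (metis UN_I imageI)
next
  fix v assume "v \<in> \<delta> m (real n) ` (*\<^sub>R) (real n) ` P"
  then obtain j y where "j \<in> I" "y \<in> ineqs (H j)" "v = \<delta> m (real n) (real n *\<^sub>R y)"
    unfolding P_eq by auto
  then show "v \<le> (real n)\<^sup>2 * scaled i m (1 / real n) x"
    using assms(1,4) by (simp add: delta_scaled mult_left_mono)
qed

text \<open>\<open>GREATEST\<close> yields an upper bound only when the maximum is attained; an
  optimal candidate supplies this.\<close>

lemma delta_hat_ge:
  fixes n :: nat
  assumes "n > 0" "i \<in> I" "x \<in> ineqs (H i)"
  shows "(real n)\<^sup>2 * scaled i m (1 / real n) x \<le> delta_hat P \<delta> m n"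
proof -
  obtain \<Phi> :: "('i \<times> (real ^ 'r) \<times> (real ^ 'r ^ 'r)) set" where \<Phi>:
    "\<And>i x0 E. (i, x0, E) \<in> \<Phi> \<Longrightarrow> i \<in> I"
    "\<And>m t. \<exists>i x0 E x. (i, x0, E) \<in> \<Phi> \<and> optimal i x0 E m t x"
    by (rule candidates) blast
  obtain k x0 E z where "(k, x0, E) \<in> \<Phi>" and z: "z \<in> ineqs (H k)"
    "\<And>j y. \<lbrakk>j \<in> I; y \<in> ineqs (H j)\<rbrakk> \<Longrightarrow> scaled j m (1 / real n) y \<le> scaled k m (1 / real n) z"
    using \<Phi>(2)[of m "1 / real n"] unfolding optimal_def by blast
  then have "k \<in> I" using \<Phi>(1) by blast
  then have "delta_hat P \<delta> m n = (real n)\<^sup>2 * scaled k m (1 / real n) z"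
    using delta_hat_eq[OF assms(1) _ z] by blast
  then show ?thesis using z(2)[OF assms(2,3)] by (simp add: mult_left_mono)
qed

text \<open>Multiplying by \<open>n\<^sup>2\<close> turns a quadratic in \<open>t = 1 / n\<close>
  into one in \<open>n\<close> with the coefficients reversed, so the value at \<open>t = 0\<close>
  becomes the coefficient of \<open>n\<^sup>2\<close>. Invertibility enters only the last clause, so
  that a polynomial can be chosen for every candidate.\<close>

lemma candidate_polynomial:
  obtains y0 y1 p where "degree p \<le> 2" "coeff p 2 = lead i m y0"
    "\<And>n. n > 0 \<Longrightarrow> poly p n = n\<^sup>2 * scaled i m (1 / n) (y0 + (1 / n) *\<^sub>R y1)"
    "\<And>t x. det (kkt_matrix E (A i m)) \<noteq> 0 \<Longrightarrow> kkt_matrix E (A i m) *v (x - x0) =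
      kkt_rhs E x0 (b i m + t *\<^sub>R e i m) (A i m) \<Longrightarrow> x = y0 + t *\<^sub>R y1"
proof -
  obtain y0 y1 where y: "\<And>t x. det (kkt_matrix E (A i m)) \<noteq> 0 \<Longrightarrow> kkt_matrix E (A i m) *v (x - x0) =
      kkt_rhs E x0 (b i m + t *\<^sub>R e i m) (A i m) \<longleftrightarrow> x = y0 + t *\<^sub>R y1"
    using kkt_solution_affine[of E "A i m" x0 "b i m" "e i m"] by metis
  obtain c1 c2 where c: "\<And>t. scaled i m t (y0 + t *\<^sub>R y1) = lead i m y0 + t * c1 + t\<^sup>2 * c2"
    unfolding scaled_def lead_def
    using quad_along_line[of "a i m" "d i m" "f i m" "b i m" "e i m" "A i m" y0 y1] by metis
  show thesis
  proof (rule that[of "[:c2, c1, lead i m y0:]" y0 y1])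
    show "poly [:c2, c1, lead i m y0:] n = n\<^sup>2 * scaled i m (1 / n) (y0 + (1 / n) *\<^sub>R y1)" if "n > 0" for n
      using that unfolding c by (simp add: power2_eq_square field_simps)
    show "coeff [:c2, c1, lead i m y0:] 2 = lead i m y0" by (simp add: numeral_2_eq_2)
  qed (use y in auto)
qed

text \<open>Every positive \<open>n\<close> has a feasible optimal candidate and there are finitely
  many, so one, \<phi>, is optimal infinitely often. If it failed infinitely often, some \<psi>
  would exceed it infinitely often; feasibility of \<psi> and the sign of the difference of two
  polynomials are eventually constant, so \<psi> would exceed \<phi> for all large \<open>n\<close>,
  against the choice of \<phi>.\<close>

lemma delta_hat_eventually_quadratic:
  obtains p i y where "eventually_quadratic (delta_hat P \<delta> m) p" "i \<in> I" "y \<in> ineqs (H i)"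
    "coeff p 2 = lead i m y" "\<And>j z. \<lbrakk>j \<in> I; z \<in> ineqs (H j)\<rbrakk> \<Longrightarrow> lead j m z \<le> coeff p 2"
proof -
  obtain \<Phi> :: "('i \<times> (real ^ 'r) \<times> (real ^ 'r ^ 'r)) set" where \<Phi>: "finite \<Phi>"
    "\<And>i x0 E. (i, x0, E) \<in> \<Phi> \<Longrightarrow> i \<in> I"
    "\<And>m t. \<exists>i x0 E x. (i, x0, E) \<in> \<Phi> \<and> optimal i x0 E m t x"
    by (rule candidates) blast
  define R where "R i x0 E y0 y1 p \<longleftrightarrow> degree p \<le> 2 \<and> coeff p 2 = lead i m y0 \<and>
      (\<forall>n>0. poly p n = n\<^sup>2 * scaled i m (1 / n) (y0 + (1 / n) *\<^sub>R y1)) \<and>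
      (\<forall>t x. det (kkt_matrix E (A i m)) \<noteq> 0 \<longrightarrow> kkt_matrix E (A i m) *v (x - x0) =
        kkt_rhs E x0 (b i m + t *\<^sub>R e i m) (A i m) \<longrightarrow> x = y0 + t *\<^sub>R y1)"
    for i x0 E y0 y1 p
  have "\<exists>y0 y1 p. R i x0 E y0 y1 p" for i x0 E
    unfolding R_def by (rule candidate_polynomial[of i m E x0]) blast
  then obtain Y0 Y1 p where R: "\<And>i x0 E. R i x0 E (Y0 i x0 E) (Y1 i x0 E) (p i x0 E)" by metis
  have deg: "degree (p i x0 E) \<le> 2" and lead: "coeff (p i x0 E) 2 = lead i m (Y0 i x0 E)"
    and p: "n > 0 \<Longrightarrow> poly (p i x0 E) n = n\<^sup>2 * scaled i m (1 / n) (Y0 i x0 E + (1 / n) *\<^sub>R Y1 i x0 E)"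
    and Y: "det (kkt_matrix E (A i m)) \<noteq> 0 \<Longrightarrow> kkt_matrix E (A i m) *v (x - x0) =
        kkt_rhs E x0 (b i m + t *\<^sub>R e i m) (A i m) \<Longrightarrow> x = Y0 i x0 E + t *\<^sub>R Y1 i x0 E"
    for i x0 E n t x
    using R[of i x0 E] unfolding R_def by blast+
  define q where "q = (\<lambda>(i, x0, E). p i x0 E)"
  define ok where "ok = (\<lambda>(i, x0, E) n. Y0 i x0 E + (1 / real n) *\<^sub>R Y1 i x0 E \<in> ineqs (H i))"
  let ?g = "delta_hat P \<delta> m"
  have attained: "\<exists>\<phi>\<in>\<Phi>. ok \<phi> n \<and> ?g n = poly (q \<phi>) (real n)" if n: "n > 0" for n :: nat
  proof -
    obtain i x0 E x where x: "(i, x0, E) \<in> \<Phi>" "det (kkt_matrix E (A i m)) \<noteq> 0" "x \<in> ineqs (H i)"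
      "kkt_matrix E (A i m) *v (x - x0) = kkt_rhs E x0 (b i m + (1 / real n) *\<^sub>R e i m) (A i m)"
      and max: "\<forall>j\<in>I. \<forall>y\<in>ineqs (H j). scaled j m (1 / real n) y \<le> scaled i m (1 / real n) x"
      using \<Phi>(3)[of m "1 / real n"] unfolding optimal_def by (elim exE conjE)
    have xY: "x = Y0 i x0 E + (1 / real n) *\<^sub>R Y1 i x0 E" using Y[OF x(2,4)] .
    have "?g n = (real n)\<^sup>2 * scaled i m (1 / real n) x"
      using delta_hat_eq[OF n \<Phi>(2)[OF x(1)] x(3)] max by blast
    then have "ok (i, x0, E) n \<and> ?g n = poly (q (i, x0, E)) (real n)"
      using n x(3) xY p[of "real n" i x0 E] by (simp add: ok_def q_def)
    then show ?thesis using x(1) by blast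
  qed
  have below: "poly (q \<phi>) (real n) \<le> ?g n" if "\<phi> \<in> \<Phi>" "ok \<phi> n" "n > 0" for \<phi> and n :: nat
  proof -
    obtain i x0 E where \<phi>: "\<phi> = (i, x0, E)" by (cases \<phi>) auto
    show ?thesis
      using that delta_hat_ge[OF that(3), of i] \<Phi>(2)[of i x0 E] p[of "real n" i x0 E]
      by (simp add: \<phi> ok_def q_def)
  qed
  have ok_eventually: "\<forall>\<^sub>F n in sequentially. ok \<phi> n" if "\<exists>\<^sub>F n in sequentially. ok \<phi> n" for \<phi>
    using that convex_eventually_if_frequently[OF convex_ineqs] unfolding ok_def
    by (cases \<phi>) auto
  have pos: "\<forall>\<^sub>F n in sequentially. n > (0 :: nat)" by (rule eventually_gt_at_top)
  have "\<forall>\<^sub>F n in sequentially. \<exists>\<phi>\<in>\<Phi>. ok \<phi> n \<and> ?g n = poly (q \<phi>) (real n)"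
    using pos by eventually_elim (rule attained)
  then have "\<exists>\<^sub>F n in sequentially. \<exists>\<phi>\<in>\<Phi>. ok \<phi> n \<and> ?g n = poly (q \<phi>) (real n)"
    by (rule eventually_frequently[OF sequentially_bot])
  from frequently_bex_finite[OF \<Phi>(1) this]
  obtain \<phi> where \<phi>: "\<phi> \<in> \<Phi>" "\<exists>\<^sub>F n in sequentially. ok \<phi> n \<and> ?g n = poly (q \<phi>) (real n)"
    by blast
  then have ok_\<phi>: "\<forall>\<^sub>F n in sequentially. ok \<phi> n"
    by (intro ok_eventually) (auto elim: frequently_elim1)
  have eq: "\<forall>\<^sub>F n in sequentially. ?g n = poly (q \<phi>) (real n)"
  proof (rule ccontr)
    assume "\<not> ?thesis"
    then have "\<exists>\<^sub>F n in sequentially. ?g n \<noteq> poly (q \<phi>) (real n)"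
      by (simp add: not_eventually)
    then have "\<exists>\<^sub>F n in sequentially. (?g n \<noteq> poly (q \<phi>) (real n)) \<and> (ok \<phi> n \<and> n > 0)"
      using eventually_conj[OF ok_\<phi> pos] by (rule frequently_eventually_frequently)
    then have "\<exists>\<^sub>F n in sequentially. \<exists>\<psi>\<in>\<Phi>. ok \<psi> n \<and> poly (q \<psi> - q \<phi>) (real n) > 0"
    proof (rule frequently_elim1)
      fix n assume n: "?g n \<noteq> poly (q \<phi>) (real n) \<and> (ok \<phi> n \<and> n > 0)"
      obtain \<psi> where "\<psi> \<in> \<Phi>" "ok \<psi> n" "?g n = poly (q \<psi>) (real n)"
        using attained n by blast
      then show "\<exists>\<psi>\<in>\<Phi>. ok \<psi> n \<and> poly (q \<psi> - q \<phi>) (real n) > 0"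
        using n below[OF \<phi>(1), of n] by (intro bexI[of _ \<psi>]) auto
    qed
    from frequently_bex_finite[OF \<Phi>(1) this] obtain \<psi> where \<psi>: "\<psi> \<in> \<Phi>"
      "\<exists>\<^sub>F n in sequentially. ok \<psi> n \<and> poly (q \<psi> - q \<phi>) (real n) > 0"
      by blast
    have "\<forall>\<^sub>F n in sequentially. ok \<psi> n"
      using \<psi>(2) by (intro ok_eventually) (auto elim: frequently_elim1)
    moreover have "\<forall>\<^sub>F n in sequentially. poly (q \<psi> - q \<phi>) (real n) > 0"
      using \<psi>(2) by (intro eventually_poly_pos lead_coeff_pos_if_frequently) (auto elim: frequently_elim1)
    ultimately have "\<forall>\<^sub>F n in sequentially. \<not> (ok \<phi> n \<and> ?g n = poly (q \<phi>) (real n))"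
      using pos
    proof eventually_elim
      case (elim n)
      then show ?case using below[OF \<psi>(1) elim(1)] by auto
    qed
    then show False using \<phi>(2) by (simp add: frequently_def)
  qed
  obtain i x0 E where ixE: "\<phi> = (i, x0, E)" by (cases \<phi>) auto
  have i: "i \<in> I" using \<Phi>(2) \<phi>(1) ixE by blast
  have quadr: "eventually_quadratic ?g (q \<phi>)"
    using eq deg by (simp add: eventually_quadratic_def ixE q_def)
  show thesis
  proof (rule that[OF quadr i])
    \<comment> \<open>The winning candidates tend to \<open>Y0 i x0 E\<close>, and the piece is
      closed, so the coefficient of \<open>n\<^sup>2\<close> is attained as a value of
      \<open>lead\<close>.\<close>
    have "(\<lambda>n. Y0 i x0 E + (1 / real n) *\<^sub>R Y1 i x0 E) \<longlonglongrightarrow> Y0 i x0 E + 0 *\<^sub>R Y1 i x0 E"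
      by (intro tendsto_intros lim_1_over_n)
    moreover have "\<forall>\<^sub>F n in sequentially. Y0 i x0 E + (1 / real n) *\<^sub>R Y1 i x0 E \<in> ineqs (H i)"
      using ok_\<phi> by (simp add: ok_def ixE)
    ultimately show "Y0 i x0 E \<in> ineqs (H i)"
      using Lim_in_closed_set[OF closed_ineqs, of _ "H i" sequentially] by simp
    show "coeff (q \<phi>) 2 = lead i m (Y0 i x0 E)"
      by (simp add: q_def ixE lead)
    fix j z assume jz: "j \<in> I" "z \<in> ineqs (H j)"
    \<comment> \<open>\<open>?r\<close> is \<open>\<delta>\<close> along the ray through
      \<open>z\<close>; the maximum dominates it for all large \<open>n\<close>, which compares the
      coefficients of \<open>n\<^sup>2\<close>.\<close>
    let ?r = "[:f j m, d j m + e j m \<bullet> z, lead j m z:]"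
    have "\<forall>\<^sub>F n in sequentially. poly (q \<phi> - ?r) (real n) \<ge> 0"
      using eq pos
    proof eventually_elim
      case (elim n)
      have "poly ?r (real n) = \<delta> m (real n) (real n *\<^sub>R z)"
        using delta[OF jz, of "real n" m] elim(2) by (simp add: lead_def power2_eq_square algebra_simps)
      also have "\<dots> \<le> ?g n"
        using delta_hat_ge[OF elim(2) jz] delta_scaled[OF jz, of "real n"] elim(2) by simp
      finally show ?case using elim(1) by simp
    qed
    moreover have "degree (q \<phi> - ?r) \<le> 2"
      using deg[of i x0 E] by (intro degree_diff_le) (auto simp: q_def ixE)
    ultimately have "coeff (q \<phi> - ?r) 2 \<ge> 0" by (rule coeff2_nonneg_if_eventually[rotated])
    then show "lead j m z \<le> coeff (q \<phi>) 2" by (simp add: numeral_2_eq_2)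
  qed
qed

section \<open>\<open>js\<close> as a function of the parameter\<close>

lemma js_attained:
  obtains p i y where "eventually_quadratic (delta_hat P \<delta> m) p" "coeff p 2 = js P \<delta> m"
    "i \<in> I" "y \<in> ineqs (H i)" "js P \<delta> m = lead i m y"
    "\<And>j z. \<lbrakk>j \<in> I; z \<in> ineqs (H j)\<rbrakk> \<Longrightarrow> lead j m z \<le> js P \<delta> m"
proof (rule delta_hat_eventually_quadratic[of m])
  fix p i y assume p: "eventually_quadratic (delta_hat P \<delta> m) p" "i \<in> I" "y \<in> ineqs (H i)"
    "coeff p 2 = lead i m y" "\<And>j z. \<lbrakk>j \<in> I; z \<in> ineqs (H j)\<rbrakk> \<Longrightarrow> lead j m z \<le> coeff p 2"
  have "js P \<delta> m = coeff p 2" unfolding js_def using p(1) by (rule n2_coeff_eq)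
  then show thesis using that[OF p(1) _ p(2,3)] p(4,5) by simp
qed

lemma js_ge: "\<lbrakk>j \<in> I; z \<in> ineqs (H j)\<rbrakk> \<Longrightarrow> lead j m z \<le> js P \<delta> m"
  by (rule js_attained[of m]) blast

text \<open>Describes the graph by quantifiers over the pieces and polynomial comparisons, which
  makes it accessible to quantifier elimination.\<close>

lemma js_eq_iff:
  "js P \<delta> m = s \<longleftrightarrow> (\<exists>i\<in>I. \<exists>y. y \<in> ineqs (H i) \<and> lead i m y = s) \<and>
    (\<forall>i\<in>I. \<forall>y. y \<in> ineqs (H i) \<longrightarrow> lead i m y \<le> s)"
proof -
  obtain i y where iy: "i \<in> I" "y \<in> ineqs (H i)" "js P \<delta> m = lead i m y"
    by (rule js_attained)
  show ?thesis
  proof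
    assume "js P \<delta> m = s"
    then show "(\<exists>i\<in>I. \<exists>y. y \<in> ineqs (H i) \<and> lead i m y = s) \<and>
        (\<forall>i\<in>I. \<forall>y. y \<in> ineqs (H i) \<longrightarrow> lead i m y \<le> s)"
      using iy js_ge by metis
  next
    assume "(\<exists>i\<in>I. \<exists>y. y \<in> ineqs (H i) \<and> lead i m y = s) \<and>
        (\<forall>i\<in>I. \<forall>y. y \<in> ineqs (H i) \<longrightarrow> lead i m y \<le> s)"
    then show "js P \<delta> m = s" using iy js_ge by (metis order_antisym)
  qed
qed

lemma delta2_eq:
  assumes "i \<in> I" "x \<in> ineqs (H i)"
  shows "delta2 \<delta> m x = lead i m x"
proof -
  have "\<forall>\<^sub>F n in sequentially. \<delta> m (real n) (real n *\<^sub>R x) =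
      poly [:f i m, d i m + e i m \<bullet> x, lead i m x:] (real n)"
    using eventually_gt_at_top[of "0 :: nat"]
    by eventually_elim (use assms delta in \<open>simp add: lead_def power2_eq_square algebra_simps\<close>)
  then have "eventually_quadratic (\<lambda>n. \<delta> m (real n) (real n *\<^sub>R x))
      [:f i m, d i m + e i m \<bullet> x, lead i m x:]"
    by (simp add: eventually_quadratic_def)
  from n2_coeff_eq[OF this] show ?thesis by (simp add: delta2_def numeral_2_eq_2)
qed

lemma polynomial_function_lead:
  assumes "i \<in> I" "polynomial_function \<mu>" "polynomial_function \<xi>"
  shows "polynomial_function (\<lambda>z. lead i (\<mu> z) (\<xi> z))"
  unfolding lead_def
  using polynomial_function_comp[OF poly_a[OF assms(1)] assms(2)]
    polynomial_function_comp[OF poly_b[OF assms(1)] assms(2)]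
    polynomial_function_comp[OF poly_A[OF assms(1)] assms(2)]
  by (intro polynomial_function_quad assms(3))

lemma sign_definable_ineqs:
  fixes \<xi> :: "'b::real_normed_vector \<Rightarrow> real ^ 'r"
  assumes "i \<in> I" "polynomial_function \<xi>"
  shows "sign_definable {z. \<xi> z \<in> ineqs (H i)}"
  unfolding ineqs_def mem_Collect_eq
  by (intro sign_definable_finite_ball finite_H[OF assms(1)] sign_definable_le
      polynomial_function_intros assms(2))

lemma sign_definable_js_graph: "sign_definable {(m, s). js P \<delta> m = s}"
proof -
  have "sign_definable {z. js P \<delta> (fst z) = snd z}"
    unfolding js_eq_iff
    by (intro sign_definable_conj sign_definable_finite_bex sign_definable_finite_ball finite_I
        sign_definable_ex sign_definable_all sign_definable_imp sign_definable_ineqs sign_definable_eq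
        sign_definable_le polynomial_function_lead polynomial_function_intros)
  then show ?thesis by (simp add: case_prod_unfold)
qed

lemma piecewise_rational_js: "piecewise_rational (js P \<delta>)"
proof -
  obtain \<Phi> :: "('i \<times> (real ^ 'r) \<times> (real ^ 'r ^ 'r)) set" where \<Phi>: "finite \<Phi>"
    "\<And>i x0 E. (i, x0, E) \<in> \<Phi> \<Longrightarrow> i \<in> I"
    "\<And>m t. \<exists>i x0 E x. (i, x0, E) \<in> \<Phi> \<and> optimal i x0 E m t x"
    by (rule candidates) blast
  define D where "D = (\<lambda>(i, x0 :: real ^ 'r, E) m. det (kkt_matrix E (A i m)))"
  define N where "N = (\<lambda>(i, x0, E) m. quad ((D (i, x0, E) m)\<^sup>2 * a i m) (D (i, x0, E) m *\<^sub>R b i m) (A i m)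
    (D (i, x0, E) m *\<^sub>R x0 + kkt_num E x0 (b i m) (A i m)))"
  \<comment> \<open>A sector is where \<open>js\<close> agrees with the rational function of the
    candidate, rather than where the candidate is feasible and optimal; definability then follows
    from that of the graph, and the formula for \<open>js\<close> holds by construction.\<close>
  define S where "S \<phi> = {m. D \<phi> m \<noteq> 0 \<and> (\<exists>s. (m, s) \<in> {(m, s). js P \<delta> m = s} \<and> (D \<phi> m)\<^sup>2 * s = N \<phi> m)}" for \<phi>
  have poly: "polynomial_function (D \<phi>)" "polynomial_function (N \<phi>)" if "\<phi> \<in> \<Phi>" for \<phi>
  proof -
    obtain i x0 E where \<phi>: "\<phi> = (i, x0, E)" by (cases \<phi>) auto
    then have i: "i \<in> I" using \<Phi>(2) that by blast
    show D: "polynomial_function (D \<phi>)"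
      unfolding D_def \<phi> using i
      by (auto intro!: polynomial_function_det polynomial_function_kkt_matrix poly_A)
    then have "polynomial_function (\<lambda>m. D (i, x0, E) m)" by (simp add: \<phi>)
    then show "polynomial_function (N \<phi>)"
      unfolding N_def \<phi> prod.case
      by (intro polynomial_function_quad polynomial_function_intros polynomial_function_kkt_num
          poly_a poly_b poly_A i)
  qed
  show ?thesis
    unfolding piecewise_rational_def
  proof (intro exI[of _ "S ` \<Phi>"] conjI ballI)
    show "finite (S ` \<Phi>)" using \<Phi>(1) by simp
    have "m \<in> \<Union>(S ` \<Phi>)" for m
    proof -
      \<comment> \<open>At \<open>t = 0\<close> the candidate maximizes the leading forms
        themselves.\<close>
      obtain i x0 E x where x: "(i, x0, E) \<in> \<Phi>" "det (kkt_matrix E (A i m)) \<noteq> 0" "x \<in> ineqs (H i)"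
        "kkt_matrix E (A i m) *v (x - x0) = kkt_rhs E x0 (b i m) (A i m)"
        "\<forall>j\<in>I. \<forall>y\<in>ineqs (H j). lead j m y \<le> lead i m x"
        using \<Phi>(3)[of m 0] unfolding optimal_def scaled_0 by (elim exE conjE) simp
      have js: "js P \<delta> m = lead i m x"
        unfolding js_eq_iff using x(3,5) \<Phi>(2)[OF x(1)] by blast
      have "x = x0 + (1 / D (i, x0, E) m) *\<^sub>R kkt_num E x0 (b i m) (A i m)"
        using x(4) unfolding kkt_solution[OF x(2)] by (simp add: D_def)
      then have "lead i m x = N (i, x0, E) m / (D (i, x0, E) m)\<^sup>2"
        unfolding lead_def using quad_rational_point[of "D (i, x0, E) m"] x(2)
        by (simp add: N_def D_def)
      then have "m \<in> S (i, x0, E)"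
        using js x(2) by (simp add: S_def D_def)
      then show ?thesis using x(1) by blast
    qed
    then show "\<Union>(S ` \<Phi>) = UNIV" by blast
  next
    fix T assume "T \<in> S ` \<Phi>"
    then obtain \<phi> where \<phi>: "\<phi> \<in> \<Phi>" "T = S \<phi>" by blast
    have "sign_definable (S \<phi>)"
      unfolding S_def
      by (intro sign_definable_conj sign_definable_not sign_definable_eq sign_definable_ex
          sign_definable_mem[OF sign_definable_js_graph] polynomial_function_intros
          polynomial_function_comp[OF poly(1)[OF \<phi>(1)]] polynomial_function_comp[OF poly(2)[OF \<phi>(1)]])
    then show "semialgebraic T" using \<phi>(2) semialgebraic_if_sign_definable by simp
    have "(D \<phi> m)\<^sup>2 \<noteq> 0 \<and> js P \<delta> m = N \<phi> m / (D \<phi> m)\<^sup>2" if "m \<in> T" for m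
      using that unfolding \<phi>(2) S_def by (auto simp: field_simps)
    moreover have "real_polynomial_function (\<lambda>m. (D \<phi> m)\<^sup>2)" "real_polynomial_function (N \<phi>)"
      using poly[OF \<phi>(1)] by (auto simp: real_polynomial_function_eq polynomial_function_power2)
    ultimately show "\<exists>p q. real_polynomial_function p \<and> real_polynomial_function q \<and>
        (\<forall>m\<in>T. q m \<noteq> 0 \<and> js P \<delta> m = p m / q m)"
      by blast
  qed
qed

text \<open>As a supremum of continuous functions \<open>js\<close> is lower semicontinuous. The
  supremum is attained on finitely many compact pieces, so the sets
  \<open>{m. s \<le> js P \<delta> m}\<close> are finite unions of projections of closed sets along
  compact ones, hence closed.\<close>

lemma continuous_on_js: "continuous_on UNIV (js P \<delta>)"
proof -
  have cont: "continuous_on UNIV (\<lambda>z. lead i (snd z) (fst z))" "continuous_on UNIV (\<lambda>m. lead i m x)"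
    if "i \<in> I" for i x
    using polynomial_function_lead[OF that] polynomial_function_intros
    by (auto intro!: continuous_on_polymonial_function)
  have lower: "open {m. s < js P \<delta> m}" for s
  proof -
    have "{m. s < js P \<delta> m} = (\<Union>i\<in>I. \<Union>x\<in>ineqs (H i). {m. s < lead i m x})"
    proof (intro set_eqI iffI)
      fix m assume "m \<in> {m. s < js P \<delta> m}"
      moreover obtain i y where "i \<in> I" "y \<in> ineqs (H i)" "js P \<delta> m = lead i m y"
        by (rule js_attained)
      ultimately show "m \<in> (\<Union>i\<in>I. \<Union>x\<in>ineqs (H i). {m. s < lead i m x})" by auto
    next
      fix m assume "m \<in> (\<Union>i\<in>I. \<Union>x\<in>ineqs (H i). {m. s < lead i m x})"
      then show "m \<in> {m. s < js P \<delta> m}"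
        using js_ge order_less_le_trans by fastforce
    qed
    moreover have "open {m. s < lead i m x}" if "i \<in> I" for i x
      using cont(2)[OF that] by (intro open_Collect_less continuous_on_const)
    then have "open (\<Union>i\<in>I. \<Union>x\<in>ineqs (H i). {m. s < lead i m x})"
      by (intro open_UN ballI)
    ultimately show ?thesis by simp
  qed
  have upper: "closed {m. s \<le> js P \<delta> m}" for s
  proof -
    have "{m. s \<le> js P \<delta> m} = (\<Union>i\<in>I. {m. \<exists>x. x \<in> ineqs (H i) \<and> (x, m) \<in> {z. s \<le> lead i (snd z) (fst z)}})"
    proof (intro set_eqI iffI)
      fix m assume "m \<in> {m. s \<le> js P \<delta> m}"
      moreover obtain i y where "i \<in> I" "y \<in> ineqs (H i)" "js P \<delta> m = lead i m y"
        by (rule js_attained)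
      ultimately show "m \<in> (\<Union>i\<in>I. {m. \<exists>x. x \<in> ineqs (H i) \<and> (x, m) \<in> {z. s \<le> lead i (snd z) (fst z)}})"
        by auto
    next
      fix m assume "m \<in> (\<Union>i\<in>I. {m. \<exists>x. x \<in> ineqs (H i) \<and> (x, m) \<in> {z. s \<le> lead i (snd z) (fst z)}})"
      then show "m \<in> {m. s \<le> js P \<delta> m}"
        using js_ge order_trans by fastforce
    qed
    moreover have "closed {m. \<exists>x. x \<in> ineqs (H i) \<and> (x, m) \<in> {z. s \<le> lead i (snd z) (fst z)}}"
      if "i \<in> I" for i
    proof (rule closed_compact_projection)
      show "compact (ineqs (H i))"
        using bounded_H[OF that] closed_ineqs compact_eq_bounded_closed by blast
      show "closed {z. s \<le> lead i (snd z) (fst z)}"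
        using cont(1)[OF that] by (intro closed_Collect_le continuous_on_const)
    qed
    ultimately show ?thesis using finite_I by auto
  qed
  have "(js P \<delta> \<longlongrightarrow> js P \<delta> m) (at m)" for m
  proof (rule order_tendstoI)
    fix s assume "s < js P \<delta> m"
    then show "\<forall>\<^sub>F x in at m. s < js P \<delta> x"
      using eventually_at_in_open'[OF lower[of s], of m] by simp
  next
    fix s assume "js P \<delta> m < s"
    moreover have "{m. js P \<delta> m < s} = - {m. s \<le> js P \<delta> m}" by auto
    then have "open {m. js P \<delta> m < s}" using open_Compl[OF upper[of s]] by simp
    ultimately show "\<forall>\<^sub>F x in at m. js P \<delta> x < s"
      using eventually_at_in_open'[of "{m. js P \<delta> m < s}" m] by simp
  qed
  then show ?thesis by (simp add: continuous_on_eq_continuous_at isCont_def)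
qed

lemma js_properties:
  "(\<forall>m. \<exists>p. eventually_quadratic (delta_hat P \<delta> m) p \<and> coeff p 2 = js P \<delta> m)
    \<and> (\<forall>m. js P \<delta> m \<in> delta2 \<delta> m ` P \<and> (\<forall>x\<in>P. delta2 \<delta> m x \<le> js P \<delta> m))
    \<and> piecewise_rational (js P \<delta>)
    \<and> closed (corner_locus (js P \<delta>))
    \<and> semialgebraic (corner_locus (js P \<delta>))
    \<and> semialg_dim (corner_locus (js P \<delta>)) \<le> CARD('r) - 1
    \<and> semialgebraic (nondiff_set (js P \<delta>))
    \<and> continuous_on UNIV (js P \<delta>)"
proof (intro conjI allI)
  fix m
  show "\<exists>p. eventually_quadratic (delta_hat P \<delta> m) p \<and> coeff p 2 = js P \<delta> m"
    by (rule js_attained[of m]) blast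
  obtain i y where iy: "i \<in> I" "y \<in> ineqs (H i)" "js P \<delta> m = lead i m y"
    by (rule js_attained)
  then show "js P \<delta> m \<in> delta2 \<delta> m ` P"
    using delta2_eq[OF iy(1,2)] P_eq by (metis UN_I imageI)
  show "\<forall>x\<in>P. delta2 \<delta> m x \<le> js P \<delta> m"
    using delta2_eq js_ge P_eq by auto
next
  have nondiff: "sign_definable (nondiff_set (js P \<delta>))"
    using sign_definable_js_graph by (rule sign_definable_nondiff_set)
  then show "semialgebraic (nondiff_set (js P \<delta>))"
    by (rule semialgebraic_if_sign_definable)
  show "semialgebraic (corner_locus (js P \<delta>))"
    unfolding corner_locus_eq_closure
    using nondiff by (intro semialgebraic_if_sign_definable sign_definable_closure)
  show "closed (corner_locus (js P \<delta>))"
    unfolding corner_locus_eq_closure by (rule closed_closure)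
  show "semialg_dim (corner_locus (js P \<delta>)) \<le> CARD('r) - 1"
    using piecewise_rational_js
    by (intro semialg_dim_less_if_no_interior piecewise_rational_interior_corner_locus)
qed (rule piecewise_rational_js, rule continuous_on_js)

end

section \<open>Passage from cones to polytopes\<close>

lemma ineqs_Un: "ineqs (H \<union> K) = ineqs H \<inter> ineqs K"
  by (auto simp: ineqs_def)

text \<open>Substituting \<open>n *\<^sub>R x\<close> for \<open>x\<close> makes all quadratic terms
  multiples of \<open>n\<^sup>2\<close> and all linear terms multiples of \<open>n\<close>, which
  separates the leading part.\<close>

lemma param_quadratic_quad:
  assumes "param_quadratic q"
  obtains a b A d e f where "polynomial_function a" "polynomial_function b"
    "\<And>k l. polynomial_function (\<lambda>m. A m $ k $ l)"
    "\<And>m n x. q m n (n *\<^sub>R x) = n\<^sup>2 * quad (a m) (b m) (A m) x + n * (d m + e m \<bullet> x) + f m"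
proof -
  obtain a b c d e f where poly: "real_polynomial_function a" "\<forall>i. real_polynomial_function (b i)"
    "\<forall>i j. real_polynomial_function (c i j)" and
    q: "\<forall>m n x. q m n x = a m * n\<^sup>2 + (\<Sum>i\<in>UNIV. b i m * n * x $ i)
      + (\<Sum>i\<in>UNIV. \<Sum>j\<in>UNIV. c i j m * x $ i * x $ j) + d m * n + (\<Sum>i\<in>UNIV. e i m * x $ i) + f m"
    using assms unfolding param_quadratic_def by (elim exE conjE)
  show thesis
  proof (rule that)
    show "polynomial_function a" using poly(1) by (simp add: real_polynomial_function_eq)
    show "polynomial_function (\<lambda>m. \<chi> i. b i m)"
      by (rule polynomial_function_vec) (use poly(2) in \<open>simp add: real_polynomial_function_eq\<close>)
    show "polynomial_function (\<lambda>m. (\<chi> i j. c i j m) $ k $ l)" for k l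
      using poly(3) by (simp add: real_polynomial_function_eq)
    show "q m n (n *\<^sub>R x) = n\<^sup>2 * quad (a m) (\<chi> i. b i m) (\<chi> i j. c i j m) x
        + n * (d m + (\<chi> i. e i m) \<bullet> x) + f m" for m n x
      unfolding q[rule_format]
      by (simp add: quad_def inner_vec_def matrix_vector_mult_def sum_distrib_left
          power2_eq_square algebra_simps)
  qed
qed

theorem theorem4p1:
  fixes P :: "(real ^ 'r) set"
    and \<delta> :: "real ^ 'r \<Rightarrow> real \<Rightarrow> real ^ 'r \<Rightarrow> real"
  assumes "rational_polytope P" and "P \<noteq> {}"
    and "piecewise_quadratic P \<delta>"
  shows "(\<forall>m. \<exists>p. eventually_quadratic (delta_hat P \<delta> m) p \<and> coeff p 2 = js P \<delta> m)
    \<and> (\<forall>m. js P \<delta> m \<in> delta2 \<delta> m ` P \<and> (\<forall>x\<in>P. delta2 \<delta> m x \<le> js P \<delta> m))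
    \<and> piecewise_rational (js P \<delta>)
    \<and> closed (corner_locus (js P \<delta>))
    \<and> semialgebraic (corner_locus (js P \<delta>))
    \<and> semialg_dim (corner_locus (js P \<delta>)) \<le> CARD('r) - 1
    \<and> semialgebraic (nondiff_set (js P \<delta>))
    \<and> continuous_on UNIV (js P \<delta>)"
proof -
  have polytope: "polytope P"
    using assms(1) unfolding rational_polytope_def polytope_def by blast
  obtain HP where HP: "finite HP" "\<And>x. x \<in> P \<longleftrightarrow> (\<forall>h\<in>HP. fst h \<bullet> x \<le> snd h)"
    using polyhedron_inequalities[OF polytope_imp_polyhedron[OF polytope]] by blast
  have P: "P = ineqs HP" by (rule set_eqI) (simp only: ineqs_def HP(2) mem_Collect_eq)
  obtain \<C> where fin: "finite \<C>" and \<C>: "\<forall>C\<in>\<C>. polyhedron C \<and> cone C"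
    and cover: "\<forall>n>0. \<forall>x\<in>(*\<^sub>R) n ` P. (n, x) \<in> \<Union>\<C>"
    and quadr: "\<forall>C\<in>\<C>. \<exists>q. param_quadratic q \<and>
      (\<forall>m. \<forall>n>0. \<forall>x\<in>(*\<^sub>R) n ` P. (n, x) \<in> C \<longrightarrow> \<delta> m n x = q m n x)"
    using assms(3) unfolding piecewise_quadratic_def by (elim exE conjE)
  define piece where "piece C H a b A d e f \<longleftrightarrow> finite H \<and> {x. (1, x) \<in> C} = ineqs H \<and>
      polynomial_function a \<and> polynomial_function b \<and> (\<forall>k l. polynomial_function (\<lambda>m. A m $ k $ l)) \<and>
      (\<forall>x n m. x \<in> P \<longrightarrow> (1, x) \<in> C \<longrightarrow> n > 0 \<longrightarrow> \<delta> m n (n *\<^sub>R x) =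
        n\<^sup>2 * quad (a m) (b m) (A m) x + n * (d m + e m \<bullet> x) + f m)"
    for C :: "(real \<times> (real ^ 'r)) set" and H a b A d e f
  have "\<exists>H a b A d e f. piece C H a b A d e f" if C: "C \<in> \<C>" for C
  proof -
    obtain H where H: "finite H" "{x. (1, x) \<in> C} = ineqs H"
      using polyhedron_slice_ineqs \<C> C by metis
    obtain q where q: "param_quadratic q"
      "\<forall>m. \<forall>n>0. \<forall>x\<in>(*\<^sub>R) n ` P. (n, x) \<in> C \<longrightarrow> \<delta> m n x = q m n x"
      using bspec[OF quadr C] by (elim exE conjE)
    obtain a b A d e f where c: "polynomial_function a" "polynomial_function b"
      "\<And>k l. polynomial_function (\<lambda>m. A m $ k $ l)"
      "\<And>m n x. q m n (n *\<^sub>R x) = n\<^sup>2 * quad (a m) (b m) (A m) x + n * (d m + e m \<bullet> x) + f m"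
      using param_quadratic_quad[OF q(1)] by metis
    have "\<delta> m n (n *\<^sub>R x) = n\<^sup>2 * quad (a m) (b m) (A m) x + n * (d m + e m \<bullet> x) + f m"
      if x: "x \<in> P" "(1, x) \<in> C" "n > 0" for x n m
    proof -
      \<comment> \<open>Homogeneity of the cone moves membership from height 1 to height
        \<open>n\<close>.\<close>
      have "n *\<^sub>R (1, x) \<in> C" using \<C> C x(2,3) unfolding cone_def by (meson less_imp_le)
      then have "\<delta> m n (n *\<^sub>R x) = q m n (n *\<^sub>R x)" using q(2) x(1,3) by simp
      then show ?thesis unfolding c(4) .
    qed
    then have "piece C H a b A d e f" using H c(1-3) unfolding piece_def by blast
    then show ?thesis by blast
  qed
  then obtain H a b A d e f where piece:
    "\<And>C. C \<in> \<C> \<Longrightarrow> piece C (H C) (a C) (b C) (A C) (d C) (e C) (f C)"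
    by metis
  have H: "finite (H C)" "{x. (1, x) \<in> C} = ineqs (H C)"
    and poly: "polynomial_function (a C)" "polynomial_function (b C)"
      "polynomial_function (\<lambda>m. A C m $ k $ l)"
    and \<delta>: "\<lbrakk>x \<in> P; (1, x) \<in> C; n > 0\<rbrakk> \<Longrightarrow> \<delta> m n (n *\<^sub>R x) =
        n\<^sup>2 * quad (a C m) (b C m) (A C m) x + n * (d C m + e C m \<bullet> x) + f C m"
    if "C \<in> \<C>" for C x n m k l
    using piece[OF that] unfolding piece_def by blast+
  \<comment> \<open>Cones whose slice misses \<open>P\<close> are dropped, since there is no maximum
    over an empty piece.\<close>
  define I where "I = {C\<in>\<C>. ineqs (HP \<union> H C) \<noteq> {}}"
  have slice: "x \<in> ineqs (HP \<union> H C) \<longleftrightarrow> x \<in> P \<and> (1, x) \<in> C" if "C \<in> \<C>" for C x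
    using H(2)[OF that] P by (auto simp: ineqs_Un)
  have P_eq: "P = (\<Union>C\<in>I. ineqs (HP \<union> H C))"
  proof (intro set_eqI iffI)
    fix x assume x: "x \<in> P"
    have "x \<in> (*\<^sub>R) 1 ` P" using x by simp
    then obtain C where C: "C \<in> \<C>" "(1, x) \<in> C" using cover zero_less_one by blast
    then have "x \<in> ineqs (HP \<union> H C)" using slice x by blast
    then show "x \<in> (\<Union>C\<in>I. ineqs (HP \<union> H C))" using C(1) unfolding I_def by blast
  qed (use slice in \<open>auto simp: I_def\<close>)
  interpret quadratic_pieces P \<delta> I "\<lambda>C. HP \<union> H C" a b A d e f
  proof
    show "finite I" using fin by (simp add: I_def)
    show "I \<noteq> {}" using P_eq assms(2) by auto
    fix C assume "C \<in> I"
    then have C: "C \<in> \<C>" "ineqs (HP \<union> H C) \<noteq> {}" by (auto simp: I_def)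
    show "finite (HP \<union> H C)" using HP(1) H(1) C(1) by simp
    show "bounded (ineqs (HP \<union> H C))"
      using polytope_imp_bounded[OF polytope] by (rule bounded_subset) (use P in \<open>auto simp: ineqs_Un\<close>)
    show "ineqs (HP \<union> H C) \<noteq> {}" by (rule C(2))
    show "polynomial_function (a C)" "polynomial_function (b C)"
      "polynomial_function (\<lambda>m. A C m $ k $ l)" for k l
      using poly C(1) by blast+
    show "\<delta> m n (n *\<^sub>R x) = n\<^sup>2 * quad (a C m) (b C m) (A C m) x + n * (d C m + e C m \<bullet> x) + f C m"
      if "x \<in> ineqs (HP \<union> H C)" "n > 0" for x n m
      using \<delta> slice C(1) that by blast
  qed (rule P_eq)
  show ?thesis by (rule js_properties)
qed

end
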